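(* Let $R$ be a left noetherian ring, $S$ a right noetherian ring, and ${}_RU$ a generalized tilting left $R$-module with $S=\mathrm{End}({}_RU)$. If the injective dimension of the left $R$-module ${}_RU$ and the injective dimension of the right $S$-module $U_S$ are both finite, then they are equal: $\mathrm{l.id}_R(U)=\mathrm{r.id}_S(U)$.
   Context: $\mathrm{mod}\,R$ denotes the category of finitely generated left $R$-modules. A module ${}_RU\in\mathrm{mod}\,R$ is selforthogonal if $\mathrm{Ext}_R^i(U,U)=0$ for all $i\ge 1$. $\mathrm{gen}^*({}_RR)$ is the class of $X\in\mathrm{mod}\,R$ admitting an exact sequence $\cdots\to P_1\to P_0\to X\to 0$ with all $P_i$ finitely generated projective. $\mathrm{add}\,{}_RU$ is the full subcategory of $\mathrm{mod}\,R$ of modules isomorphic to direct summands of finite direct sums of copies of $U$. A selforthogonal module ${}_RU\in\mathrm{gen}^*({}_RR)$ is a generalized tilting (Wakamatsu tilting) module if there is an exact sequence $0\to {}_RR\to U_0\to U_1\to\cdots$ with all $U_i\in\mathrm{add}\,{}_RU$ that remains exact after applying $\mathrm{Hom}_R(-,{}_RU)$. Endomorphisms of ${}_RU$ act on the right, so $U$ is an $(R,S)$-bimodule ${}_RU_S$. (Known fact, Wakamatsu: ${}_RU$ is generalized tilting with $S=\mathrm{End}({}_RU)$ iff $U_S$ is generalized tilting with $R=\mathrm{End}(U_S)$ iff ${}_RU_S$ is faithfully balanced, i.e. the natural maps $R\to\mathrm{End}(U_S)$ and $S\to\mathrm{End}({}_RU)^{op}$ are isomorphisms, and selforthogonal on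 both sides, with ${}_RU\in\mathrm{gen}^*({}_RR)$ and $U_S\in\mathrm{gen}^*(S_S)$.) $\mathrm{l.id}_R$ and $\mathrm{r.id}_S$ denote injective dimension of left $R$-modules and right $S$-modules respectively. *)

theory Defs
  imports "HOL-Algebra.Module" "HOL-Algebra.AbelCoset" "HOL-Library.Extended_Nat"
begin

text \<open>
  Left modules over a not necessarily commutative ring. The library locale \<open>module\<close> requires a
  commutative ring, but its record type and its locale \<open>submodule\<close> do not, and are reused.
  The fields \<open>mult\<close> and \<open>one\<close> that a module record inherits from \<open>ring\<close> are irrelevant.
\<close>

locale left_module = R?: ring R + M?: abelian_group M
  for R :: "('r, 'a) ring_scheme" (structure) and M :: "('r, 'm, 'b) module_scheme" (structure) +
  assumes smult_closed:
      "\<lbrakk>a \<in> carrier R; x \<in> carrier M\<rbrakk> \<Longrightarrow> a \<odot>\<^bsub>M\<^esub> x \<in> carrier M"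
    and smult_l_distr:
      "\<lbrakk>a \<in> carrier R; b \<in> carrier R; x \<in> carrier M\<rbrakk> \<Longrightarrow>
        (a \<oplus> b) \<odot>\<^bsub>M\<^esub> x = a \<odot>\<^bsub>M\<^esub> x \<oplus>\<^bsub>M\<^esub> b \<odot>\<^bsub>M\<^esub> x"
    and smult_r_distr:
      "\<lbrakk>a \<in> carrier R; x \<in> carrier M; y \<in> carrier M\<rbrakk> \<Longrightarrow>
        a \<odot>\<^bsub>M\<^esub> (x \<oplus>\<^bsub>M\<^esub> y) = a \<odot>\<^bsub>M\<^esub> x \<oplus>\<^bsub>M\<^esub> a \<odot>\<^bsub>M\<^esub> y"
    and smult_assoc:
      "\<lbrakk>a \<in> carrier R; b \<in> carrier R; x \<in> carrier M\<rbrakk> \<Longrightarrow>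
        (a \<otimes> b) \<odot>\<^bsub>M\<^esub> x = a \<odot>\<^bsub>M\<^esub> (b \<odot>\<^bsub>M\<^esub> x)"
    and smult_one:
      "x \<in> carrier M \<Longrightarrow> \<one> \<odot>\<^bsub>M\<^esub> x = x"

definition opposite :: "('r, 'a) ring_scheme \<Rightarrow> ('r, 'a) ring_scheme" where
  "opposite R = R\<lparr>mult := \<lambda>x y. y \<otimes>\<^bsub>R\<^esub> x\<rparr>"

text \<open>A right module is a left module over the opposite ring; its scalar multiplication
  \<open>s \<odot> x\<close> stands for \<open>x s\<close>.\<close>

definition right_module :: "('r, 'a) ring_scheme \<Rightarrow> ('r, 'm, 'b) module_scheme \<Rightarrow> bool" where
  "right_module S M \<longleftrightarrow> left_module (opposite S) M"

definition regular_module :: "('r, 'a) ring_scheme \<Rightarrow> ('r, 'r) module" where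
  "regular_module R =
    \<lparr>carrier = carrier R, mult = mult R, one = one R, zero = zero R, add = add R, smult = mult R\<rparr>"

definition finitely_generated ::
    "('r, 'a) ring_scheme \<Rightarrow> ('r, 'm, 'b) module_scheme \<Rightarrow> bool" where
  "finitely_generated R M \<longleftrightarrow>
    (\<exists>A. finite A \<and> A \<subseteq> carrier M \<and> carrier M = \<Inter> {N. submodule N R M \<and> A \<subseteq> N})"

definition left_noetherian :: "('r, 'a) ring_scheme \<Rightarrow> bool" where
  "left_noetherian R \<longleftrightarrow> ring R \<and>
    (\<forall>I. submodule I R (regular_module R) \<longrightarrow>
      finitely_generated R ((regular_module R)\<lparr>carrier := I\<rparr>))"

definition right_noetherian :: "('r, 'a) ring_scheme \<Rightarrow> bool" where
  "right_noetherian S \<longleftrightarrow> left_noetherian (opposite S)"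


text \<open>Homomorphisms are extensional functions, so that they form a set with the right equality.\<close>

definition mod_hom ::
    "('r, 'a) ring_scheme \<Rightarrow> ('r, 'm, 'b) module_scheme \<Rightarrow> ('r, 'n, 'c) module_scheme
      \<Rightarrow> ('m \<Rightarrow> 'n) set" where
  "mod_hom R M N = {f \<in> carrier M \<rightarrow>\<^sub>E carrier N.
    (\<forall>x \<in> carrier M. \<forall>y \<in> carrier M. f (x \<oplus>\<^bsub>M\<^esub> y) = f x \<oplus>\<^bsub>N\<^esub> f y) \<and>
    (\<forall>a \<in> carrier R. \<forall>x \<in> carrier M. f (a \<odot>\<^bsub>M\<^esub> x) = a \<odot>\<^bsub>N\<^esub> f x)}"

text \<open>The abelian group Hom(M, N). With \<open>N = M\<close> it is the ring of endomorphisms acting on the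
  right: the product \<open>f \<otimes> g\<close> is ``first \<open>f\<close>, then \<open>g\<close>''. (For \<open>N \<noteq> M\<close> there is no product.)\<close>

definition hom_group ::
    "('r, 'a) ring_scheme \<Rightarrow> ('r, 'm, 'b) module_scheme \<Rightarrow> ('r, 'n, 'c) module_scheme
      \<Rightarrow> ('m \<Rightarrow> 'n) ring" where
  "hom_group R M N =
    \<lparr>carrier = mod_hom R M N, mult = undefined, one = undefined,
     zero = (\<lambda>x \<in> carrier M. \<zero>\<^bsub>N\<^esub>), add = (\<lambda>f g. \<lambda>x \<in> carrier M. f x \<oplus>\<^bsub>N\<^esub> g x)\<rparr>"

definition endo_ring ::
    "('r, 'a) ring_scheme \<Rightarrow> ('r, 'm, 'b) module_scheme \<Rightarrow> ('m \<Rightarrow> 'm) ring" where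
  "endo_ring R M = (hom_group R M M)
    \<lparr>mult := \<lambda>f g. compose (carrier M) g f, one := \<lambda>x \<in> carrier M. x\<rparr>"

text \<open>\<open>M\<close> as a right module over its endomorphism ring.\<close>

definition endo_module :: "('r, 'm, 'b) module_scheme \<Rightarrow> ('m \<Rightarrow> 'm, 'm) module" where
  "endo_module M =
    \<lparr>carrier = carrier M, mult = mult M, one = one M, zero = zero M, add = add M,
     smult = (\<lambda>f x. f x)\<rparr>"

text \<open>The map Hom(B, N) \<open>\<rightarrow>\<close> Hom(A, N) induced by \<open>f : A \<rightarrow> B\<close>.\<close>

definition pullback :: "('r, 'm, 'b) module_scheme \<Rightarrow> ('m \<Rightarrow> 'n) \<Rightarrow> ('n \<Rightarrow> 'k) \<Rightarrow> ('m \<Rightarrow> 'k)" where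
  "pullback A f h = compose (carrier A) h f"

definition exact_at ::
    "('x, 'a) ring_scheme \<Rightarrow> ('x \<Rightarrow> 'y) \<Rightarrow> ('y, 'b) ring_scheme \<Rightarrow> ('y \<Rightarrow> 'z)
      \<Rightarrow> ('z, 'c) ring_scheme \<Rightarrow> bool" where
  "exact_at A f B g C \<longleftrightarrow> f ` carrier A = {y \<in> carrier B. g y = \<zero>\<^bsub>C\<^esub>}"


text \<open>
  HOL definitions cannot quantify over types, so ``all modules'' and ``all resolutions'' range over
  modules whose elements are drawn from the type below, for a module with elements in \<open>'m\<close> over a
  ring with elements in \<open>'r\<close>. It has cardinality \<open>k = (|'m| + aleph_0) ^ |'r|\<close>, which is large
  enough for every notion below to agree with the unrestricted one:

  \<^item> It contains copies of the ring and of \<open>M\<close>, hence suffices for Baer's criterion, and of the free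
    module on the set \<open>M\<close>, hence suffices to split that module's projection onto a projective \<open>M\<close>.

  \<^item> Free modules on sets of size at most \<open>k\<close>, and their submodules, have size at most \<open>k\<close>
    (as \<open>|'r| \<le> k\<close>); so \<open>M\<close> has a projective resolution in it. Modules in add M also fit.

  \<^item> An abelian group of size at most \<open>l\<close> embeds in a divisible group \<open>D\<close> of size at most
    \<open>l + aleph_0\<close>, and a module \<open>N\<close> with underlying group in \<open>D\<close> embeds in the injective module
    \<open>Hom_Z(R, D)\<close> of size at most \<open>(l + aleph_0) ^ |'r|\<close>. This is \<open>k\<close> for \<open>l = |'m|\<close> and again \<open>k\<close> for
    \<open>l = k\<close>; so \<open>M\<close> has injective resolutions in it, and if \<open>M\<close> has one of length \<open>n\<close> anywhere, then it
    has one of length \<open>n\<close> here (truncate at the \<open>n\<close>-th cosyzygy).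
\<close>

type_synonym ('r, 'm) univ = "'r \<Rightarrow> 'm + nat"

definition projective_module ::
    "('r, 'a) ring_scheme \<Rightarrow> ('r, 'm, 'b) module_scheme \<Rightarrow> bool" where
  "projective_module R P \<longleftrightarrow> left_module R P \<and>
    (\<forall>(A :: ('r, ('r, 'm) univ) module) (B :: ('r, ('r, 'm) univ) module) p g.
      left_module R A \<longrightarrow> left_module R B \<longrightarrow>
      p \<in> mod_hom R A B \<longrightarrow> p ` carrier A = carrier B \<longrightarrow> g \<in> mod_hom R P B \<longrightarrow>
      (\<exists>h \<in> mod_hom R P A. compose (carrier P) p h = g))"

definition injective_module ::
    "('r, 'a) ring_scheme \<Rightarrow> ('r, 'm, 'b) module_scheme \<Rightarrow> bool" where
  "injective_module R E \<longleftrightarrow> left_module R E \<and>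
    (\<forall>(A :: ('r, ('r, 'm) univ) module) (B :: ('r, ('r, 'm) univ) module) j g.
      left_module R A \<longrightarrow> left_module R B \<longrightarrow>
      j \<in> mod_hom R A B \<longrightarrow> inj_on j (carrier A) \<longrightarrow> g \<in> mod_hom R A E \<longrightarrow>
      (\<exists>h \<in> mod_hom R B E. compose (carrier A) h j = g))"

definition projective_resolution ::
    "('r, 'a) ring_scheme \<Rightarrow> (nat \<Rightarrow> ('r, 'p) module) \<Rightarrow> (nat \<Rightarrow> 'p \<Rightarrow> 'p) \<Rightarrow> ('p \<Rightarrow> 'm)
      \<Rightarrow> ('r, 'm, 'b) module_scheme \<Rightarrow> bool" where
  "projective_resolution R P d e M \<longleftrightarrow>
    (\<forall>i. projective_module R (P i)) \<and>
    (\<forall>i. d i \<in> mod_hom R (P (Suc i)) (P i)) \<and>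
    e \<in> mod_hom R (P 0) M \<and> e ` carrier (P 0) = carrier M \<and>
    exact_at (P 1) (d 0) (P 0) e M \<and>
    (\<forall>i. exact_at (P (Suc (Suc i))) (d (Suc i)) (P (Suc i)) (d i) (P i))"

definition injective_resolution ::
    "('r, 'a) ring_scheme \<Rightarrow> ('r, 'm, 'b) module_scheme \<Rightarrow> ('m \<Rightarrow> 'e) \<Rightarrow> (nat \<Rightarrow> ('r, 'e) module)
      \<Rightarrow> (nat \<Rightarrow> 'e \<Rightarrow> 'e) \<Rightarrow> bool" where
  "injective_resolution R M e I d \<longleftrightarrow>
    (\<forall>i. injective_module R (I i)) \<and>
    (\<forall>i. d i \<in> mod_hom R (I i) (I (Suc i))) \<and>
    e \<in> mod_hom R M (I 0) \<and> inj_on e (carrier M) \<and>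
    exact_at M e (I 0) (d 0) (I 1) \<and>
    (\<forall>i. exact_at (I i) (d i) (I (Suc i)) (d (Suc i)) (I (Suc (Suc i))))"

text \<open>The infimum of the empty set is \<open>\<infinity>\<close>; the zero module has dimension 0.\<close>

definition injective_dimension ::
    "('r, 'a) ring_scheme \<Rightarrow> ('r, 'm, 'b) module_scheme \<Rightarrow> enat" where
  "injective_dimension R M =
    Inf {enat n | n. \<exists>e (I :: nat \<Rightarrow> ('r, ('r, 'm) univ) module) d.
      left_module R M \<and> injective_resolution R M e I d \<and>
      (\<forall>i > n. carrier (I i) = {\<zero>\<^bsub>I i\<^esub>})}"

definition right_injective_dimension ::
    "('r, 'a) ring_scheme \<Rightarrow> ('r, 'm, 'b) module_scheme \<Rightarrow> enat" where
  "right_injective_dimension S M = injective_dimension (opposite S) M"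

text \<open>Vanishing of \<open>Ext\<^sup>i(M, N)\<close>, the \<open>i\<close>-th cohomology of
  \<open>0 \<rightarrow> Hom(P\<^sub>0, N) \<rightarrow> Hom(P\<^sub>1, N) \<rightarrow> \<dots>\<close>; it does not depend on the resolution.\<close>

definition Ext_zero ::
    "('r, 'a) ring_scheme \<Rightarrow> nat \<Rightarrow> ('r, 'm, 'b) module_scheme \<Rightarrow> ('r, 'n, 'c) module_scheme
      \<Rightarrow> bool" where
  "Ext_zero R i M N \<longleftrightarrow>
    (\<forall>(P :: nat \<Rightarrow> ('r, ('r, 'm) univ) module) d e. projective_resolution R P d e M \<longrightarrow>
      {h \<in> mod_hom R (P i) N.
        pullback (P (Suc i)) (d i) h = \<zero>\<^bsub>hom_group R (P (Suc i)) N\<^esub>} =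
      (case i of 0 \<Rightarrow> {\<zero>\<^bsub>hom_group R (P 0) N\<^esub>}
       | Suc j \<Rightarrow> pullback (P (Suc j)) (d j) ` mod_hom R (P j) N))"

definition selforthogonal ::
    "('r, 'a) ring_scheme \<Rightarrow> ('r, 'm, 'b) module_scheme \<Rightarrow> bool" where
  "selforthogonal R U \<longleftrightarrow>
    left_module R U \<and> finitely_generated R U \<and> (\<forall>i \<ge> 1. Ext_zero R i U U)"

definition in_gen_star ::
    "('r, 'a) ring_scheme \<Rightarrow> ('r, 'm, 'b) module_scheme \<Rightarrow> bool" where
  "in_gen_star R X \<longleftrightarrow>
    left_module R X \<and> finitely_generated R X \<and>
    (\<exists>(P :: nat \<Rightarrow> ('r, ('r, 'm) univ) module) d e.
      projective_resolution R P d e X \<and> (\<forall>i. finitely_generated R (P i)))"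

definition power_module :: "('r, 'm, 'b) module_scheme \<Rightarrow> nat \<Rightarrow> ('r, nat \<Rightarrow> 'm) module" where
  "power_module M n =
    \<lparr>carrier = {..<n} \<rightarrow>\<^sub>E carrier M, mult = undefined, one = undefined,
     zero = (\<lambda>i \<in> {..<n}. \<zero>\<^bsub>M\<^esub>), add = (\<lambda>f g. \<lambda>i \<in> {..<n}. f i \<oplus>\<^bsub>M\<^esub> g i),
     smult = (\<lambda>a f. \<lambda>i \<in> {..<n}. a \<odot>\<^bsub>M\<^esub> f i)\<rparr>"

definition in_add ::
    "('r, 'a) ring_scheme \<Rightarrow> ('r, 'm, 'b) module_scheme \<Rightarrow> ('r, 'n, 'c) module_scheme
      \<Rightarrow> bool" where
  "in_add R U X \<longleftrightarrow>
    left_module R X \<and> finitely_generated R X \<and>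
    (\<exists>n D D' f. submodule D R (power_module U n) \<and> submodule D' R (power_module U n) \<and>
      D \<inter> D' = {\<zero>\<^bsub>power_module U n\<^esub>} \<and>
      D <+>\<^bsub>power_module U n\<^esub> D' = carrier (power_module U n) \<and>
      f \<in> mod_hom R X ((power_module U n)\<lparr>carrier := D\<rparr>) \<and> bij_betw f (carrier X) D)"

definition generalized_tilting ::
    "('r, 'a) ring_scheme \<Rightarrow> ('r, 'm, 'b) module_scheme \<Rightarrow> bool" where
  "generalized_tilting R U \<longleftrightarrow>
    selforthogonal R U \<and> in_gen_star R U \<and>
    (\<exists>(V :: nat \<Rightarrow> ('r, ('r, 'm) univ) module) e d.
      (\<forall>i. in_add R U (V i)) \<and>
      e \<in> mod_hom R (regular_module R) (V 0) \<and>
      (\<forall>i. d i \<in> mod_hom R (V i) (V (Suc i))) \<and>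
      inj_on e (carrier R) \<and>
      exact_at (regular_module R) e (V 0) (d 0) (V 1) \<and>
      (\<forall>i. exact_at (V i) (d i) (V (Suc i)) (d (Suc i)) (V (Suc (Suc i)))) \<and>
      pullback (regular_module R) e ` mod_hom R (V 0) U = mod_hom R (regular_module R) U \<and>
      exact_at (hom_group R (V 1) U) (pullback (V 0) (d 0)) (hom_group R (V 0) U)
        (pullback (regular_module R) e) (hom_group R (regular_module R) U) \<and>
      (\<forall>i. exact_at (hom_group R (V (Suc (Suc i))) U) (pullback (V (Suc i)) (d (Suc i)))
        (hom_group R (V (Suc i)) U) (pullback (V i) (d i)) (hom_group R (V i) U)))"

end

theory Submission
  imports Defs
begin

text \<open>
  Write \<open>B\<close> for the opposite of \<open>S\<close>, so that \<open>U\<close> is a left module over \<open>R\<close> and over \<open>B\<close>. Applying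
  \<open>Hom\<^sub>R(-, U)\<close> to the coresolution of \<open>R\<close> in \<open>add U\<close> gives a projective resolution of \<open>U\<close> over \<open>B\<close>
  whose \<open>U\<close>-dual is the coresolution again. Hence \<open>U\<close> is faithfully balanced and self-orthogonal over
  both rings, and the situation is symmetric.

  Suppose that \<open>U\<close> has injective dimension at most \<open>m\<close> over \<open>R\<close> and at most \<open>q\<close> over \<open>B\<close>, where
  \<open>m < q\<close>. By Baer's criterion, the coresolution of length \<open>q\<close> can be shortened once
  \<open>M = Ext\<^sub>B\<^sup>q(N, U)\<close> vanishes for all \<open>N = B/J\<close>. Let \<open>P\<close> be a free resolution of \<open>N\<close>; then \<open>M\<close> is the
  top cohomology of the complex \<open>X = Hom\<^sub>B(P, U)\<close> of finite powers of \<open>U\<close>. Let \<open>T\<close> be a resolution of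
  \<open>X\<close> by finitely generated free \<open>R\<close>-modules, obtained from an exact mapping cone, and \<open>Q\<close> a free
  resolution of \<open>M\<close> with \<open>Q\<^sub>0 = T\<^sub>0\<close>. The complex \<open>Hom\<^sub>R(T, U)\<close> computes the \<open>U\<close>-dual of \<open>X\<close>, that is
  \<open>N\<close> placed in degree \<open>q\<close>, so it is exact below degree \<open>q\<close>, and \<open>Hom\<^sub>R(Q, U)\<close> is exact above degree \<open>m\<close>.
  The map \<open>T \<rightarrow> Q\<close> therefore allows one to shift dimensions first along the former and then along the
  latter complex: evaluation at an element of \<open>Q\<^sub>0\<close> on \<open>Hom\<^sub>R(Q\<^sub>0, U)\<close> extends over \<open>Hom\<^sub>R(Q\<^sub>1, U)\<close>.
  Since \<open>U\<close> is balanced, every element of \<open>Q\<^sub>0\<close> comes from \<open>Q\<^sub>1\<close>, and \<open>M = 0\<close>.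
\<close>

section \<open>Modules and homomorphisms\<close>

text \<open>Each shift along a dual complex consumes exactness in one degree and moves one term up
  the coresolution of \<open>U\<close> over \<open>B\<close>, which ends after \<open>q\<close>
  steps. The dual of \<open>T\<close> fails in degree \<open>q\<close>, where \<open>N\<close> sits;
  the dual of \<open>Q\<close> is exact there because \<open>m < q\<close>, but not in low degrees.
  Neither complex suffices alone, so the change of complex happens at the last step, through a chain
  map that is the identity on \<open>T_0 = Q_0\<close>.

  \<open>T\<close> has to replace \<open>X\<close> because the terms of \<open>X\<close> are powers
  of \<open>U\<close>, while a comparison with a resolution of \<open>M\<close> needs free modules.
  That the dual of \<open>T\<close> still sees \<open>N\<close> rests on two facts:
  self-orthogonality and finite injective dimension over \<open>R\<close> keep the exact cone exact
  after dualizing, and balancedness turns the dual of \<open>X\<close> back into \<open>P\<close>.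

  Vanishing of Ext is expressed as solvability of lifting problems into a coresolution, so the
  argument forms neither quotient modules nor cohomology groups.\<close>

lemma left_module_ring: "left_module R M \<Longrightarrow> ring R"
  by (simp add: left_module_def)

lemma left_module_abelian_group: "left_module R M \<Longrightarrow> abelian_group M"
  by (simp add: left_module_def)

lemma left_moduleI:
  fixes R (structure) and M (structure)
  assumes "ring R" and "abelian_group M"
    and "\<And>a x. \<lbrakk>a \<in> carrier R; x \<in> carrier M\<rbrakk> \<Longrightarrow> a \<odot>\<^bsub>M\<^esub> x \<in> carrier M"
    and "\<And>a b x. \<lbrakk>a \<in> carrier R; b \<in> carrier R; x \<in> carrier M\<rbrakk> \<Longrightarrow>
        (a \<oplus> b) \<odot>\<^bsub>M\<^esub> x = a \<odot>\<^bsub>M\<^esub> x \<oplus>\<^bsub>M\<^esub> b \<odot>\<^bsub>M\<^esub> x"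
    and "\<And>a x y. \<lbrakk>a \<in> carrier R; x \<in> carrier M; y \<in> carrier M\<rbrakk> \<Longrightarrow>
        a \<odot>\<^bsub>M\<^esub> (x \<oplus>\<^bsub>M\<^esub> y) = a \<odot>\<^bsub>M\<^esub> x \<oplus>\<^bsub>M\<^esub> a \<odot>\<^bsub>M\<^esub> y"
    and "\<And>a b x. \<lbrakk>a \<in> carrier R; b \<in> carrier R; x \<in> carrier M\<rbrakk> \<Longrightarrow>
        (a \<otimes> b) \<odot>\<^bsub>M\<^esub> x = a \<odot>\<^bsub>M\<^esub> (b \<odot>\<^bsub>M\<^esub> x)"
    and "\<And>x. x \<in> carrier M \<Longrightarrow> \<one> \<odot>\<^bsub>M\<^esub> x = x"
  shows "left_module R M"
  using assms by (simp add: left_module_def left_module_axioms_def)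

context left_module
begin

lemma smult_l_null: "x \<in> carrier M \<Longrightarrow> \<zero> \<odot>\<^bsub>M\<^esub> x = \<zero>\<^bsub>M\<^esub>"
proof -
  assume x: "x \<in> carrier M"
  have "\<zero> \<odot>\<^bsub>M\<^esub> x = \<zero> \<odot>\<^bsub>M\<^esub> x \<oplus>\<^bsub>M\<^esub> \<zero> \<odot>\<^bsub>M\<^esub> x"
    using smult_l_distr[of \<zero> \<zero> x] x by simp
  thus ?thesis using x by (metis M.add.r_cancel_one' R.zero_closed smult_closed)
qed

lemma smult_r_null: "a \<in> carrier R \<Longrightarrow> a \<odot>\<^bsub>M\<^esub> \<zero>\<^bsub>M\<^esub> = \<zero>\<^bsub>M\<^esub>"
  using smult_r_distr[of a "\<zero>\<^bsub>M\<^esub>" "\<zero>\<^bsub>M\<^esub>"] smult_closed[of a "\<zero>\<^bsub>M\<^esub>"]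
  by (metis M.add.r_cancel_one' M.l_zero M.zero_closed)

lemma smult_l_minus: "\<lbrakk>a \<in> carrier R; x \<in> carrier M\<rbrakk> \<Longrightarrow> (\<ominus> a) \<odot>\<^bsub>M\<^esub> x = \<ominus>\<^bsub>M\<^esub> (a \<odot>\<^bsub>M\<^esub> x)"
  using smult_l_distr[of "\<ominus> a" a x] smult_l_null[of x] smult_closed
  by (metis M.minus_equality R.a_inv_closed R.l_neg)

lemma smult_r_minus: "\<lbrakk>a \<in> carrier R; x \<in> carrier M\<rbrakk> \<Longrightarrow> a \<odot>\<^bsub>M\<^esub> (\<ominus>\<^bsub>M\<^esub> x) = \<ominus>\<^bsub>M\<^esub> (a \<odot>\<^bsub>M\<^esub> x)"
  using smult_r_distr[of a "\<ominus>\<^bsub>M\<^esub> x" x] smult_r_null[of a] smult_closed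
  by (metis M.minus_equality M.a_inv_closed M.l_neg)

lemma minus_eq_smult: "x \<in> carrier M \<Longrightarrow> \<ominus>\<^bsub>M\<^esub> x = (\<ominus> \<one>) \<odot>\<^bsub>M\<^esub> x"
  by (simp add: smult_l_minus smult_one)

lemma finsum_smult:
  "\<lbrakk>finite I; a \<in> carrier R; f \<in> I \<rightarrow> carrier M\<rbrakk> \<Longrightarrow>
     a \<odot>\<^bsub>M\<^esub> (\<Oplus>\<^bsub>M\<^esub>i\<in>I. f i) = (\<Oplus>\<^bsub>M\<^esub>i\<in>I. a \<odot>\<^bsub>M\<^esub> f i)"
proof (induct set: finite)
  case empty then show ?case by (simp add: smult_r_null)
next
  case (insert x F) then show ?case
    by (simp add: Pi_def smult_r_distr smult_closed)
qed

lemma submoduleI: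
  assumes "N \<subseteq> carrier M" and "\<zero>\<^bsub>M\<^esub> \<in> N"
    and "\<And>x y. x \<in> N \<Longrightarrow> y \<in> N \<Longrightarrow> x \<oplus>\<^bsub>M\<^esub> y \<in> N"
    and "\<And>a x. a \<in> carrier R \<Longrightarrow> x \<in> N \<Longrightarrow> a \<odot>\<^bsub>M\<^esub> x \<in> N"
  shows "submodule N R M"
proof (rule submodule.intro)
  show "subgroup N (add_monoid M)"
  proof (rule subgroup.intro)
    fix x assume x: "x \<in> N"
    then have "\<ominus>\<^bsub>M\<^esub> x \<in> N" using assms minus_eq_smult[of x] by (metis R.a_inv_closed R.one_closed subsetD)
    then show "inv\<^bsub>add_monoid M\<^esub> x \<in> N" by (simp add: a_inv_def)
  qed (use assms in auto)
  show "submodule_axioms N R M" using assms by (simp add: submodule_axioms_def)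
qed

end

lemma submoduleD:
  assumes "submodule N R M"
  shows "N \<subseteq> carrier M" "\<zero>\<^bsub>M\<^esub> \<in> N"
    "x \<in> N \<Longrightarrow> y \<in> N \<Longrightarrow> x \<oplus>\<^bsub>M\<^esub> y \<in> N"
    "a \<in> carrier R \<Longrightarrow> x \<in> N \<Longrightarrow> a \<odot>\<^bsub>M\<^esub> x \<in> N"
    "x \<in> N \<Longrightarrow> \<ominus>\<^bsub>M\<^esub> x \<in> N"
proof -
  have sg: "subgroup N (add_monoid M)" using assms by (rule submodule.axioms)
  show "N \<subseteq> carrier M" "\<zero>\<^bsub>M\<^esub> \<in> N" "x \<in> N \<Longrightarrow> y \<in> N \<Longrightarrow> x \<oplus>\<^bsub>M\<^esub> y \<in> N"
    "x \<in> N \<Longrightarrow> \<ominus>\<^bsub>M\<^esub> x \<in> N"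
    using subgroup.subset[OF sg] subgroup.one_closed[OF sg] subgroup.m_closed[OF sg, of x y]
      subgroup.m_inv_closed[OF sg, of x] by (auto simp: a_inv_def)
  show "a \<in> carrier R \<Longrightarrow> x \<in> N \<Longrightarrow> a \<odot>\<^bsub>M\<^esub> x \<in> N"
    using assms by (simp add: submodule_def submodule_axioms_def)
qed

lemma submodule_minus:
  assumes "submodule N R M" "x \<in> N" "y \<in> N"
  shows "x \<ominus>\<^bsub>M\<^esub> y \<in> N"
  using submoduleD[OF assms(1)] assms by (simp add: a_minus_def)

lemma left_module_submodule:
  assumes "left_module R M" "submodule N R M"
  shows "left_module R (M\<lparr>carrier := N\<rparr>)"
proof -
  interpret left_module R M by fact
  note N = submoduleD[OF assms(2)]
  have [simp]: "x \<in> N \<Longrightarrow> x \<in> carrier M" for x using N by blast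
  show ?thesis
  proof (rule left_moduleI)
    show "abelian_group (M\<lparr>carrier := N\<rparr>)"
    proof (rule abelian_groupI, goal_cases)
      case (6 x)
      then show ?case using N(5)[of x] by (auto intro!: bexI[of _ "\<ominus>\<^bsub>M\<^esub> x"] simp: M.l_neg)
    qed (auto simp: N M.a_assoc intro: M.a_comm)
  qed (auto simp: N R.ring_axioms smult_l_distr smult_r_distr smult_assoc smult_one)
qed

lemma submodule_carrier: "left_module R M \<Longrightarrow> submodule (carrier M) R M"
proof -
  assume "left_module R M"
  then interpret left_module R M .
  show ?thesis by (rule submoduleI) (auto simp: smult_closed)
qed

lemma submodule_restrict_iff:
  assumes "left_module R M" "submodule N R M"
  shows "submodule L R (M\<lparr>carrier := N\<rparr>) \<longleftrightarrow> submodule L R M \<and> L \<subseteq> N"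
proof -
  interpret N: left_module R "M\<lparr>carrier := N\<rparr>" by (rule left_module_submodule[OF assms])
  interpret M: left_module R M by fact
  show ?thesis
  proof
    assume L: "submodule L R (M\<lparr>carrier := N\<rparr>)"
    show "submodule L R M \<and> L \<subseteq> N"
      using submoduleD[OF L] submoduleD(1)[OF assms(2)] by (auto intro!: M.submoduleI)
  next
    assume L: "submodule L R M \<and> L \<subseteq> N"
    then show "submodule L R (M\<lparr>carrier := N\<rparr>)"
      using submoduleD[OF L[THEN conjunct1]] by (auto intro!: N.submoduleI)
  qed
qed

text \<open>Extensionality is dropped, in contrast to \<open>mod_hom\<close>: composites, sums and
  identities are then homomorphisms as bare lambda-terms, and a function remains one when a carrier
  is shrunk or enlarged. The module conditions on both ends travel with the predicate.\<close>

definition lhom ::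
    "('r, 'a) ring_scheme \<Rightarrow> ('r, 'm, 'b) module_scheme \<Rightarrow> ('r, 'n, 'c) module_scheme
      \<Rightarrow> ('m \<Rightarrow> 'n) \<Rightarrow> bool" where
  "lhom R M N f \<longleftrightarrow> left_module R M \<and> left_module R N \<and> f \<in> carrier M \<rightarrow> carrier N \<and>
    (\<forall>x \<in> carrier M. \<forall>y \<in> carrier M. f (x \<oplus>\<^bsub>M\<^esub> y) = f x \<oplus>\<^bsub>N\<^esub> f y) \<and>
    (\<forall>a \<in> carrier R. \<forall>x \<in> carrier M. f (a \<odot>\<^bsub>M\<^esub> x) = a \<odot>\<^bsub>N\<^esub> f x)"

lemma lhomI:
  assumes "left_module R M" "left_module R N" "\<And>x. x \<in> carrier M \<Longrightarrow> f x \<in> carrier N"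
    "\<And>x y. x \<in> carrier M \<Longrightarrow> y \<in> carrier M \<Longrightarrow> f (x \<oplus>\<^bsub>M\<^esub> y) = f x \<oplus>\<^bsub>N\<^esub> f y"
    "\<And>a x. a \<in> carrier R \<Longrightarrow> x \<in> carrier M \<Longrightarrow> f (a \<odot>\<^bsub>M\<^esub> x) = a \<odot>\<^bsub>N\<^esub> f x"
  shows "lhom R M N f"
  using assms by (auto simp: lhom_def)

lemma lhomD:
  assumes "lhom R M N f"
  shows "left_module R M" "left_module R N"
    "x \<in> carrier M \<Longrightarrow> f x \<in> carrier N"
    "x \<in> carrier M \<Longrightarrow> y \<in> carrier M \<Longrightarrow> f (x \<oplus>\<^bsub>M\<^esub> y) = f x \<oplus>\<^bsub>N\<^esub> f y"
    "a \<in> carrier R \<Longrightarrow> x \<in> carrier M \<Longrightarrow> f (a \<odot>\<^bsub>M\<^esub> x) = a \<odot>\<^bsub>N\<^esub> f x"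
  using assms by (auto simp: lhom_def)

lemma lhom_zero: assumes "lhom R M N f" shows "f \<zero>\<^bsub>M\<^esub> = \<zero>\<^bsub>N\<^esub>"
proof -
  note f = lhomD[OF assms]
  interpret M: left_module R M by (rule f)
  interpret N: left_module R N by (rule f)
  have "f \<zero>\<^bsub>M\<^esub> = f \<zero>\<^bsub>M\<^esub> \<oplus>\<^bsub>N\<^esub> f \<zero>\<^bsub>M\<^esub>" using f(4)[of "\<zero>\<^bsub>M\<^esub>" "\<zero>\<^bsub>M\<^esub>"] by simp
  then show ?thesis using f(3)[of "\<zero>\<^bsub>M\<^esub>"] by (metis M.zero_closed N.add.r_cancel_one')
qed

lemma lhom_uminus: assumes "lhom R M N f" "x \<in> carrier M" shows "f (\<ominus>\<^bsub>M\<^esub> x) = \<ominus>\<^bsub>N\<^esub> f x"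
proof -
  note f = lhomD[OF assms(1)]
  interpret M: left_module R M by (rule f)
  interpret N: left_module R N by (rule f)
  show ?thesis using assms(2) f by (simp add: M.minus_eq_smult N.minus_eq_smult)
qed

lemma lhom_minus:
  assumes "lhom R M N f" "x \<in> carrier M" "y \<in> carrier M"
  shows "f (x \<ominus>\<^bsub>M\<^esub> y) = f x \<ominus>\<^bsub>N\<^esub> f y"
proof -
  note f = lhomD[OF assms(1)]
  interpret M: left_module R M by (rule f)
  show ?thesis using assms f by (simp add: a_minus_def lhom_uminus[OF assms(1)])
qed

lemma lhom_finsum:
  assumes "lhom R M N f" "finite I" "g \<in> I \<rightarrow> carrier M"
  shows "f (\<Oplus>\<^bsub>M\<^esub>i\<in>I. g i) = (\<Oplus>\<^bsub>N\<^esub>i\<in>I. f (g i))"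
proof -
  note f = lhomD[OF assms(1)]
  interpret M: left_module R M by (rule f)
  interpret N: left_module R N by (rule f)
  show ?thesis using assms(2,3)
  proof induct
    case empty then show ?case by (simp add: lhom_zero[OF assms(1)])
  next
    case (insert x F)
    then have "f (finsum M g (insert x F)) = f (g x) \<oplus>\<^bsub>N\<^esub> f (finsum M g F)"
      by (subst M.finsum_insert) (auto simp: f Pi_def)
    also have "\<dots> = finsum N (\<lambda>i. f (g i)) (insert x F)"
      using insert by (subst N.finsum_insert) (auto simp: f Pi_def)
    finally show ?case .
  qed
qed

lemma lhom_comp: "lhom R M N f \<Longrightarrow> lhom R N L g \<Longrightarrow> lhom R M L (\<lambda>x. g (f x))"
  by (auto simp: lhom_def Pi_iff)

lemma lhom_cong: "lhom R M N f \<Longrightarrow> (\<And>x. x \<in> carrier M \<Longrightarrow> g x = f x) \<Longrightarrow> lhom R M N g"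
  unfolding lhom_def by (auto simp: Pi_iff left_module.smult_closed abelian_group.axioms
      left_module_abelian_group abelian_monoid.a_closed)

lemma lhom_id: "left_module R M \<Longrightarrow> lhom R M M (\<lambda>x. x)"
  by (auto simp: lhom_def)

lemma lhom_const_zero:
  assumes "left_module R M" "left_module R N"
  shows "lhom R M N (\<lambda>x. \<zero>\<^bsub>N\<^esub>)"
proof -
  interpret N: left_module R N by fact
  show ?thesis using assms by (intro lhomI) (auto simp: N.smult_r_null)
qed

lemma lhom_diff:
  assumes "lhom R M N f" "lhom R M N g"
  shows "lhom R M N (\<lambda>x. f x \<ominus>\<^bsub>N\<^esub> g x)"
proof -
  note f = lhomD[OF assms(1)] and g = lhomD[OF assms(2)]
  interpret M: left_module R M by (rule f)
  interpret N: left_module R N by (rule f)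
  show ?thesis
    by (intro lhomI f)
      (auto simp: f g a_minus_def N.minus_add N.a_ac N.smult_r_distr N.smult_r_minus)
qed

lemma lhom_plus:
  assumes "lhom R M N f" "lhom R M N g"
  shows "lhom R M N (\<lambda>x. f x \<oplus>\<^bsub>N\<^esub> g x)"
proof -
  note f = lhomD[OF assms(1)] and g = lhomD[OF assms(2)]
  interpret M: left_module R M by (rule f)
  interpret N: left_module R N by (rule f)
  show ?thesis
    by (intro lhomI f) (auto simp: f g N.a_ac N.smult_r_distr)
qed

lemma left_module_diff_eq_zero:
  assumes "left_module R M" "x \<in> carrier M" "y \<in> carrier M"
  shows "x \<ominus>\<^bsub>M\<^esub> y = \<zero>\<^bsub>M\<^esub> \<longleftrightarrow> x = y"
proof -
  interpret left_module R M by fact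
  show ?thesis using assms
    by (metis M.add.inv_closed M.add.inv_inv M.minus_equality M.r_neg a_minus_def)
qed

lemma submodule_image:
  assumes "lhom R M N f" "submodule L R M"
  shows "submodule (f ` L) R N"
proof -
  note f = lhomD[OF assms(1)] and L = submoduleD[OF assms(2)]
  interpret N: left_module R N by (rule f)
  have Lc: "x \<in> L \<Longrightarrow> x \<in> carrier M" for x using L by blast
  show ?thesis
  proof (rule N.submoduleI)
    show "\<zero>\<^bsub>N\<^esub> \<in> f ` L" using L(2) lhom_zero[OF assms(1)] by (metis imageI)
    show "x \<oplus>\<^bsub>N\<^esub> y \<in> f ` L" if xy: "x \<in> f ` L" "y \<in> f ` L" for x y
    proof -
      obtain u v where u: "u \<in> L" "x = f u" and v: "v \<in> L" "y = f v" using xy by blast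
      then have "x \<oplus>\<^bsub>N\<^esub> y = f (u \<oplus>\<^bsub>M\<^esub> v)" using f(4)[of u v] Lc by simp
      then show ?thesis using u v L(3) by blast
    qed
    show "a \<odot>\<^bsub>N\<^esub> x \<in> f ` L" if a: "a \<in> carrier R" "x \<in> f ` L" for a x
    proof -
      obtain u where u: "u \<in> L" "x = f u" using a by blast
      then have "a \<odot>\<^bsub>N\<^esub> x = f (a \<odot>\<^bsub>M\<^esub> u)" using f(5)[of a u] Lc a by simp
      then show ?thesis using u L(4) a by blast
    qed
  qed (use f Lc in auto)
qed

lemma submodule_vimage:
  assumes "lhom R M N f" "submodule L R N"
  shows "submodule {x \<in> carrier M. f x \<in> L} R M"
proof -
  note f = lhomD[OF assms(1)] and L = submoduleD[OF assms(2)]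
  interpret M: left_module R M by (rule f)
  show ?thesis
    by (rule M.submoduleI) (auto simp: f L lhom_zero[OF assms(1)] M.smult_closed)
qed

lemma submodule_zero: "left_module R M \<Longrightarrow> submodule {\<zero>\<^bsub>M\<^esub>} R M"
proof -
  assume "left_module R M"
  then interpret left_module R M .
  show ?thesis by (rule submoduleI) (auto simp: smult_r_null)
qed

lemma submodule_kernel:
  assumes "lhom R M N f"
  shows "submodule {x \<in> carrier M. f x = \<zero>\<^bsub>N\<^esub>} R M"
  using submodule_vimage[OF assms submodule_zero] lhomD(2)[OF assms] by simp

lemma submodule_Int:
  assumes "left_module R M" "submodule K R M" "submodule L R M"
  shows "submodule (K \<inter> L) R M"
proof -
  interpret left_module R M by fact
  note K = submoduleD[OF assms(2)] and L = submoduleD[OF assms(3)]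
  show ?thesis using K L by (intro submoduleI) auto
qed

lemma lhom_restrict_range:
  assumes "lhom R M N f" "submodule L R N" "\<And>x. x \<in> carrier M \<Longrightarrow> f x \<in> L"
  shows "lhom R M (N\<lparr>carrier := L\<rparr>) f"
  using assms left_module_submodule[OF lhomD(2)[OF assms(1)] assms(2)]
  by (auto simp: lhom_def Pi_iff)

lemma lhom_restrict_domain:
  assumes "lhom R M N f" "submodule L R M"
  shows "lhom R (M\<lparr>carrier := L\<rparr>) N f"
  using assms left_module_submodule[OF lhomD(1)[OF assms(1)] assms(2)] submoduleD(1)[OF assms(2)]
  by (auto simp: lhom_def Pi_iff subset_iff)

lemma lhom_extend_range:
  assumes "lhom R M (N\<lparr>carrier := L\<rparr>) f" "left_module R N" "L \<subseteq> carrier N"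
  shows "lhom R M N f"
  using assms by (auto simp: lhom_def Pi_iff)

text \<open>The image of \<open>p\<close> stands in for the quotient of \<open>M\<close> by the
  kernel of \<open>p\<close>, which gives the homomorphism theorem without quotient modules.\<close>

lemma lhom_factor_image:
  assumes p: "lhom R M D p" and f: "lhom R M E f"
    and ker: "\<And>x. x \<in> carrier M \<Longrightarrow> p x = \<zero>\<^bsub>D\<^esub> \<Longrightarrow> f x = \<zero>\<^bsub>E\<^esub>"
  obtains h where "lhom R (D\<lparr>carrier := p ` carrier M\<rparr>) E h"
    and "\<And>x. x \<in> carrier M \<Longrightarrow> h (p x) = f x"
proof -
  note P = lhomD[OF p] and F = lhomD[OF f]
  interpret M: left_module R M by (rule P)
  interpret D: left_module R D by (rule P)
  have wd: "f x = f y" if "x \<in> carrier M" "y \<in> carrier M" "p x = p y" for x y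
  proof -
    have "p (x \<ominus>\<^bsub>M\<^esub> y) = \<zero>\<^bsub>D\<^esub>" using that P by (simp add: lhom_minus[OF p] left_module_diff_eq_zero[OF P(2)])
    then have "f (x \<ominus>\<^bsub>M\<^esub> y) = \<zero>\<^bsub>E\<^esub>" using ker that by blast
    then show ?thesis
      using that F left_module_diff_eq_zero[OF F(2)] by (simp add: lhom_minus[OF f])
  qed
  define h where "h = (\<lambda>d. f (SOME x. x \<in> carrier M \<and> p x = d))"
  have h: "h (p x) = f x" if "x \<in> carrier M" for x
  proof -
    have "\<exists>y. y \<in> carrier M \<and> p y = p x" using that by blast
    from someI_ex[OF this] show ?thesis unfolding h_def using wd that by blast
  qed
  have hp: "h (p x \<oplus>\<^bsub>D\<^esub> p y) = f x \<oplus>\<^bsub>E\<^esub> f y" if "x \<in> carrier M" "y \<in> carrier M" for x y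
    using that h[of "x \<oplus>\<^bsub>M\<^esub> y"] P(4) F(4) by simp
  have hs: "h (a \<odot>\<^bsub>D\<^esub> p x) = a \<odot>\<^bsub>E\<^esub> f x" if "x \<in> carrier M" "a \<in> carrier R" for a x
    using that h[of "a \<odot>\<^bsub>M\<^esub> x"] P(5) F(5) M.smult_closed by simp
  have "submodule (p ` carrier M) R D"
    using submodule_image[OF p submodule_carrier[OF P(1)]] .
  then have "lhom R (D\<lparr>carrier := p ` carrier M\<rparr>) E h"
    using left_module_submodule[OF P(2)]
    by (intro lhomI) (auto simp: F h hp hs)
  then show thesis using h that by blast
qed

lemma lhom_inverse:
  assumes f: "lhom R M N f" and bij: "bij_betw f (carrier M) (carrier N)"
  obtains k where "lhom R N M k" "\<And>x. x \<in> carrier M \<Longrightarrow> k (f x) = x"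
    "\<And>y. y \<in> carrier N \<Longrightarrow> f (k y) = y"
proof -
  interpret M: left_module R M by (rule lhomD(1)[OF f])
  have im: "f ` carrier M = carrier N" and inj: "inj_on f (carrier M)"
    using bij by (auto simp: bij_betw_def)
  have k0: "x = \<zero>\<^bsub>M\<^esub>" if "x \<in> carrier M" "f x = \<zero>\<^bsub>N\<^esub>" for x
    using inj_onD[OF inj, of x "\<zero>\<^bsub>M\<^esub>"] that lhom_zero[OF f] by simp
  obtain k where k: "lhom R (N\<lparr>carrier := f ` carrier M\<rparr>) M k" "\<And>x. x \<in> carrier M \<Longrightarrow> k (f x) = x"
    by (rule lhom_factor_image[OF f lhom_id[OF lhomD(1)[OF f]]], erule (1) k0) (rule that)
  have "lhom R N M k" using k(1) unfolding im by simp
  moreover have "f (k y) = y" if "y \<in> carrier N" for y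
    using that k(2) unfolding im[symmetric] by auto
  ultimately show thesis using that k(2) by metis
qed

lemma mod_hom_iff:
  assumes "left_module R M" "left_module R N"
  shows "f \<in> mod_hom R M N \<longleftrightarrow> lhom R M N f \<and> f \<in> extensional (carrier M)"
  using assms by (auto simp: mod_hom_def lhom_def PiE_def)

lemma lhom_restrict: "lhom R M N f \<Longrightarrow> restrict f (carrier M) \<in> mod_hom R M N"
  using mod_hom_iff[OF lhomD(1,2)] by (metis lhom_cong restrict_apply restrict_extensional)

lemma mod_hom_lhom:
  "f \<in> mod_hom R M N \<Longrightarrow> left_module R M \<Longrightarrow> left_module R N \<Longrightarrow> lhom R M N f"
  by (simp add: mod_hom_iff)

lemma left_module_regular:
  fixes R (structure)
  assumes "ring R"
  shows "left_module R (regular_module R)"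
proof -
  interpret ring R by fact
  show ?thesis
  proof (rule left_moduleI)
    show "abelian_group (regular_module R)"
      by (rule abelian_groupI)
        (auto simp: regular_module_def a_assoc intro: a_comm l_neg intro!: bexI[of _ "\<ominus> _"])
  qed (auto simp: regular_module_def l_distr r_distr m_assoc ring_axioms)
qed

lemma regular_module_simps [simp]:
  "carrier (regular_module R) = carrier R" "zero (regular_module R) = zero R"
  "add (regular_module R) = add R" "smult (regular_module R) = mult R"
  by (simp_all add: regular_module_def)

section \<open>Baer's criterion\<close>

definition dsum ::
    "('r, 'm, 'b) module_scheme \<Rightarrow> ('r, 'n, 'c) module_scheme \<Rightarrow> ('r, 'm \<times> 'n) module" where
  "dsum M N = \<lparr>carrier = carrier M \<times> carrier N, mult = undefined, one = undefined,
     zero = (\<zero>\<^bsub>M\<^esub>, \<zero>\<^bsub>N\<^esub>), add = (\<lambda>p q. (fst p \<oplus>\<^bsub>M\<^esub> fst q, snd p \<oplus>\<^bsub>N\<^esub> snd q)),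
     smult = (\<lambda>a p. (a \<odot>\<^bsub>M\<^esub> fst p, a \<odot>\<^bsub>N\<^esub> snd p))\<rparr>"

lemma dsum_simps [simp]:
  "carrier (dsum M N) = carrier M \<times> carrier N" "zero (dsum M N) = (\<zero>\<^bsub>M\<^esub>, \<zero>\<^bsub>N\<^esub>)"
  "p \<oplus>\<^bsub>dsum M N\<^esub> q = (fst p \<oplus>\<^bsub>M\<^esub> fst q, snd p \<oplus>\<^bsub>N\<^esub> snd q)"
  "a \<odot>\<^bsub>dsum M N\<^esub> p = (a \<odot>\<^bsub>M\<^esub> fst p, a \<odot>\<^bsub>N\<^esub> snd p)"
  by (simp_all add: dsum_def)

lemma left_module_dsum:
  assumes "left_module R M" "left_module R N"
  shows "left_module R (dsum M N)"
proof -
  interpret M: left_module R M by fact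
  interpret N: left_module R N by fact
  show ?thesis
  proof (rule left_moduleI)
    show "abelian_group (dsum M N)"
    proof (rule abelian_groupI, goal_cases)
      case (6 x)
      then show ?case
        by (auto intro!: bexI[of _ "(\<ominus>\<^bsub>M\<^esub> fst x, \<ominus>\<^bsub>N\<^esub> snd x)"] simp: M.l_neg N.l_neg)
    qed (auto simp: M.a_assoc N.a_assoc intro: M.a_comm N.a_comm)
  qed (auto simp: M.ring_axioms M.smult_closed N.smult_closed M.smult_l_distr N.smult_l_distr
      M.smult_r_distr N.smult_r_distr M.smult_assoc N.smult_assoc M.smult_one N.smult_one)
qed

text \<open>A homomorphism out of a left ideal extends to the whole ring exactly if it multiplies a
  fixed element. Phrased by elements, injectivity involves no auxiliary type, which frees later
  arguments from the type bound in \<open>injective_module\<close>.\<close>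

definition baer :: "('r, 'a) ring_scheme \<Rightarrow> ('r, 'e, 'b) module_scheme \<Rightarrow> bool" where
  "baer R E \<longleftrightarrow> left_module R E \<and>
    (\<forall>J f. submodule J R (regular_module R) \<longrightarrow>
      lhom R ((regular_module R)\<lparr>carrier := J\<rparr>) E f \<longrightarrow>
      (\<exists>x \<in> carrier E. \<forall>a \<in> J. f a = a \<odot>\<^bsub>E\<^esub> x))"


text \<open>Partial extensions are handled as graphs in the direct sum of \<open>M\<close> and
  \<open>E\<close>, so that the union of a chain is again one. A maximal graph is total because
  Baer's condition supplies a value at any missing point.\<close>

theorem baer_extend:
  assumes E: "baer R E" and M: "left_module R M" and N: "submodule N R M"
    and f: "lhom R (M\<lparr>carrier := N\<rparr>) E f"
  obtains g where "lhom R M E g" "\<And>x. x \<in> N \<Longrightarrow> g x = f x"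
proof -
  have E': "left_module R E" using E by (simp add: baer_def)
  interpret M: left_module R M by fact
  interpret E: left_module R E by fact
  have ME: "left_module R (dsum M E)" by (rule left_module_dsum[OF M E'])
  interpret ME: left_module R "dsum M E" by fact
  note Nd = submoduleD[OF N] and fd = lhomD[OF f, simplified]
  have Nc [simp]: "x \<in> N \<Longrightarrow> x \<in> carrier M" for x using Nd by blast
  \<comment> \<open>A submodule of the sum is a graph as soon as zero has no second value.\<close>
  define \<G> where "\<G> = {G. submodule G R (dsum M E) \<and> (\<forall>y. (\<zero>\<^bsub>M\<^esub>, y) \<in> G \<longrightarrow> y = \<zero>\<^bsub>E\<^esub>) \<and>
    (\<forall>x \<in> N. (x, f x) \<in> G)}"
  have "(\<lambda>x. (x, f x)) ` N \<in> \<G>"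
  proof -
    have "lhom R (M\<lparr>carrier := N\<rparr>) (dsum M E) (\<lambda>x. (x, f x))"
      using left_module_submodule[OF M N] by (intro lhomI ME) (auto simp: fd)
    then have "submodule ((\<lambda>x. (x, f x)) ` N) R (dsum M E)"
      using submodule_image[OF _ submodule_carrier[OF left_module_submodule[OF M N]]] by fastforce
    then show ?thesis using lhom_zero[OF f] by (auto simp: \<G>_def)
  qed
  then have "\<G> \<noteq> {}" by blast
  then have "\<exists>G\<in>\<G>. \<forall>X\<in>\<G>. G \<subseteq> X \<longrightarrow> X = G"
  proof (rule subset_Zorn_nonempty)
    fix C assume C: "C \<noteq> {}" "subset.chain \<G> C"
    then have CG: "C \<subseteq> \<G>" and lin: "\<And>X Y. X \<in> C \<Longrightarrow> Y \<in> C \<Longrightarrow> X \<subseteq> Y \<or> Y \<subseteq> X"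
      by (auto simp: subset_chain_def)
    have sub: "X \<in> C \<Longrightarrow> submodule X R (dsum M E)" for X using CG by (auto simp: \<G>_def)
    have "submodule (\<Union>C) R (dsum M E)"
    proof (rule ME.submoduleI)
      show "\<Union>C \<subseteq> carrier (dsum M E)" using sub submoduleD(1) by blast
      show "\<zero>\<^bsub>dsum M E\<^esub> \<in> \<Union>C" using sub submoduleD(2) C(1) by blast
      show "x \<oplus>\<^bsub>dsum M E\<^esub> y \<in> \<Union>C" if xy: "x \<in> \<Union>C" "y \<in> \<Union>C" for x y
      proof -
        obtain X where "X \<in> C" "x \<in> X" "y \<in> X" using xy lin by blast
        then show ?thesis using submoduleD(3)[OF sub] by blast
      qed
      show "a \<odot>\<^bsub>dsum M E\<^esub> x \<in> \<Union>C" if "a \<in> carrier R" "x \<in> \<Union>C" for a x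
        using that submoduleD(4)[OF sub] by blast
    qed
    then show "\<Union>C \<in> \<G>" using C(1) CG unfolding \<G>_def by blast
  qed
  then obtain G where G: "G \<in> \<G>" and max: "\<And>X. X \<in> \<G> \<Longrightarrow> G \<subseteq> X \<Longrightarrow> X = G" by blast
  have Gs: "submodule G R (dsum M E)" and G0: "\<And>y. (\<zero>\<^bsub>M\<^esub>, y) \<in> G \<Longrightarrow> y = \<zero>\<^bsub>E\<^esub>"
    and Gf: "\<And>x. x \<in> N \<Longrightarrow> (x, f x) \<in> G"
    using G by (auto simp: \<G>_def)
  note Gd = submoduleD[OF Gs, simplified]
  have Gc: "x \<in> carrier M" "y \<in> carrier E" if "(x, y) \<in> G" for x y using Gd(1) that by auto
  have Gfun: "y = z" if "(x, y) \<in> G" "(x, z) \<in> G" for x y z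
  proof -
    have "(x, y) \<ominus>\<^bsub>dsum M E\<^esub> (x, z) \<in> G" using submodule_minus[OF Gs] that by blast
    moreover have "\<ominus>\<^bsub>dsum M E\<^esub> (x, z) = (\<ominus>\<^bsub>M\<^esub> x, \<ominus>\<^bsub>E\<^esub> z)"
      using Gc[OF that(2)] by (intro ME.minus_equality) (auto simp: M.l_neg E.l_neg)
    ultimately have "(\<zero>\<^bsub>M\<^esub>, y \<ominus>\<^bsub>E\<^esub> z) \<in> G"
      using Gc[OF that(2)] by (simp add: a_minus_def M.r_neg)
    then show ?thesis using G0 Gc that left_module_diff_eq_zero[OF E'] by metis
  qed
  have tot: "\<exists>y. (x, y) \<in> G" if x: "x \<in> carrier M" for x
  proof -
    \<comment> \<open>The multiples of \<open>x\<close> already in the domain correspond to a left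
      ideal; Baer's condition turns the values there into multiples of one element \<open>y\<close>,
      the value to be assigned to \<open>x\<close>.\<close>
    define J where "J = {a \<in> carrier R. \<exists>v. (a \<odot>\<^bsub>M\<^esub> x, v) \<in> G}"
    define g where "g = (\<lambda>a. THE v. (a \<odot>\<^bsub>M\<^esub> x, v) \<in> G)"
    have g: "g a = v" if "(a \<odot>\<^bsub>M\<^esub> x, v) \<in> G" for a v
      unfolding g_def using that Gfun by blast
    have RR: "left_module R (regular_module R)"
      by (rule left_module_regular) (rule M.R.ring_axioms)
    interpret RR: left_module R "regular_module R" by (rule RR)
    have add: "((a \<oplus>\<^bsub>R\<^esub> b) \<odot>\<^bsub>M\<^esub> x, v \<oplus>\<^bsub>E\<^esub> w) \<in> G"
      if "a \<in> carrier R" "b \<in> carrier R" "(a \<odot>\<^bsub>M\<^esub> x, v) \<in> G" "(b \<odot>\<^bsub>M\<^esub> x, w) \<in> G" for a b v w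
      using Gd(3)[OF that(3,4)] that x by (simp add: M.smult_l_distr)
    have mul: "((a \<otimes>\<^bsub>R\<^esub> b) \<odot>\<^bsub>M\<^esub> x, a \<odot>\<^bsub>E\<^esub> w) \<in> G"
      if "a \<in> carrier R" "b \<in> carrier R" "(b \<odot>\<^bsub>M\<^esub> x, w) \<in> G" for a b w
      using Gd(4)[OF that(1,3)] that x by (simp add: M.smult_assoc)
    have J: "submodule J R (regular_module R)"
    proof (rule RR.submoduleI)
      show "\<zero>\<^bsub>regular_module R\<^esub> \<in> J"
        using Gd(2) x by (auto simp: J_def M.smult_l_null)
    qed (use add mul in \<open>fastforce simp: J_def\<close>)+
    have gG: "(a \<odot>\<^bsub>M\<^esub> x, g a) \<in> G" if "a \<in> J" for a using that g by (auto simp: J_def)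
    have gc: "g a \<in> carrier E" if "a \<in> J" for a using Gc(2)[OF gG[OF that]] .
    have "lhom R ((regular_module R)\<lparr>carrier := J\<rparr>) E g"
    proof (rule lhomI)
      show "left_module R ((regular_module R)\<lparr>carrier := J\<rparr>)"
        by (rule left_module_submodule[OF RR J])
    qed (use gc in \<open>auto simp: J_def intro!: g add mul E' gG[unfolded J_def]\<close>)
    then obtain y where y: "y \<in> carrier E" "\<And>a. a \<in> J \<Longrightarrow> g a = a \<odot>\<^bsub>E\<^esub> y"
      using E J unfolding baer_def by blast
    \<comment> \<open>The image of \<open>h\<close> is the sum of \<open>G\<close> and the submodule
      spanned by \<open>(x, y)\<close>.\<close>
    define h where "h = (\<lambda>p. ((fst (fst p) \<oplus>\<^bsub>M\<^esub> snd p \<odot>\<^bsub>M\<^esub> x), (snd (fst p) \<oplus>\<^bsub>E\<^esub> snd p \<odot>\<^bsub>E\<^esub> y)))"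
    have GR: "left_module R (dsum ((dsum M E)\<lparr>carrier := G\<rparr>) (regular_module R))"
      by (intro left_module_dsum left_module_submodule[OF ME Gs] RR)
    have h: "lhom R (dsum ((dsum M E)\<lparr>carrier := G\<rparr>) (regular_module R)) (dsum M E) h"
    proof (rule lhomI[OF GR ME], goal_cases)
      case (1 p)
      then show ?case using Gc x y by (cases p) (auto simp: h_def M.smult_closed E.smult_closed)
    next
      case (2 p q)
      obtain p1 p2 p3 where p: "p = ((p1, p2), p3)" by (metis surj_pair)
      obtain q1 q2 q3 where q: "q = ((q1, q2), q3)" by (metis surj_pair)
      have "p1 \<in> carrier M" "p2 \<in> carrier E" "q1 \<in> carrier M" "q2 \<in> carrier E"
        "p3 \<in> carrier R" "q3 \<in> carrier R"
        using 2 p q Gc by auto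
      then show ?case using x y(1)
        by (simp add: h_def p q M.smult_l_distr E.smult_l_distr M.smult_closed E.smult_closed M.a_ac E.a_ac)
    next
      case (3 a p)
      obtain p1 p2 p3 where p: "p = ((p1, p2), p3)" by (metis surj_pair)
      have "p1 \<in> carrier M" "p2 \<in> carrier E" "p3 \<in> carrier R"
        using 3 p Gc by auto
      then show ?case using x y(1) 3(1)
        by (simp add: h_def p M.smult_r_distr E.smult_r_distr M.smult_closed E.smult_closed M.smult_assoc E.smult_assoc)
    qed
    define G' where "G' = h ` carrier (dsum ((dsum M E)\<lparr>carrier := G\<rparr>) (regular_module R))"
    have G's: "submodule G' R (dsum M E)"
      unfolding G'_def by (rule submodule_image[OF h submodule_carrier[OF GR]])
    have sub: "G \<subseteq> G'"
    proof
      fix p assume p: "p \<in> G"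
      then have "p = h (p, \<zero>\<^bsub>R\<^esub>)" using Gc[of "fst p" "snd p"] x y
        by (simp add: h_def M.smult_l_null E.smult_l_null)
      then show "p \<in> G'" using p by (auto simp: G'_def)
    qed
    have "w = \<zero>\<^bsub>E\<^esub>" if w: "(\<zero>\<^bsub>M\<^esub>, w) \<in> G'" for w
    proof -
      obtain n v a where nva: "(n, v) \<in> G" "a \<in> carrier R" "(\<zero>\<^bsub>M\<^esub>, w) = h ((n, v), a)"
        using w unfolding G'_def by auto
      then have eq: "n \<oplus>\<^bsub>M\<^esub> a \<odot>\<^bsub>M\<^esub> x = \<zero>\<^bsub>M\<^esub>" "w = v \<oplus>\<^bsub>E\<^esub> a \<odot>\<^bsub>E\<^esub> y" by (simp_all add: h_def)
      have c: "n \<in> carrier M" "v \<in> carrier E" "a \<odot>\<^bsub>M\<^esub> x \<in> carrier M" "a \<odot>\<^bsub>E\<^esub> y \<in> carrier E"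
        using Gc nva x y by (auto simp: M.smult_closed E.smult_closed)
      \<comment> \<open>If the sum lies over zero, the multiple of \<open>x\<close> is in the domain
        of \<open>G\<close>; so \<open>a\<close> belongs to \<open>J\<close>, and the value
        prescribed there cancels \<open>v\<close>.\<close>
      have "(a \<odot>\<^bsub>M\<^esub> x) = \<ominus>\<^bsub>M\<^esub> n"
        using eq c by (metis M.a_comm M.minus_equality)
      moreover have "(\<ominus>\<^bsub>M\<^esub> n, \<ominus>\<^bsub>E\<^esub> v) \<in> G"
      proof -
        have "\<ominus>\<^bsub>dsum M E\<^esub> (n, v) = (\<ominus>\<^bsub>M\<^esub> n, \<ominus>\<^bsub>E\<^esub> v)"
          using c by (intro ME.minus_equality) (auto simp: M.l_neg E.l_neg)
        then show ?thesis using Gd(5)[OF nva(1)] by simp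
      qed
      ultimately have aG: "(a \<odot>\<^bsub>M\<^esub> x, \<ominus>\<^bsub>E\<^esub> v) \<in> G" by simp
      then have "a \<in> J" using nva by (auto simp: J_def)
      then have "a \<odot>\<^bsub>E\<^esub> y = \<ominus>\<^bsub>E\<^esub> v" using y(2) g[OF aG] by simp
      then show ?thesis using eq(2) c by (simp add: E.r_neg)
    qed
    then have "G' \<in> \<G>" using G's Gf sub by (auto simp: \<G>_def)
    then have G'G: "G' = G" using max sub by blast
    have "h (\<zero>\<^bsub>dsum M E\<^esub>, \<one>\<^bsub>R\<^esub>) = (x, y)" using x y by (simp add: h_def M.smult_one E.smult_one)
    moreover have "h (\<zero>\<^bsub>dsum M E\<^esub>, \<one>\<^bsub>R\<^esub>) \<in> G'" unfolding G'_def using Gd(2) by auto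
    ultimately show ?thesis using G'G by auto
  qed
  define g where "g = (\<lambda>x. THE y. (x, y) \<in> G)"
  have g: "g x = y" if "(x, y) \<in> G" for x y unfolding g_def using that Gfun by blast
  have gG: "x \<in> carrier M \<Longrightarrow> (x, g x) \<in> G" for x using tot g by metis
  have "lhom R M E g"
  proof (rule lhomI[OF M E'])
    show "g x \<in> carrier E" if "x \<in> carrier M" for x using gG[OF that] Gc by blast
    show "g (x \<oplus>\<^bsub>M\<^esub> y) = g x \<oplus>\<^bsub>E\<^esub> g y" if "x \<in> carrier M" "y \<in> carrier M" for x y
      using Gd(3)[OF gG gG, OF that] by (intro g) simp
    show "g (a \<odot>\<^bsub>M\<^esub> x) = a \<odot>\<^bsub>E\<^esub> g x" if "a \<in> carrier R" "x \<in> carrier M" for a x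
      using Gd(4)[OF that(1) gG, OF that(2)] by (intro g) simp
  qed
  moreover have "g x = f x" if "x \<in> N" for x using Gf g that by blast
  ultimately show thesis using that by blast
qed

text \<open>\<open>p\<close> may have both a kernel and a cokernel: \<open>f\<close> first descends
  to the image of \<open>p\<close> and is then extended from there to \<open>D\<close>. This is the
  form in which injective terms are used below.\<close>

lemma baer_factor:
  assumes E: "baer R E" and p: "lhom R M D p" and f: "lhom R M E f"
    and ker: "\<And>x. x \<in> carrier M \<Longrightarrow> p x = \<zero>\<^bsub>D\<^esub> \<Longrightarrow> f x = \<zero>\<^bsub>E\<^esub>"
  obtains h where "lhom R D E h" "\<And>x. x \<in> carrier M \<Longrightarrow> f x = h (p x)"
proof -
  obtain h where h: "lhom R (D\<lparr>carrier := p ` carrier M\<rparr>) E h" "\<And>x. x \<in> carrier M \<Longrightarrow> h (p x) = f x"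
    using lhom_factor_image[OF p f ker] by blast
  have "submodule (p ` carrier M) R D"
    using submodule_image[OF p submodule_carrier[OF lhomD(1)[OF p]]] .
  then obtain g where "lhom R D E g" "\<And>x. x \<in> p ` carrier M \<Longrightarrow> g x = h x"
    using baer_extend[OF E lhomD(2)[OF p] _ h(1)] by blast
  then show thesis using that h(2) by (metis image_eqI)
qed

lemma baer_imp_injective_module:
  fixes R :: "('r, 'a) ring_scheme" and E :: "('r, 'e, 'b) module_scheme"
  assumes "baer R E" shows "injective_module R E"
  unfolding injective_module_def
proof (intro conjI allI impI)
  show E: "left_module R E" using assms by (simp add: baer_def)
  fix A B :: "('r, ('r, 'e) univ) module" and j g
  assume A: "left_module R A" and B: "left_module R B" and j: "j \<in> mod_hom R A B"
    and inj: "inj_on j (carrier A)" and g: "g \<in> mod_hom R A E"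
  have jl: "lhom R A B j" by (rule mod_hom_lhom[OF j A B])
  have "j x = \<zero>\<^bsub>B\<^esub> \<Longrightarrow> x \<in> carrier A \<Longrightarrow> x = \<zero>\<^bsub>A\<^esub>" for x
    using lhom_zero[OF jl] inj A
    by (metis inj_onD submodule_zero submoduleD(1) insert_subset)
  then obtain h where h: "lhom R B E h" "\<And>x. x \<in> carrier A \<Longrightarrow> g x = h (j x)"
    using baer_factor[OF assms jl mod_hom_lhom[OF g A E]] lhom_zero[OF mod_hom_lhom[OF g A E]] by metis
  show "\<exists>h\<in>mod_hom R B E. compose (carrier A) h j = g"
  proof (rule bexI[OF _ lhom_restrict[OF h(1)]])
    have "j x \<in> carrier B" if "x \<in> carrier A" for x using lhomD(3)[OF jl that] .
    moreover have "g \<in> extensional (carrier A)" using g mod_hom_iff[OF A E] by blast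
    ultimately show "compose (carrier A) (restrict h (carrier B)) j = g"
      by (auto simp: compose_def h extensional_def fun_eq_iff)
  qed
qed

section \<open>Independence of the type of the test modules\<close>

definition transport ::
    "('x \<Rightarrow> 'y) \<Rightarrow> ('r, 'x, 'b) module_scheme \<Rightarrow> ('r, 'y) module" where
  "transport j M = (let i = inv_into (carrier M) j in
    \<lparr>carrier = j ` carrier M, mult = undefined, one = undefined, zero = j \<zero>\<^bsub>M\<^esub>,
     add = (\<lambda>x y. j (i x \<oplus>\<^bsub>M\<^esub> i y)), smult = (\<lambda>a x. j (a \<odot>\<^bsub>M\<^esub> i x))\<rparr>)"

lemma transport:
  assumes M: "left_module R M" and j: "inj_on j (carrier M)"
  shows "left_module R (transport j M)" "lhom R M (transport j M) j"
    "lhom R (transport j M) M (inv_into (carrier M) j)" "carrier (transport j M) = j ` carrier M"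
    "zero (transport j M) = j \<zero>\<^bsub>M\<^esub>"
proof -
  interpret left_module R M by fact
  define T where "T = transport j M"
  have T [simp]: "carrier T = j ` carrier M" "zero T = j \<zero>\<^bsub>M\<^esub>"
    "x \<in> carrier M \<Longrightarrow> y \<in> carrier M \<Longrightarrow> j x \<oplus>\<^bsub>T\<^esub> j y = j (x \<oplus>\<^bsub>M\<^esub> y)"
    "x \<in> carrier M \<Longrightarrow> a \<odot>\<^bsub>T\<^esub> j x = j (a \<odot>\<^bsub>M\<^esub> x)" for x y a
    by (simp_all add: T_def transport_def Let_def j)
  show T': "left_module R (transport j M)" unfolding T_def[symmetric]
  proof (rule left_moduleI)
    show "abelian_group T"
    proof (rule abelian_groupI, goal_cases)
      case (6 x)
      then show ?case by (auto intro!: bexI[of _ "\<ominus>\<^bsub>M\<^esub> _"] simp: M.l_neg)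
    qed (auto simp: M.a_assoc intro!: arg_cong[of _ _ j] M.a_comm)
  qed (auto simp: R.ring_axioms smult_closed smult_l_distr smult_r_distr smult_assoc smult_one)
  then show "lhom R M (transport j M) j" "lhom R (transport j M) M (inv_into (carrier M) j)"
    using M by (auto simp: T_def[symmetric] j smult_closed intro!: lhomI)
  show "carrier (transport j M) = j ` carrier M" "zero (transport j M) = j \<zero>\<^bsub>M\<^esub>"
    by (simp_all add: T_def[symmetric])
qed

text \<open>The injections \<open>jA\<close> and \<open>jB\<close> witness that \<open>A\<close> and
  \<open>B\<close> fit into the bounded type over which \<open>injective_module\<close> quantifies;
  copies of both modules are tested there and the answer is carried back.\<close>

lemma injective_module_extend:
  fixes jA :: "'x \<Rightarrow> ('r, 'e) univ" and jB :: "'y \<Rightarrow> ('r, 'e) univ"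
    and E :: "('r, 'e, 'b) module_scheme"
  assumes E: "injective_module R E" and j: "lhom R A B j" and inj: "inj_on j (carrier A)"
    and g: "lhom R A E g" and jA: "inj_on jA (carrier A)" and jB: "inj_on jB (carrier B)"
  obtains h where "lhom R B E h" "\<And>x. x \<in> carrier A \<Longrightarrow> h (j x) = g x"
proof -
  note tA = transport[OF lhomD(1)[OF j] jA] and tB = transport[OF lhomD(2)[OF j] jB]
  define kA where "kA = inv_into (carrier A) jA"
  have kA: "x \<in> carrier A \<Longrightarrow> kA (jA x) = x" for x using jA by (simp add: kA_def)
  define i where "i = restrict (\<lambda>x. jB (j (kA x))) (carrier (transport jA A))"
  have i: "i \<in> mod_hom R (transport jA A) (transport jB B)"
    unfolding i_def kA_def by (intro lhom_restrict lhom_comp[OF _ tB(2)] lhom_comp[OF _ j] tA)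
  have iA: "i (jA x) = jB (j x)" if "x \<in> carrier A" for x
    using that by (simp add: i_def tA kA)
  have "inj_on i (carrier (transport jA A))"
  proof (rule inj_onI)
    fix x y assume "x \<in> carrier (transport jA A)" "y \<in> carrier (transport jA A)" "i x = i y"
    then obtain u v where uv: "u \<in> carrier A" "x = jA u" "v \<in> carrier A" "y = jA v"
      "jB (j u) = jB (j v)" by (auto simp: tA iA)
    then have "j u = j v" using jB lhomD(3)[OF j] by (meson inj_onD)
    then show "x = y" using inj uv by (metis inj_onD)
  qed
  moreover define g' where "g' = restrict (\<lambda>x. g (kA x)) (carrier (transport jA A))"
  moreover have "g' \<in> mod_hom R (transport jA A) E"
    unfolding g'_def kA_def by (intro lhom_restrict lhom_comp[OF _ g] tA)
  ultimately obtain h where h: "h \<in> mod_hom R (transport jB B) E"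
      "compose (carrier (transport jA A)) h i = g'"
    using E i tA(1) tB(1) unfolding injective_module_def by blast
  have "lhom R (transport jB B) E h" by (rule mod_hom_lhom[OF h(1) tB(1) lhomD(2)[OF g]])
  then have "lhom R B E (\<lambda>x. h (jB x))" using tB(2) by (rule lhom_comp[rotated])
  moreover have "h (jB (j x)) = g x" if "x \<in> carrier A" for x
  proof -
    have "compose (carrier (transport jA A)) h i (jA x) = h (i (jA x))"
      using that by (simp add: compose_def tA)
    then show ?thesis using that h(2) by (simp add: iA g'_def tA kA)
  qed
  ultimately show thesis using that by blast
qed

lemma projective_module_lift:
  fixes jA :: "'x \<Rightarrow> ('r, 'p) univ" and jB :: "'y \<Rightarrow> ('r, 'p) univ"
    and P :: "('r, 'p, 'b) module_scheme"
  assumes P: "projective_module R P" and p: "lhom R A B p" and surj: "p ` carrier A = carrier B"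
    and g: "lhom R P B g" and jA: "inj_on jA (carrier A)" and jB: "inj_on jB (carrier B)"
  obtains h where "lhom R P A h" "\<And>x. x \<in> carrier P \<Longrightarrow> p (h x) = g x"
proof -
  note tA = transport[OF lhomD(1)[OF p] jA] and tB = transport[OF lhomD(2)[OF p] jB]
  define kA where "kA = inv_into (carrier A) jA"
  have kA: "x \<in> carrier A \<Longrightarrow> kA (jA x) = x" for x using jA by (simp add: kA_def)
  define i where "i = restrict (\<lambda>x. jB (p (kA x))) (carrier (transport jA A))"
  have i: "i \<in> mod_hom R (transport jA A) (transport jB B)"
    unfolding i_def kA_def by (intro lhom_restrict lhom_comp[OF _ tB(2)] lhom_comp[OF _ p] tA)
  have iA: "i (jA x) = jB (p x)" if "x \<in> carrier A" for x
    using that by (simp add: i_def tA kA)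
  have "i ` jA ` carrier A = jB ` p ` carrier A"
    unfolding image_image using iA by (rule image_cong[OF refl])
  then have "i ` carrier (transport jA A) = carrier (transport jB B)"
    by (simp add: tA tB surj)
  moreover define g' where "g' = restrict (\<lambda>x. jB (g x)) (carrier P)"
  moreover have "g' \<in> mod_hom R P (transport jB B)"
    unfolding g'_def by (intro lhom_restrict lhom_comp[OF g] tB)
  ultimately obtain h where h: "h \<in> mod_hom R P (transport jA A)" "compose (carrier P) i h = g'"
    using P i tA(1) tB(1) unfolding projective_module_def by blast
  have hl: "lhom R P (transport jA A) h" by (rule mod_hom_lhom[OF h(1) lhomD(1)[OF g] tA(1)])
  then have "lhom R P A (\<lambda>x. kA (h x))" unfolding kA_def using tA(3) by (rule lhom_comp)
  moreover have "p (kA (h x)) = g x" if x: "x \<in> carrier P" for x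
  proof -
    obtain a where a: "a \<in> carrier A" "h x = jA a" using lhomD(3)[OF hl x] by (auto simp: tA)
    have "i (h x) = jB (g x)" using x h(2) by (metis compose_eq g'_def restrict_apply')
    then have "jB (p a) = jB (g x)" using a by (simp add: iA)
    then have "p a = g x" using jB lhomD(3)[OF p a(1)] lhomD(3)[OF g x] by (auto simp: inj_on_def)
    then show ?thesis using a by (simp add: kA)
  qed
  ultimately show thesis using that by blast
qed

lemma injective_module_imp_baer:
  fixes E :: "('r, 'e, 'b) module_scheme"
  assumes "injective_module R E" shows "baer R E"
  unfolding baer_def
proof (intro conjI allI impI)
  show E: "left_module R E" using assms by (simp add: injective_module_def)
  fix J f assume J: "submodule J R (regular_module R)"
    and f: "lhom R ((regular_module R)\<lparr>carrier := J\<rparr>) E f"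
  have RR: "left_module R (regular_module R)"
    by (rule left_module_regular[OF left_module_ring[OF E]])
  interpret R: ring R by (rule left_module_ring[OF E])
  \<comment> \<open>Ring elements are encoded by indicator functions, so the ring and its left
    ideals fit into the bounded type.\<close>
  define j :: "'r \<Rightarrow> ('r, 'e) univ" where "j r = (\<lambda>x. if x = r then Inr 0 else Inr 1)" for r
  have j: "inj_on j A" for A
    by (rule inj_onI) (auto simp: j_def fun_eq_iff split: if_splits)
  have "lhom R ((regular_module R)\<lparr>carrier := J\<rparr>) (regular_module R) (\<lambda>x. x)"
    by (rule lhom_restrict_domain[OF lhom_id[OF RR] J])
  then obtain h where h: "lhom R (regular_module R) E h" "\<And>x. x \<in> J \<Longrightarrow> h x = f x"
    using injective_module_extend[OF assms _ _ f j j] by (auto simp: inj_on_def)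
  have "f a = a \<odot>\<^bsub>E\<^esub> h \<one>\<^bsub>R\<^esub>" if a: "a \<in> J" for a
  proof -
    have "a \<in> carrier R" using a submoduleD(1)[OF J] by auto
    then have "h (a \<otimes>\<^bsub>R\<^esub> \<one>\<^bsub>R\<^esub>) = a \<odot>\<^bsub>E\<^esub> h \<one>\<^bsub>R\<^esub>" using lhomD(5)[OF h(1), of a "\<one>\<^bsub>R\<^esub>"] by simp
    then show ?thesis using h(2)[OF a] \<open>a \<in> carrier R\<close> by simp
  qed
  then show "\<exists>x\<in>carrier E. \<forall>a\<in>J. f a = a \<odot>\<^bsub>E\<^esub> x" using lhomD(3)[OF h(1)] by auto
qed

section \<open>Coresolutions by injective modules\<close>

text \<open>\<open>G 0\<close> is the module being coresolved and \<open>\<delta> 0\<close> its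
  embedding, so the injective term usually numbered \<open>i\<close> has index \<open>i + 1\<close>.
  Keeping the augmentation in the same sequence makes lifting along it and along the differentials
  one condition.\<close>

locale coresolution =
  fixes R :: "('r, 'a) ring_scheme" and G :: "nat \<Rightarrow> ('r, 'e) module"
    and \<delta> :: "nat \<Rightarrow> 'e \<Rightarrow> 'e"
  assumes hom: "lhom R (G i) (G (Suc i)) (\<delta> i)"
    and inj: "x \<in> carrier (G 0) \<Longrightarrow> \<delta> 0 x = \<zero>\<^bsub>G 1\<^esub> \<Longrightarrow> x = \<zero>\<^bsub>G 0\<^esub>"
    and exact: "x \<in> carrier (G (Suc i)) \<Longrightarrow> \<delta> (Suc i) x = \<zero>\<^bsub>G (Suc (Suc i))\<^esub> \<Longrightarrow> x \<in> \<delta> i ` carrier (G i)"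
    and cplx: "x \<in> carrier (G i) \<Longrightarrow> \<delta> (Suc i) (\<delta> i x) = \<zero>\<^bsub>G (Suc (Suc i))\<^esub>"
    and baer_G: "baer R (G (Suc i))"
begin

lemma left_module_G [simp]: "left_module R (G i)"
  using lhomD(1)[OF hom] .

text \<open>\<open>C\<close> is acyclic for Hom into the coresolution: \<open>Ext\<^sup>i(C, G 0) = 0\<close> for \<open>i > 0\<close>.\<close>

definition lifting :: "('r, 'c, 'd) module_scheme \<Rightarrow> bool" where
  "lifting C \<longleftrightarrow> left_module R C \<and> (\<forall>i g. lhom R C (G (Suc i)) g \<longrightarrow>
     (\<forall>x \<in> carrier C. \<delta> (Suc i) (g x) = \<zero>\<^bsub>G (Suc (Suc i))\<^esub>) \<longrightarrow>
     (\<exists>h. lhom R C (G i) h \<and> (\<forall>x \<in> carrier C. g x = \<delta> i (h x))))"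

lemma liftingD:
  assumes "lifting C" "lhom R C (G (Suc i)) g"
    "\<And>x. x \<in> carrier C \<Longrightarrow> \<delta> (Suc i) (g x) = \<zero>\<^bsub>G (Suc (Suc i))\<^esub>"
  obtains h where "lhom R C (G i) h" "\<And>x. x \<in> carrier C \<Longrightarrow> g x = \<delta> i (h x)"
  using assms unfolding lifting_def by metis

lemma lifting_trivial:
  assumes "left_module R C" "carrier C = {\<zero>\<^bsub>C\<^esub>}"
  shows "lifting C"
  unfolding lifting_def
proof (intro conjI allI impI)
  fix i g assume "lhom R C (G (Suc i)) g"
  then show "\<exists>h. lhom R C (G i) h \<and> (\<forall>x\<in>carrier C. g x = \<delta> i (h x))"
    using assms lhom_zero[of R C "G (Suc i)" g] lhom_zero[OF hom[of i]]
    by (intro exI[of _ "\<lambda>x. \<zero>\<^bsub>G i\<^esub>"]) (auto intro!: lhom_const_zero)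
qed (fact assms(1))

text \<open>Direct sums are described by maps alone, which covers both \<open>dsum\<close> and the
  splitting of a power into a smaller power and one more factor.\<close>

lemma lifting_split:
  assumes C: "left_module R C"
    and p: "lhom R C C1 p1" "lhom R C C2 p2" and i: "lhom R C1 C i1" "lhom R C2 C i2"
    and split: "\<And>x. x \<in> carrier C \<Longrightarrow> x = i1 (p1 x) \<oplus>\<^bsub>C\<^esub> i2 (p2 x)"
    and l: "lifting C1" "lifting C2"
  shows "lifting C"
  unfolding lifting_def
proof (intro conjI allI impI)
  fix n g assume g: "lhom R C (G (Suc n)) g"
    and 0: "\<forall>x\<in>carrier C. \<delta> (Suc n) (g x) = \<zero>\<^bsub>G (Suc (Suc n))\<^esub>"
  obtain h1 where h1: "lhom R C1 (G n) h1" "\<And>x. x \<in> carrier C1 \<Longrightarrow> g (i1 x) = \<delta> n (h1 x)"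
    using liftingD[OF l(1) lhom_comp[OF i(1) g]] 0 lhomD(3)[OF i(1)] by blast
  obtain h2 where h2: "lhom R C2 (G n) h2" "\<And>x. x \<in> carrier C2 \<Longrightarrow> g (i2 x) = \<delta> n (h2 x)"
    using liftingD[OF l(2) lhom_comp[OF i(2) g]] 0 lhomD(3)[OF i(2)] by blast
  have "g x = \<delta> n (h1 (p1 x) \<oplus>\<^bsub>G n\<^esub> h2 (p2 x))" if x: "x \<in> carrier C" for x
  proof -
    have c: "p1 x \<in> carrier C1" "p2 x \<in> carrier C2" using x lhomD(3)[OF p(1)] lhomD(3)[OF p(2)] by auto
    then have c': "i1 (p1 x) \<in> carrier C" "i2 (p2 x) \<in> carrier C" using lhomD(3)[OF i(1)] lhomD(3)[OF i(2)] by auto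
    have "g x = g (i1 (p1 x)) \<oplus>\<^bsub>G (Suc n)\<^esub> g (i2 (p2 x))"
      using split[OF x] lhomD(4)[OF g c'] by simp
    then show ?thesis using h1 h2 c lhomD(3)[OF h1(1)] lhomD(3)[OF h2(1)] lhomD(4)[OF hom] by simp
  qed
  then show "\<exists>h. lhom R C (G n) h \<and> (\<forall>x\<in>carrier C. g x = \<delta> n (h x))"
    using lhom_plus[OF lhom_comp[OF p(1) h1(1)] lhom_comp[OF p(2) h2(1)]] by blast
qed (fact C)

lemma lifting_dsum:
  assumes "lifting C" "lifting D"
  shows "lifting (dsum C D)"
proof -
  have C: "left_module R C" and D: "left_module R D" using assms by (auto simp: lifting_def)
  interpret C: left_module R C by fact
  interpret D: left_module R D by fact
  show ?thesis
    by (rule lifting_split[OF _ _ _ _ _ _ assms, where ?p1.0 = fst and ?p2.0 = snd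
          and ?i1.0 = "\<lambda>x. (x, \<zero>\<^bsub>D\<^esub>)" and ?i2.0 = "\<lambda>x. (\<zero>\<^bsub>C\<^esub>, x)"])
      (auto intro!: lhomI C D left_module_dsum simp: C.smult_r_null D.smult_r_null)
qed

text \<open>Dimension shifting along a morphism \<open>Y \<rightarrow> X\<close> of complexes: the lower degrees only use
  exactness of \<open>X\<close>, the last one exactness of \<open>Y\<close>.\<close>

definition exact_morphism ::
    "nat \<Rightarrow> (nat \<Rightarrow> ('r, 'x) module) \<Rightarrow> (nat \<Rightarrow> 'x \<Rightarrow> 'x) \<Rightarrow> (nat \<Rightarrow> ('r, 'y) module) \<Rightarrow>
      (nat \<Rightarrow> 'y \<Rightarrow> 'y) \<Rightarrow> (nat \<Rightarrow> 'y \<Rightarrow> 'x) \<Rightarrow> bool" where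
  "exact_morphism n X \<tau> Y \<sigma> \<mu> \<longleftrightarrow>
    (\<forall>j. lhom R (X j) (X (Suc j)) (\<tau> j)) \<and> (\<forall>j. lhom R (Y j) (Y (Suc j)) (\<sigma> j)) \<and>
    (\<forall>j. lhom R (Y j) (X j) (\<mu> j)) \<and>
    (\<forall>j. \<forall>y \<in> carrier (Y j). \<mu> (Suc j) (\<sigma> j y) = \<tau> j (\<mu> j y)) \<and>
    (\<forall>j. \<forall>x \<in> carrier (X j). \<tau> (Suc j) (\<tau> j x) = \<zero>\<^bsub>X (Suc (Suc j))\<^esub>) \<and>
    (\<forall>j. \<forall>y \<in> carrier (Y j). \<sigma> (Suc j) (\<sigma> j y) = \<zero>\<^bsub>Y (Suc (Suc j))\<^esub>) \<and>
    (\<forall>j. lifting (Y (Suc j))) \<and>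
    (\<forall>j x. Suc j < n \<longrightarrow> x \<in> carrier (X (Suc j)) \<longrightarrow> \<tau> (Suc j) x = \<zero>\<^bsub>X (Suc (Suc j))\<^esub> \<longrightarrow>
      x \<in> \<tau> j ` carrier (X j)) \<and>
    (\<forall>k y. n = Suc k \<longrightarrow> y \<in> carrier (Y n) \<longrightarrow> \<sigma> n y = \<zero>\<^bsub>Y (Suc n)\<^esub> \<longrightarrow>
      y \<in> \<sigma> k ` carrier (Y k))"

lemma exact_morphismD:
  assumes "exact_morphism n X \<tau> Y \<sigma> \<mu>"
  shows "lhom R (X j) (X (Suc j)) (\<tau> j)" "lhom R (Y j) (Y (Suc j)) (\<sigma> j)"
    "lhom R (Y j) (X j) (\<mu> j)"
    "y \<in> carrier (Y j) \<Longrightarrow> \<mu> (Suc j) (\<sigma> j y) = \<tau> j (\<mu> j y)"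
    "x \<in> carrier (X j) \<Longrightarrow> \<tau> (Suc j) (\<tau> j x) = \<zero>\<^bsub>X (Suc (Suc j))\<^esub>"
    "y \<in> carrier (Y j) \<Longrightarrow> \<sigma> (Suc j) (\<sigma> j y) = \<zero>\<^bsub>Y (Suc (Suc j))\<^esub>"
    "lifting (Y (Suc j))"
    "Suc j < n \<Longrightarrow> x \<in> carrier (X (Suc j)) \<Longrightarrow> \<tau> (Suc j) x = \<zero>\<^bsub>X (Suc (Suc j))\<^esub> \<Longrightarrow>
      x \<in> \<tau> j ` carrier (X j)"
    "n = Suc k \<Longrightarrow> y \<in> carrier (Y n) \<Longrightarrow> \<sigma> n y = \<zero>\<^bsub>Y (Suc n)\<^esub> \<Longrightarrow>
      y \<in> \<sigma> k ` carrier (Y k)"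
  using assms by (simp_all add: exact_morphism_def)

lemma exact_morphism_Suc:
  assumes "exact_morphism (Suc n) X \<tau> Y \<sigma> \<mu>"
  shows "exact_morphism n (\<lambda>j. X (Suc j)) (\<lambda>j. \<tau> (Suc j)) (\<lambda>j. Y (Suc j)) (\<lambda>j. \<sigma> (Suc j)) (\<lambda>j. \<mu> (Suc j))"
  using assms unfolding exact_morphism_def by blast

text \<open>Upwards, injectivity of the terms of \<open>G\<close> pushes the composite of
  \<open>g\<close> and \<open>\<delta> i\<close> over the next differential of \<open>X\<close>, so
  the problem recurs one degree higher in both complexes; after \<open>n\<close> shifts its
  obstruction takes values in a zero term of \<open>G\<close>. Downwards, acyclicity of the terms of
  \<open>Y\<close> lifts each solution back by one term.\<close>

lemma extension_along:
  fixes X :: "nat \<Rightarrow> ('r, 'x) module" and Y :: "nat \<Rightarrow> ('r, 'y) module"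
  assumes "exact_morphism n X \<tau> Y \<sigma> \<mu>"
    and "carrier (G (Suc (Suc (i + n)))) = {\<zero>\<^bsub>G (Suc (Suc (i + n)))\<^esub>}"
    and "lhom R (X 0) (G i) g"
    and "n > 0 \<longrightarrow> (\<forall>x \<in> carrier (X 0). \<tau> 0 x = \<zero>\<^bsub>X 1\<^esub> \<longrightarrow> \<delta> i (g x) = \<zero>\<^bsub>G (Suc i)\<^esub>)"
    and "n = 0 \<longrightarrow> (\<forall>y \<in> carrier (Y 0). \<sigma> 0 y = \<zero>\<^bsub>Y 1\<^esub> \<longrightarrow> \<delta> i (g (\<mu> 0 y)) = \<zero>\<^bsub>G (Suc i)\<^esub>)"
  shows "\<exists>h. lhom R (Y 1) (G i) h \<and> (\<forall>y \<in> carrier (Y 0). \<delta> i (g (\<mu> 0 y)) = \<delta> i (h (\<sigma> 0 y)))"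
  using assms
proof (induction n arbitrary: i X Y \<tau> \<sigma> \<mu> g)
  case (0 i X Y \<tau> \<sigma> \<mu> g)
  note sig = exact_morphismD(2)[OF 0(1)] and mu = exact_morphismD(3)[OF 0(1)]
    and lift = exact_morphismD(7)[OF 0(1)] and triv = 0(2) and g = 0(3) and ker = 0(5)
  have dg: "lhom R (Y 0) (G (Suc i)) (\<lambda>y. \<delta> i (g (\<mu> 0 y)))"
    by (rule lhom_comp[OF lhom_comp[OF mu g] hom])
  obtain g' where g': "lhom R (Y 1) (G (Suc i)) g'"
      "\<And>y. y \<in> carrier (Y 0) \<Longrightarrow> \<delta> i (g (\<mu> 0 y)) = g' (\<sigma> 0 y)"
    using baer_factor[OF baer_G sig dg] ker by auto
  have "\<delta> (Suc i) (g' y) = \<zero>\<^bsub>G (Suc (Suc i))\<^esub>" if "y \<in> carrier (Y 1)" for y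
    using lhomD(3)[OF hom lhomD(3)[OF g'(1) that]] triv by simp
  then obtain h where "lhom R (Y 1) (G i) h" "\<And>y. y \<in> carrier (Y 1) \<Longrightarrow> g' y = \<delta> i (h y)"
    using liftingD[OF _ g'(1)] lift[of 0] by auto
  then show ?case using g'(2) lhomD(3)[OF sig[of 0]] by auto
next
  case (Suc n i X Y \<tau> \<sigma> \<mu> g)
  note em = exact_morphismD[OF Suc(2)]
  note tau = em(1) and sig = em(2) and mu = em(3) and com = em(4) and sig2 = em(6)
    and lift = em(7) and exX = em(8) and exY = em(9) and triv = Suc(3) and g = Suc(4) and ker = Suc(5)
  have dg: "lhom R (X 0) (G (Suc i)) (\<lambda>y. \<delta> i (g y))"
    by (rule lhom_comp[OF g hom])
  obtain g' where g': "lhom R (X 1) (G (Suc i)) g'"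
      "\<And>y. y \<in> carrier (X 0) \<Longrightarrow> \<delta> i (g y) = g' (\<tau> 0 y)"
    using baer_factor[OF baer_G tau dg] ker by auto
  have zg: "\<delta> (Suc i) (g' (\<tau> 0 y)) = \<zero>\<^bsub>G (Suc (Suc i))\<^esub>" if "y \<in> carrier (X 0)" for y
    unfolding g'(2)[OF that, symmetric] by (rule cplx[OF lhomD(3)[OF g that]])
  have "\<exists>h. lhom R (Y (Suc 1)) (G (Suc i)) h \<and>
      (\<forall>y \<in> carrier (Y (Suc 0)). \<delta> (Suc i) (g' (\<mu> (Suc 0) y)) = \<delta> (Suc i) (h (\<sigma> (Suc 0) y)))"
  proof (rule Suc.IH[OF exact_morphism_Suc[OF Suc(2)]])
    show "lhom R (X (Suc 0)) (G (Suc i)) g'" using g'(1) by simp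
    show "n > 0 \<longrightarrow> (\<forall>x \<in> carrier (X (Suc 0)). \<tau> (Suc 0) x = \<zero>\<^bsub>X (Suc 1)\<^esub> \<longrightarrow>
        \<delta> (Suc i) (g' x) = \<zero>\<^bsub>G (Suc (Suc i))\<^esub>)"
      using exX[of 0] zg by auto
    show "n = 0 \<longrightarrow> (\<forall>y \<in> carrier (Y (Suc 0)). \<sigma> (Suc 0) y = \<zero>\<^bsub>Y (Suc 1)\<^esub> \<longrightarrow>
        \<delta> (Suc i) (g' (\<mu> (Suc 0) y)) = \<zero>\<^bsub>G (Suc (Suc i))\<^esub>)"
    \<comment> \<open>At the last shift only \<open>Y\<close> is exact: the cycle is the boundary of
      some \<open>u\<close>, whose image in \<open>X\<close> is reached through the chain
      map.\<close>
    proof (intro impI ballI)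
      fix y assume y: "n = 0" "y \<in> carrier (Y (Suc 0))" "\<sigma> (Suc 0) y = \<zero>\<^bsub>Y (Suc 1)\<^esub>"
      obtain u where u: "u \<in> carrier (Y 0)" "y = \<sigma> 0 u" using exY[of 0 y] y by auto
      then show "\<delta> (Suc i) (g' (\<mu> (Suc 0) y)) = \<zero>\<^bsub>G (Suc (Suc i))\<^esub>"
        using zg[of "\<mu> 0 u"] com[of u 0] lhomD(3)[OF mu[of 0] u(1)] by simp
    qed
  qed (use triv in auto)
  then obtain h' where h': "lhom R (Y (Suc 1)) (G (Suc i)) h'"
    "\<And>y. y \<in> carrier (Y (Suc 0)) \<Longrightarrow> \<delta> (Suc i) (g' (\<mu> (Suc 0) y)) = \<delta> (Suc i) (h' (\<sigma> (Suc 0) y))"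
    by blast
  \<comment> \<open>The solution from the next degree corrects \<open>g'\<close> to take values in
    the kernel of \<open>\<delta> (Suc i)\<close>; on the image of \<open>\<sigma> 0\<close> the
    correction vanishes.\<close>
  define f where "f = (\<lambda>y. g' (\<mu> (Suc 0) y) \<ominus>\<^bsub>G (Suc i)\<^esub> h' (\<sigma> (Suc 0) y))"
  have g'1: "lhom R (X (Suc 0)) (G (Suc i)) g'" and h'1: "lhom R (Y (Suc (Suc 0))) (G (Suc i)) h'"
    using g'(1) h'(1) by simp_all
  note gm = lhom_comp[OF mu[of "Suc 0"] g'1] and hs = lhom_comp[OF sig[of "Suc 0"] h'1]
  have f: "lhom R (Y 1) (G (Suc i)) f"
    unfolding f_def using lhom_diff[OF gm hs] by simp
  have "\<delta> (Suc i) (f y) = \<zero>\<^bsub>G (Suc (Suc i))\<^esub>" if "y \<in> carrier (Y 1)" for y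
  proof -
    have y: "y \<in> carrier (Y (Suc 0))" using that by simp
    show ?thesis unfolding f_def
      using y lhomD(3)[OF gm] lhomD(3)[OF hs] h'(2) lhomD(3)[OF hom[of "Suc i"]]
      by (simp add: lhom_minus[OF hom] left_module_diff_eq_zero[OF left_module_G])
  qed
  then obtain h where h: "lhom R (Y 1) (G i) h" "\<And>y. y \<in> carrier (Y 1) \<Longrightarrow> f y = \<delta> i (h y)"
    using liftingD[OF _ f] lift[of 0] by auto
  have "\<delta> i (g (\<mu> 0 y)) = \<delta> i (h (\<sigma> 0 y))" if y: "y \<in> carrier (Y 0)" for y
  proof -
    have s: "\<sigma> 0 y \<in> carrier (Y (Suc 0))" using lhomD(3)[OF sig y] .
    have "\<delta> i (h (\<sigma> 0 y)) = f (\<sigma> 0 y)" using h(2) s by simp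
    also have "\<dots> = g' (\<mu> (Suc 0) (\<sigma> 0 y)) \<ominus>\<^bsub>G (Suc i)\<^esub> \<zero>\<^bsub>G (Suc i)\<^esub>"
      unfolding f_def using sig2[OF y] lhom_zero[OF h'1] by simp
    also have "\<dots> = g' (\<tau> 0 (\<mu> 0 y))"
    proof -
      interpret Gi: left_module R "G (Suc i)" by simp
      show ?thesis using com[OF y] lhomD(3)[OF g'1, of "\<mu> (Suc 0) (\<sigma> 0 y)"] lhomD(3)[OF mu s]
        by (simp add: a_minus_def)
    qed
    also have "\<dots> = \<delta> i (g (\<mu> 0 y))" using g'(2) lhomD(3)[OF mu y] by simp
    finally show ?thesis ..
  qed
  then show ?case using h(1) by blast
qed

lemma inj_\<delta>_0:
  assumes "x \<in> carrier (G 0)" "y \<in> carrier (G 0)" "\<delta> 0 x = \<delta> 0 y"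
  shows "x = y"
proof -
  have "\<delta> 0 (x \<ominus>\<^bsub>G 0\<^esub> y) = \<zero>\<^bsub>G 1\<^esub>"
    using assms lhomD(3)[OF hom[of 0]] lhom_minus[OF hom[of 0]] left_module_diff_eq_zero[of R "G 1"] by simp
  moreover have "x \<ominus>\<^bsub>G 0\<^esub> y \<in> carrier (G 0)"
    using submodule_minus[OF submodule_carrier[OF left_module_G]] assms by blast
  ultimately show ?thesis using inj left_module_diff_eq_zero[OF left_module_G] assms by blast
qed

text \<open>Comparison of the two ways of computing \<open>Ext(F 0, G 0)\<close>, by the resolution \<open>F\<close> and by the
  coresolution \<open>G\<close>: a class of positive degree that vanishes in the first also vanishes in the second.\<close>

lemma cocycle_step:
  assumes \<epsilon>: "lhom R F0 D \<epsilon>" and \<phi>: "lhom R F1 F0 \<phi>"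
    and ex: "\<And>x. x \<in> carrier F0 \<Longrightarrow> \<epsilon> x = \<zero>\<^bsub>D\<^esub> \<Longrightarrow> x \<in> \<phi> ` carrier F1"
    and y: "lhom R F0 (G (Suc i)) y" and y': "\<And>x. x \<in> carrier F1 \<Longrightarrow> y (\<phi> x) = \<delta> i (y' x)"
    and k': "lhom R F0 (G i) k'" "\<And>x. x \<in> carrier F1 \<Longrightarrow> \<delta> i (y' x) = \<delta> i (k' (\<phi> x))"
  shows "\<exists>k. lhom R D (G (Suc i)) k \<and> (\<forall>x \<in> carrier F0. \<delta> (Suc i) (y x) = \<delta> (Suc i) (k (\<epsilon> x)))"
proof -
  define f where "f = (\<lambda>x. y x \<ominus>\<^bsub>G (Suc i)\<^esub> \<delta> i (k' x))"
  note dk = lhom_comp[OF k'(1) hom]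
  have f: "lhom R F0 (G (Suc i)) f"
    unfolding f_def by (rule lhom_diff[OF y dk])
  have "f x = \<zero>\<^bsub>G (Suc i)\<^esub>" if x: "x \<in> carrier F0" "\<epsilon> x = \<zero>\<^bsub>D\<^esub>" for x
  proof -
    have "x \<in> \<phi> ` carrier F1" by (rule ex[OF x])
    then obtain u where "u \<in> carrier F1" "x = \<phi> u" by blast
    then have "y x = \<delta> i (k' x)" using y' k'(2) by simp
    then show ?thesis unfolding f_def
      using lhomD(3)[OF y x(1)] lhomD(3)[OF dk x(1)] left_module_diff_eq_zero[OF left_module_G] by simp
  qed
  then obtain k where k: "lhom R D (G (Suc i)) k" "\<And>x. x \<in> carrier F0 \<Longrightarrow> f x = k (\<epsilon> x)"
    using baer_factor[OF baer_G \<epsilon> f] by blast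
  have "\<delta> (Suc i) (y x) = \<delta> (Suc i) (k (\<epsilon> x))" if x: "x \<in> carrier F0" for x
  proof -
    interpret Gi: left_module R "G (Suc (Suc i))" by simp
    have "\<delta> (Suc i) (k (\<epsilon> x)) = \<delta> (Suc i) (y x) \<ominus>\<^bsub>G (Suc (Suc i))\<^esub> \<delta> (Suc i) (\<delta> i (k' x))"
      unfolding k(2)[OF x, symmetric] f_def
      using lhomD(3)[OF y x] lhomD(3)[OF dk x] by (simp add: lhom_minus[OF hom])
    then show ?thesis using lhomD(3)[OF hom lhomD(3)[OF y x]] lhomD(3)[OF k'(1) x]
      by (simp add: cplx a_minus_def)
  qed
  then show ?thesis using k(1) by blast
qed

text \<open>A staircase descent in the double complex of homomorphisms from \<open>F\<close> to
  \<open>G\<close>: each step lifts to the preceding term of \<open>G\<close> at the price of the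
  next term of \<open>F\<close>. The total degree stays fixed, so vanishing of Ext is assumed in
  that one degree, where the staircase reaches \<open>G 0\<close>.\<close>

lemma cocycle_shift:
  fixes F :: "nat \<Rightarrow> ('r, 'f) module"
  assumes "\<And>j. lhom R (F (Suc j)) (F j) (\<phi> j)"
    and "\<And>j x. x \<in> carrier (F (Suc j)) \<Longrightarrow> \<phi> j x = \<zero>\<^bsub>F j\<^esub> \<Longrightarrow>
      x \<in> \<phi> (Suc j) ` carrier (F (Suc (Suc j)))"
    and "\<And>j x. x \<in> carrier (F (Suc (Suc j))) \<Longrightarrow> \<phi> j (\<phi> (Suc j) x) = \<zero>\<^bsub>F j\<^esub>"
    and "\<And>j. lifting (F (Suc (Suc j)))"
    and "\<And>w. lhom R (F (Suc i)) (G 0) w \<Longrightarrow>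
      (\<And>x. x \<in> carrier (F (Suc (Suc i))) \<Longrightarrow> w (\<phi> (Suc i) x) = \<zero>\<^bsub>G 0\<^esub>) \<Longrightarrow>
      \<exists>w'. lhom R (F i) (G 0) w' \<and> (\<forall>x \<in> carrier (F (Suc i)). w x = w' (\<phi> i x))"
    and "lhom R (F 1) (G i) y"
    and "\<And>x. x \<in> carrier (F 2) \<Longrightarrow> \<delta> i (y (\<phi> 1 x)) = \<zero>\<^bsub>G (Suc i)\<^esub>"
  shows "\<exists>k. lhom R (F 0) (G i) k \<and> (\<forall>x \<in> carrier (F 1). \<delta> i (y x) = \<delta> i (k (\<phi> 0 x)))"
  using assms
proof (induction i arbitrary: F \<phi> y)
  case (0 F \<phi> y)
  have "y (\<phi> (Suc 0) x) = \<zero>\<^bsub>G 0\<^esub>" if "x \<in> carrier (F (Suc (Suc 0)))" for x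
  proof -
    have "\<phi> (Suc 0) x \<in> carrier (F (Suc 0))" using that by (rule lhomD(3)[OF 0(1)])
    then show ?thesis using inj lhomD(3)[OF 0(6)] 0(7)[of x] that by (simp add: numeral_2_eq_2)
  qed
  then obtain w where "lhom R (F 0) (G 0) w" "\<And>x. x \<in> carrier (F (Suc 0)) \<Longrightarrow> y x = w (\<phi> 0 x)"
    using 0(5)[of y] 0(6) by auto
  then show ?case by auto
next
  case (Suc i F \<phi> y)
  note phi = Suc(2) and ex = Suc(3) and phi2 = Suc(4) and lift = Suc(5) and ext = Suc(6)
  have y: "lhom R (F (Suc 0)) (G (Suc i)) y" using Suc(7) by simp
  have dy: "\<And>x. x \<in> carrier (F (Suc (Suc 0))) \<Longrightarrow> \<delta> (Suc i) (y (\<phi> (Suc 0) x)) = \<zero>\<^bsub>G (Suc (Suc i))\<^esub>"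
    using Suc(8) by (simp add: numeral_2_eq_2)
  obtain y' where y': "lhom R (F (Suc (Suc 0))) (G i) y'"
      "\<And>x. x \<in> carrier (F (Suc (Suc 0))) \<Longrightarrow> y (\<phi> (Suc 0) x) = \<delta> i (y' x)"
    using liftingD[OF lift lhom_comp[OF phi y] dy] by blast
  have "\<exists>k. lhom R (F (Suc 0)) (G i) k \<and> (\<forall>x \<in> carrier (F (Suc 1)). \<delta> i (y' x) = \<delta> i (k (\<phi> (Suc 0) x)))"
  proof (rule Suc.IH[of "\<lambda>j. F (Suc j)" "\<lambda>j. \<phi> (Suc j)"])
    show "lhom R (F (Suc 1)) (G i) y'" using y'(1) by simp
    show "\<delta> i (y' (\<phi> (Suc 1) x)) = \<zero>\<^bsub>G (Suc i)\<^esub>" if "x \<in> carrier (F (Suc 2))" for x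
    proof -
      have x: "x \<in> carrier (F (Suc (Suc (Suc 0))))" using that by (simp add: numeral_2_eq_2)
      then show ?thesis
        using y'(2)[OF lhomD(3)[OF phi x]] phi2[OF x] lhom_zero[OF y] by simp
    qed
    show "\<exists>w'. lhom R (F (Suc i)) (G 0) w' \<and> (\<forall>x \<in> carrier (F (Suc (Suc i))). w x = w' (\<phi> (Suc i) x))"
      if "lhom R (F (Suc (Suc i))) (G 0) w"
        "\<And>x. x \<in> carrier (F (Suc (Suc (Suc i)))) \<Longrightarrow> w (\<phi> (Suc (Suc i)) x) = \<zero>\<^bsub>G 0\<^esub>" for w
      using ext that by blast
  qed (use phi ex phi2 lift in auto)
  then obtain k' where k': "lhom R (F (Suc 0)) (G i) k'"
    "\<And>x. x \<in> carrier (F (Suc (Suc 0))) \<Longrightarrow> \<delta> i (y' x) = \<delta> i (k' (\<phi> (Suc 0) x))" by auto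
  have "\<exists>k. lhom R (F 0) (G (Suc i)) k \<and>
      (\<forall>x \<in> carrier (F (Suc 0)). \<delta> (Suc i) (y x) = \<delta> (Suc i) (k (\<phi> 0 x)))"
    by (rule cocycle_step[OF phi phi ex y y'(2) k'])
  then show ?case by simp
qed

text \<open>Acyclicity passes from the terms of a resolution to the resolved module as soon as
  Hom(-, \<open>G 0\<close>) keeps the resolution exact in positive degrees. This will yield
  self-orthogonality of \<open>U\<close> on both sides.\<close>

lemma lifting_of_resolution:
  fixes F :: "nat \<Rightarrow> ('r, 'f) module"
  assumes \<epsilon>: "lhom R (F 0) D \<epsilon>" and surj: "\<epsilon> ` carrier (F 0) = carrier D"
    and phi: "\<And>j. lhom R (F (Suc j)) (F j) (\<phi> j)"
    and ex0: "\<And>x. x \<in> carrier (F 0) \<Longrightarrow> \<epsilon> x = \<zero>\<^bsub>D\<^esub> \<Longrightarrow> x \<in> \<phi> 0 ` carrier (F 1)"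
    and cp0: "\<And>x. x \<in> carrier (F 1) \<Longrightarrow> \<epsilon> (\<phi> 0 x) = \<zero>\<^bsub>D\<^esub>"
    and ex: "\<And>j x. x \<in> carrier (F (Suc j)) \<Longrightarrow> \<phi> j x = \<zero>\<^bsub>F j\<^esub> \<Longrightarrow>
      x \<in> \<phi> (Suc j) ` carrier (F (Suc (Suc j)))"
    and phi2: "\<And>j x. x \<in> carrier (F (Suc (Suc j))) \<Longrightarrow> \<phi> j (\<phi> (Suc j) x) = \<zero>\<^bsub>F j\<^esub>"
    and lift: "\<And>j. lifting (F j)"
    and ext: "\<And>i w. lhom R (F (Suc i)) (G 0) w \<Longrightarrow>
      (\<And>x. x \<in> carrier (F (Suc (Suc i))) \<Longrightarrow> w (\<phi> (Suc i) x) = \<zero>\<^bsub>G 0\<^esub>) \<Longrightarrow>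
      \<exists>w'. lhom R (F i) (G 0) w' \<and> (\<forall>x \<in> carrier (F (Suc i)). w x = w' (\<phi> i x))"
  shows "lifting D"
  unfolding lifting_def
proof (intro conjI allI impI)
  show D: "left_module R D" by (rule lhomD(2)[OF \<epsilon>])
  fix i g assume g: "lhom R D (G (Suc i)) g"
    and dg: "\<forall>x\<in>carrier D. \<delta> (Suc i) (g x) = \<zero>\<^bsub>G (Suc (Suc i))\<^esub>"
  obtain y where y: "lhom R (F 0) (G i) y" "\<And>x. x \<in> carrier (F 0) \<Longrightarrow> g (\<epsilon> x) = \<delta> i (y x)"
    using liftingD[OF lift lhom_comp[OF \<epsilon> g]] dg lhomD(3)[OF \<epsilon>] by blast
  have dyp: "\<delta> i (y (\<phi> 0 x)) = \<zero>\<^bsub>G (Suc i)\<^esub>" if "x \<in> carrier (F (Suc 0))" for x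
    using y(2)[OF lhomD(3)[OF phi that]] cp0 that lhom_zero[OF g] by simp
  have "\<exists>h. lhom R D (G i) h \<and> (\<forall>x \<in> carrier (F 0). \<delta> i (y x) = \<delta> i (h (\<epsilon> x)))"
  \<comment> \<open>For \<open>i = 0\<close> the embedding \<open>\<delta> 0\<close> is injective
    and \<open>y\<close> itself descends to \<open>D\<close>; otherwise one more lift produces the
    cocycle on \<open>F 1\<close> that \<open>cocycle_shift\<close> needs.\<close>
  proof (cases i)
    case 0
    have kf: "y x = \<zero>\<^bsub>G i\<^esub>" if x: "x \<in> carrier (F 0)" "\<epsilon> x = \<zero>\<^bsub>D\<^esub>" for x
    proof -
      obtain u where u: "u \<in> carrier (F (Suc 0))" "x = \<phi> 0 u" using ex0[OF x] by auto
      then show ?thesis using dyp[OF u(1)] inj lhomD(3)[OF y(1) x(1)] 0 by simp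
    qed
    obtain h where h: "lhom R (D\<lparr>carrier := \<epsilon> ` carrier (F 0)\<rparr>) (G i) h"
        "\<And>x. x \<in> carrier (F 0) \<Longrightarrow> h (\<epsilon> x) = y x"
      by (rule lhom_factor_image[OF \<epsilon> y(1)], erule (1) kf) (rule that)
    have "D\<lparr>carrier := carrier D\<rparr> = D" by simp
    then have "lhom R D (G i) h" using h(1) by (simp only: surj)
    then show ?thesis using h(2) by force
  next
    case (Suc n)
    have yn: "lhom R (F 0) (G (Suc n)) y" using y(1) Suc by simp
    obtain y' where y': "lhom R (F (Suc 0)) (G n) y'"
        "\<And>x. x \<in> carrier (F (Suc 0)) \<Longrightarrow> y (\<phi> 0 x) = \<delta> n (y' x)"
      using liftingD[OF lift lhom_comp[OF phi yn]] dyp Suc by blast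
    have "\<exists>k. lhom R (F 0) (G n) k \<and> (\<forall>x \<in> carrier (F 1). \<delta> n (y' x) = \<delta> n (k (\<phi> 0 x)))"
    proof (rule cocycle_shift[where F = F and \<phi> = \<phi> and i = n and y = y', OF phi ex phi2 lift ext])
      show "lhom R (F 1) (G n) y'" using y'(1) by simp
      show "\<delta> n (y' (\<phi> 1 x)) = \<zero>\<^bsub>G (Suc n)\<^esub>" if "x \<in> carrier (F 2)" for x
      proof -
        have x: "x \<in> carrier (F (Suc (Suc 0)))" using that by (simp add: numeral_2_eq_2)
        then show ?thesis using y'(2)[OF lhomD(3)[OF phi x]] phi2[OF x] lhom_zero[OF yn] by simp
      qed
    qed
    then obtain k where k: "lhom R (F 0) (G n) k"
      "\<And>x. x \<in> carrier (F (Suc 0)) \<Longrightarrow> \<delta> n (y' x) = \<delta> n (k (\<phi> 0 x))" by auto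
    have ex0': "x \<in> \<phi> 0 ` carrier (F (Suc 0))" if "x \<in> carrier (F 0)" "\<epsilon> x = \<zero>\<^bsub>D\<^esub>" for x
      using ex0[OF that] by simp
    show ?thesis unfolding Suc by (rule cocycle_step[OF \<epsilon> phi ex0' yn y'(2) k])
  qed
  then obtain h where h': "lhom R D (G i) h \<and> (\<forall>x \<in> carrier (F 0). \<delta> i (y x) = \<delta> i (h (\<epsilon> x)))" ..
  then have "lhom R D (G i) h" ..
  moreover have "g x = \<delta> i (h x)" if "x \<in> carrier D" for x
  proof -
    have "x \<in> \<epsilon> ` carrier (F 0)" using surj that by simp
    then obtain u where u: "u \<in> carrier (F 0)" "x = \<epsilon> u" by blast
    show ?thesis unfolding u(2) y(2)[OF u(1)] by (rule h'[THEN conjunct2, THEN bspec, OF u(1)])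
  qed
  ultimately show "\<exists>h. lhom R D (G i) h \<and> (\<forall>x\<in>carrier D. g x = \<delta> i (h x))" by (intro exI[of _ h] conjI ballI)
qed

end

section \<open>Finite powers and free modules\<close>

lemma power_module_simps [simp]:
  "carrier (power_module M n) = {..<n} \<rightarrow>\<^sub>E carrier M"
  "zero (power_module M n) = (\<lambda>i \<in> {..<n}. \<zero>\<^bsub>M\<^esub>)"
  "x \<oplus>\<^bsub>power_module M n\<^esub> y = (\<lambda>i \<in> {..<n}. x i \<oplus>\<^bsub>M\<^esub> y i)"
  "a \<odot>\<^bsub>power_module M n\<^esub> x = (\<lambda>i \<in> {..<n}. a \<odot>\<^bsub>M\<^esub> x i)"
  by (simp_all add: power_module_def)

lemma restrict_eq_PiE: "x \<in> I \<rightarrow>\<^sub>E A \<Longrightarrow> (\<And>i. i \<in> I \<Longrightarrow> f i = x i) \<Longrightarrow> restrict f I = x"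
  by (metis PiE_restrict restrict_ext)

lemma left_module_power:
  assumes "left_module R M" shows "left_module R (power_module M n)"
proof -
  interpret left_module R M by fact
  have c: "x \<in> carrier (power_module M n) \<Longrightarrow> i < n \<Longrightarrow> x i \<in> carrier M" for x i by auto
  have x: "restrict f {..<n} = x" if "x \<in> carrier (power_module M n)" "\<And>i. i < n \<Longrightarrow> f i = x i" for f x
    using that by (intro restrict_eq_PiE) auto
  show ?thesis
  proof (rule left_moduleI)
    show "abelian_group (power_module M n)"
    proof (rule abelian_groupI, goal_cases)
      case (1 x y)
      then show ?case using c by simp
    next
      case 2
      then show ?case by simp
    next
      case (3 x y z)
      then show ?case using c by (simp add: M.a_assoc cong: restrict_cong)
    next
      case (4 x y)
      then show ?case using c by (simp add: M.a_comm cong: restrict_cong)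
    next
      case (5 x)
      show ?case unfolding power_module_simps by (rule x[OF 5]) (use c[OF 5] in simp)
    next
      case (6 x)
      then show ?case using c
        by (intro bexI[of _ "\<lambda>i \<in> {..<n}. \<ominus>\<^bsub>M\<^esub> x i"]) (simp_all add: M.l_neg cong: restrict_cong)
    qed
  next
    fix z assume z: "z \<in> carrier (power_module M n)"
    show "\<one>\<^bsub>R\<^esub> \<odot>\<^bsub>power_module M n\<^esub> z = z"
      unfolding power_module_simps by (rule x[OF z]) (use c[OF z] in \<open>simp add: smult_one\<close>)
  qed (use c in \<open>simp_all add: R.ring_axioms smult_closed smult_l_distr smult_r_distr smult_assoc
      cong: restrict_cong\<close>)
qed

lemma power_eqI:
  "x \<in> carrier (power_module M n) \<Longrightarrow> y \<in> carrier (power_module M n) \<Longrightarrow>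
    (\<And>i. i < n \<Longrightarrow> x i = y i) \<Longrightarrow> x = y"
  by (auto intro: PiE_ext)

definition inc :: "('r, 'm, 'b) module_scheme \<Rightarrow> nat \<Rightarrow> nat \<Rightarrow> 'm \<Rightarrow> nat \<Rightarrow> 'm" where
  "inc M n i u = (\<lambda>j \<in> {..<n}. if j = i then u else \<zero>\<^bsub>M\<^esub>)"

lemma lhom_proj: "left_module R M \<Longrightarrow> i < n \<Longrightarrow> lhom R (power_module M n) M (\<lambda>x. x i)"
  by (intro lhomI left_module_power) auto

lemma lhom_inc:
  assumes "left_module R M" shows "lhom R M (power_module M n) (inc M n i)"
proof -
  interpret left_module R M by fact
  show ?thesis
    by (intro lhomI left_module_power assms)
      (auto simp: inc_def smult_r_null intro!: restrict_ext split: if_splits)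
qed

lemma power_decomp:
  assumes M: "left_module R M" and x: "x \<in> carrier (power_module M n)"
  shows "x = (\<Oplus>\<^bsub>power_module M n\<^esub>i\<in>{..<n}. inc M n i (x i))"
proof (rule power_eqI[OF x])
  interpret left_module R M by fact
  interpret P: left_module R "power_module M n" by (rule left_module_power[OF M])
  have inc: "(\<lambda>i. inc M n i (x i)) \<in> {..<n} \<rightarrow> carrier (power_module M n)"
    using x by (intro Pi_I lhomD(3)[OF lhom_inc[OF M]]) auto
  then show "(\<Oplus>\<^bsub>power_module M n\<^esub>i\<in>{..<n}. inc M n i (x i)) \<in> carrier (power_module M n)"
    by (rule P.finsum_closed)
  have xc: "x i \<in> carrier M" if "i < n" for i using x that by auto
  fix j assume j: "j < n"
  have "(\<Oplus>\<^bsub>power_module M n\<^esub>i\<in>{..<n}. inc M n i (x i)) j = (\<Oplus>\<^bsub>M\<^esub>i\<in>{..<n}. inc M n i (x i) j)"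
    by (rule lhom_finsum[OF lhom_proj[OF M j] _ inc]) simp
  also have "\<dots> = (\<Oplus>\<^bsub>M\<^esub>i\<in>{..<n}. if j = i then x i else \<zero>\<^bsub>M\<^esub>)"
    by (rule M.finsum_cong') (use j xc in \<open>auto simp: inc_def\<close>)
  also have "\<dots> = x j"
    by (rule M.finsum_singleton) (use j xc in auto)
  finally show "x j = (\<Oplus>\<^bsub>power_module M n\<^esub>i\<in>{..<n}. inc M n i (x i)) j" ..
qed

lemma lhom_power_eq:
  assumes f: "lhom R (power_module M n) N f" and M: "left_module R M"
    and x: "x \<in> carrier (power_module M n)"
  shows "f x = (\<Oplus>\<^bsub>N\<^esub>i\<in>{..<n}. f (inc M n i (x i)))"
proof -
  have inc: "(\<lambda>i. inc M n i (x i)) \<in> {..<n} \<rightarrow> carrier (power_module M n)"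
    using x by (intro Pi_I lhomD(3)[OF lhom_inc[OF M]]) auto
  show ?thesis by (subst power_decomp[OF M x]) (rule lhom_finsum[OF f _ inc], simp)
qed

abbreviation free :: "('r, 'a) ring_scheme \<Rightarrow> nat \<Rightarrow> ('r, nat \<Rightarrow> 'r) module" where
  "free R n \<equiv> power_module (regular_module R) n"

definition basis :: "('r, 'a) ring_scheme \<Rightarrow> nat \<Rightarrow> nat \<Rightarrow> nat \<Rightarrow> 'r" where
  "basis R n i = inc (regular_module R) n i \<one>\<^bsub>R\<^esub>"

text \<open>For fixed \<open>x\<close> this is the homomorphism out of a free module with prescribed
  basis images; for fixed \<open>a\<close> it is evaluation at \<open>a\<close>, once
  \<open>x\<close> is read as such a homomorphism. The duality below alternates between both
  readings.\<close>

definition lin :: "('r, 'm, 'b) module_scheme \<Rightarrow> nat \<Rightarrow> (nat \<Rightarrow> 'm) \<Rightarrow> (nat \<Rightarrow> 'r) \<Rightarrow> 'm" where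
  "lin M n x a = (\<Oplus>\<^bsub>M\<^esub>i\<in>{..<n}. a i \<odot>\<^bsub>M\<^esub> x i)"

lemma left_module_free: "ring R \<Longrightarrow> left_module R (free R n)"
  by (intro left_module_power left_module_regular)

lemma basis_closed: "ring R \<Longrightarrow> basis R n i \<in> carrier (free R n)"
  unfolding basis_def by (rule lhomD(3)[OF lhom_inc[OF left_module_regular]])
    (simp_all add: ring.ring_simprules(6))

lemma lin_hom:
  assumes M: "left_module R M" and x: "x \<in> carrier (power_module M n)"
  shows "lhom R (free R n) M (lin M n x)"
proof -
  interpret left_module R M by fact
  have c: "a i \<odot>\<^bsub>M\<^esub> x i \<in> carrier M" "x i \<in> carrier M" "a i \<in> carrier R"
    if "a \<in> carrier (free R n)" "i < n" for a i
    using that x by (auto intro!: smult_closed)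
  show ?thesis
  proof (rule lhomI[OF left_module_free[OF R.ring_axioms] M])
    fix a b :: "nat \<Rightarrow> 'a" assume a: "a \<in> carrier (free R n)"
    show "lin M n x a \<in> carrier M"
      unfolding lin_def by (rule M.finsum_closed) (use a c in auto)
    show "lin M n x (a \<oplus>\<^bsub>free R n\<^esub> b) = lin M n x a \<oplus>\<^bsub>M\<^esub> lin M n x b"
      if b: "b \<in> carrier (free R n)"
    proof -
      have "lin M n x (a \<oplus>\<^bsub>free R n\<^esub> b) = (\<Oplus>\<^bsub>M\<^esub>i\<in>{..<n}. a i \<odot>\<^bsub>M\<^esub> x i \<oplus>\<^bsub>M\<^esub> b i \<odot>\<^bsub>M\<^esub> x i)"
        unfolding lin_def using c[OF a] c[OF b]
        by (intro M.finsum_cong') (auto simp: smult_l_distr)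
      also have "\<dots> = lin M n x a \<oplus>\<^bsub>M\<^esub> lin M n x b"
        unfolding lin_def using c[OF a] c[OF b] by (intro M.finsum_addf) auto
      finally show ?thesis .
    qed
    show "lin M n x (r \<odot>\<^bsub>free R n\<^esub> a) = r \<odot>\<^bsub>M\<^esub> lin M n x a" if r: "r \<in> carrier R" for r
    proof -
      have "lin M n x (r \<odot>\<^bsub>free R n\<^esub> a) = (\<Oplus>\<^bsub>M\<^esub>i\<in>{..<n}. r \<odot>\<^bsub>M\<^esub> (a i \<odot>\<^bsub>M\<^esub> x i))"
        unfolding lin_def using c[OF a] r
        by (intro M.finsum_cong') (auto simp: smult_assoc smult_closed)
      also have "\<dots> = r \<odot>\<^bsub>M\<^esub> lin M n x a"
        unfolding lin_def using c[OF a] r by (intro finsum_smult[symmetric]) auto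
      finally show ?thesis .
    qed
  qed
qed

lemma lin_basis:
  assumes M: "left_module R M" and x: "x \<in> carrier (power_module M n)" and i: "i < n"
  shows "lin M n x (basis R n i) = x i"
proof -
  interpret left_module R M by fact
  have xc: "x i \<in> carrier M" if "i < n" for i using x that by auto
  have "lin M n x (basis R n i) = (\<Oplus>\<^bsub>M\<^esub>j\<in>{..<n}. if i = j then x j else \<zero>\<^bsub>M\<^esub>)"
    unfolding lin_def
    by (rule M.finsum_cong') (use xc in \<open>auto simp: basis_def inc_def smult_one smult_l_null\<close>)
  also have "\<dots> = x i" by (rule M.finsum_singleton) (use i xc in auto)
  finally show ?thesis .
qed

lemma lhom_free_eq:
  assumes f: "lhom R (free R n) M f" and a: "a \<in> carrier (free R n)"
  shows "f a = lin M n (\<lambda>i \<in> {..<n}. f (basis R n i)) a"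
proof -
  interpret left_module R M by (rule lhomD(2)[OF f])
  have RR: "left_module R (regular_module R)" by (rule left_module_regular[OF R.ring_axioms])
  have b: "basis R n i \<in> carrier (free R n)" for i by (rule basis_closed[OF R.ring_axioms])
  have "f a = (\<Oplus>\<^bsub>M\<^esub>i\<in>{..<n}. f (inc (regular_module R) n i (a i)))"
    by (rule lhom_power_eq[OF f RR a])
  also have "\<dots> = lin M n (\<lambda>i \<in> {..<n}. f (basis R n i)) a"
    unfolding lin_def
  proof (rule M.finsum_cong'[OF refl])
    show "(\<lambda>i. a i \<odot>\<^bsub>M\<^esub> (\<lambda>i \<in> {..<n}. f (basis R n i)) i) \<in> {..<n} \<rightarrow> carrier M"
      using a lhomD(3)[OF f b] by (auto intro!: smult_closed)
    fix i assume i: "i \<in> {..<n}"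
    have ai: "a i \<in> carrier R" using a i by auto
    have "inc (regular_module R) n i (a i) = a i \<odot>\<^bsub>free R n\<^esub> basis R n i"
      using ai by (auto simp: inc_def basis_def intro!: restrict_ext)
    then show "f (inc (regular_module R) n i (a i)) = a i \<odot>\<^bsub>M\<^esub> (\<lambda>i \<in> {..<n}. f (basis R n i)) i"
      using lhomD(5)[OF f ai b] i by simp
  qed
  finally show ?thesis .
qed

lemma lhom_free_ext:
  assumes f: "lhom R (free R n) M f" and g: "lhom R (free R n) M g"
    and eq: "\<And>i. i < n \<Longrightarrow> f (basis R n i) = g (basis R n i)" and a: "a \<in> carrier (free R n)"
  shows "f a = g a"
  unfolding lhom_free_eq[OF f a] lhom_free_eq[OF g a]
  by (rule arg_cong[of _ _ "\<lambda>x. lin M n x a"]) (auto intro!: restrict_ext eq)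

lemma lin_comp:
  assumes g: "lhom R M N g" and x: "x \<in> carrier (power_module M n)" and a: "a \<in> carrier (free R n)"
  shows "g (lin M n x a) = lin N n (\<lambda>i \<in> {..<n}. g (x i)) a"
proof -
  note M = lhomD(1)[OF g]
  have "g (lin M n x a) = lin N n (\<lambda>i \<in> {..<n}. g (lin M n x (basis R n i))) a"
    by (rule lhom_free_eq[OF lhom_comp[OF lin_hom[OF M x] g] a])
  also have "(\<lambda>i \<in> {..<n}. g (lin M n x (basis R n i))) = (\<lambda>i \<in> {..<n}. g (x i))"
    by (rule restrict_ext) (simp add: lin_basis[OF M x])
  finally show ?thesis .
qed

definition pad :: "('r, 'm, 'b) module_scheme \<Rightarrow> nat \<Rightarrow> (nat \<Rightarrow> 'm) \<Rightarrow> nat \<Rightarrow> 'm" where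
  "pad M n x = (\<lambda>j \<in> {..<Suc n}. if j < n then x j else \<zero>\<^bsub>M\<^esub>)"

text \<open>The data of a direct sum decomposition in the form that \<open>lifting_split\<close> and
  \<open>noeth_extension\<close> expect.\<close>

lemma power_Suc_split:
  assumes M: "left_module R M"
  shows "lhom R (power_module M (Suc n)) (power_module M n) (\<lambda>x. restrict x {..<n})"
    "lhom R (power_module M (Suc n)) M (\<lambda>x. x n)"
    "lhom R (power_module M n) (power_module M (Suc n)) (pad M n)"
    "lhom R M (power_module M (Suc n)) (inc M (Suc n) n)"
    "x \<in> carrier (power_module M (Suc n)) \<Longrightarrow>
      x = pad M n (restrict x {..<n}) \<oplus>\<^bsub>power_module M (Suc n)\<^esub> inc M (Suc n) n (x n)"
proof -
  interpret left_module R M by fact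
  note P = left_module_power[OF M]
  have c: "x \<in> carrier (power_module M m) \<Longrightarrow> i < m \<Longrightarrow> x i \<in> carrier M" for x i m by auto
  show "lhom R (power_module M (Suc n)) (power_module M n) (\<lambda>x. restrict x {..<n})"
    by (rule lhomI[OF P P]) (use c in \<open>simp_all add: cong: restrict_cong\<close>)
  show "lhom R (power_module M (Suc n)) M (\<lambda>x. x n)" by (rule lhom_proj[OF M]) simp
  show "lhom R (power_module M n) (power_module M (Suc n)) (pad M n)"
    unfolding pad_def
    by (rule lhomI[OF P P]) (use c in \<open>auto simp: smult_r_null cong: if_cong intro!: restrict_ext\<close>)
  show "lhom R M (power_module M (Suc n)) (inc M (Suc n) n)" by (rule lhom_inc[OF M])
  show "x = pad M n (restrict x {..<n}) \<oplus>\<^bsub>power_module M (Suc n)\<^esub> inc M (Suc n) n (x n)"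
    if x: "x \<in> carrier (power_module M (Suc n))"
    unfolding power_module_simps
    by (rule restrict_eq_PiE[symmetric])
      (use x c[OF x] in \<open>auto simp: pad_def inc_def less_Suc_eq\<close>)
qed

context coresolution
begin

lemma lifting_power:
  assumes C: "lifting C" shows "lifting (power_module C n)"
proof (induction n)
  case 0
  show ?case
    by (rule lifting_trivial)
      (use C in \<open>auto simp: lifting_def restrict_def intro!: left_module_power\<close>)
next
  case (Suc n)
  have C': "left_module R C" using C by (simp add: lifting_def)
  show ?case
    by (rule lifting_split[OF left_module_power[OF C'] power_Suc_split[OF C'] Suc C])
qed

text \<open>A homomorphism out of the ring is determined by the image of one, so lifting it is
  exactness at a single element.\<close>

lemma lifting_regular: "ring R \<Longrightarrow> lifting (regular_module R)"
  unfolding lifting_def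
proof (intro conjI allI impI)
  assume "ring R"
  then show RR: "left_module R (regular_module R)" by (rule left_module_regular)
  interpret R: ring R by fact
  fix i g assume g: "lhom R (regular_module R) (G (Suc i)) g"
    and "\<forall>x\<in>carrier (regular_module R). \<delta> (Suc i) (g x) = \<zero>\<^bsub>G (Suc (Suc i))\<^esub>"
  then have "g \<one>\<^bsub>R\<^esub> \<in> \<delta> i ` carrier (G i)" using exact lhomD(3)[OF g, of "\<one>\<^bsub>R\<^esub>"] by simp
  then obtain y where y: "y \<in> carrier (G i)" "g \<one>\<^bsub>R\<^esub> = \<delta> i y" by blast
  interpret Gi: left_module R "G i" by simp
  have "lhom R (regular_module R) (G i) (\<lambda>a. a \<odot>\<^bsub>G i\<^esub> y)"
    using y(1) by (intro lhomI RR) (auto simp: Gi.smult_closed Gi.smult_l_distr Gi.smult_assoc)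
  moreover have "g a = \<delta> i (a \<odot>\<^bsub>G i\<^esub> y)" if "a \<in> carrier R" for a
    using lhomD(5)[OF g that, of "\<one>\<^bsub>R\<^esub>"] lhomD(5)[OF hom that y(1)] that y(2) by simp
  ultimately show "\<exists>h. lhom R (regular_module R) (G i) h \<and>
      (\<forall>x\<in>carrier (regular_module R). g x = \<delta> i (h x))" by auto
qed

end

section \<open>Noetherian modules\<close>

text \<open>That \<open>A\<close> generates \<open>N\<close> is tested against submodules of
  \<open>M\<close>, which avoids moving between these and the submodules of the module with carrier
  \<open>N\<close>.\<close>

definition noeth :: "('r, 'a) ring_scheme \<Rightarrow> ('r, 'm, 'b) module_scheme \<Rightarrow> bool" where
  "noeth R M \<longleftrightarrow> left_module R M \<and> (\<forall>N. submodule N R M \<longrightarrow>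
    (\<exists>A. finite A \<and> A \<subseteq> N \<and> (\<forall>L. submodule L R M \<longrightarrow> A \<subseteq> L \<longrightarrow> N \<subseteq> L)))"

lemma noethD:
  assumes "noeth R M" "submodule N R M"
  shows "\<exists>A. finite A \<and> A \<subseteq> N \<and> (\<forall>L. submodule L R M \<longrightarrow> A \<subseteq> L \<longrightarrow> N \<subseteq> L)"
  using assms unfolding noeth_def by blast

text \<open>Lifted generators of the image of \<open>L\<close> in \<open>N\<close>, together with
  the images of generators of its preimage in \<open>K\<close>, generate \<open>L\<close>: modulo
  the former, every element of \<open>L\<close> comes from \<open>K\<close>.\<close>

lemma noeth_extension:
  assumes p: "lhom R M N p" and i: "lhom R K M i" and K: "noeth R K" and N: "noeth R N"
    and ker: "\<And>x. x \<in> carrier M \<Longrightarrow> p x = \<zero>\<^bsub>N\<^esub> \<Longrightarrow> x \<in> i ` carrier K"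
  shows "noeth R M"
  unfolding noeth_def
proof (intro conjI allI impI)
  show M: "left_module R M" by (rule lhomD(1)[OF p])
  interpret M: left_module R M by fact
  fix L assume L: "submodule L R M"
  note Lc = submoduleD(1)[OF L]
  obtain A where A: "finite A" "A \<subseteq> p ` L"
      "\<forall>H. submodule H R N \<longrightarrow> A \<subseteq> H \<longrightarrow> p ` L \<subseteq> H"
    using noethD[OF N submodule_image[OF p L]] by (elim exE conjE)
  obtain B where B: "finite B" "B \<subseteq> {x \<in> carrier K. i x \<in> L}"
      "\<forall>H. submodule H R K \<longrightarrow> B \<subseteq> H \<longrightarrow> {x \<in> carrier K. i x \<in> L} \<subseteq> H"
    using noethD[OF K submodule_vimage[OF i L]] by (elim exE conjE)
  obtain A' where A': "finite A'" "A' \<subseteq> L" "A = p ` A'"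
    using finite_subset_image[OF A(1,2)] by blast
  have "L \<subseteq> H" if H: "submodule H R M" "A' \<union> i ` B \<subseteq> H" for H
  proof
    fix x assume x: "x \<in> L"
    have HL: "submodule (H \<inter> L) R M" by (rule submodule_Int[OF M H(1) L])
    have "p ` L \<subseteq> p ` (H \<inter> L)"
      by (rule A(3)[rule_format, OF submodule_image[OF p HL]]) (use A' H in blast)
    then obtain y where y: "y \<in> H" "y \<in> L" "p x = p y" using x by blast
    have xy: "x \<ominus>\<^bsub>M\<^esub> y \<in> L" by (rule submodule_minus[OF L x y(2)])
    have "p (x \<ominus>\<^bsub>M\<^esub> y) = \<zero>\<^bsub>N\<^esub>"
      using lhom_minus[OF p, of x y] left_module_diff_eq_zero[OF lhomD(2)[OF p], of "p x" "p y"] x y Lc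
        lhomD(3)[OF p] by auto
    then obtain k where k: "k \<in> carrier K" "x \<ominus>\<^bsub>M\<^esub> y = i k"
      using ker xy Lc by blast
    have "{x \<in> carrier K. i x \<in> L} \<subseteq> {x \<in> carrier K. i x \<in> H}"
      by (rule B(3)[rule_format, OF submodule_vimage[OF i H(1)]]) (use H B in blast)
    then have "x \<ominus>\<^bsub>M\<^esub> y \<in> H" using k xy by auto
    then have "(x \<ominus>\<^bsub>M\<^esub> y) \<oplus>\<^bsub>M\<^esub> y \<in> H" using submoduleD(3)[OF H(1)] y by blast
    moreover have "x \<in> carrier M" "y \<in> carrier M" using x y Lc by auto
    then have "(x \<ominus>\<^bsub>M\<^esub> y) \<oplus>\<^bsub>M\<^esub> y = x" by (simp add: a_minus_def M.a_assoc M.l_neg)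
    ultimately show "x \<in> H" by simp
  qed
  then show "\<exists>A. finite A \<and> A \<subseteq> L \<and> (\<forall>H. submodule H R M \<longrightarrow> A \<subseteq> H \<longrightarrow> L \<subseteq> H)"
    using A' B by (intro exI[of _ "A' \<union> i ` B"]) auto
qed

lemma noeth_trivial: "left_module R M \<Longrightarrow> carrier M = {\<zero>\<^bsub>M\<^esub>} \<Longrightarrow> noeth R M"
  unfolding noeth_def
  by (intro conjI allI impI exI[of _ "{}"]) (simp_all, metis singletonD submoduleD(1,2) subsetD subsetI)

lemma noeth_image:
  assumes "lhom R K M i" "noeth R K" "i ` carrier K = carrier M"
  shows "noeth R M"
\<comment> \<open>With the zero module as target, all of \<open>M\<close> must come from
  \<open>K\<close>.\<close>
proof (rule noeth_extension[OF lhom_const_zero assms(1,2) noeth_trivial])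
  let ?Z = "M\<lparr>carrier := {\<zero>\<^bsub>M\<^esub>}\<rparr>"
  show M: "left_module R M" by (rule lhomD(2)[OF assms(1)])
  show "left_module R ?Z" "left_module R ?Z" by (rule left_module_submodule[OF M submodule_zero[OF M]])+
qed (use assms(3) in auto)

lemma noeth_dsum:
  assumes "noeth R M" "noeth R N" shows "noeth R (dsum M N)"
proof -
  have M: "left_module R M" and N: "left_module R N" using assms by (auto simp: noeth_def)
  interpret N: left_module R N by fact
  show ?thesis
    by (rule noeth_extension[OF _ _ assms, of _ snd "\<lambda>x. (x, \<zero>\<^bsub>N\<^esub>)"])
      (auto intro!: lhomI M N left_module_dsum simp: N.smult_r_null)
qed

lemma noeth_power:
  assumes "noeth R M" shows "noeth R (power_module M n)"
proof (induction n)
  case 0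
  show ?case by (rule noeth_trivial) (use assms in \<open>auto simp: noeth_def intro!: left_module_power\<close>)
next
  case (Suc n)
  have M: "left_module R M" using assms by (simp add: noeth_def)
  interpret left_module R M by fact
  note s = power_Suc_split[OF M]
  show ?case
  proof (rule noeth_extension[OF s(2,3) Suc assms])
    fix x assume x: "x \<in> carrier (power_module M (Suc n))" "x n = \<zero>\<^bsub>M\<^esub>"
    have r: "restrict x {..<n} \<in> carrier (power_module M n)" by (rule lhomD(3)[OF s(1) x(1)])
    have "pad M n (restrict x {..<n}) = x"
      unfolding pad_def
    proof (rule restrict_eq_PiE)
      show "x \<in> {..<Suc n} \<rightarrow>\<^sub>E carrier M" using x(1) by simp
      show "(if i < n then restrict x {..<n} i else \<zero>\<^bsub>M\<^esub>) = x i" if "i \<in> {..<Suc n}" for i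
        using that x(2) by (cases "i < n") (simp_all add: less_Suc_eq)
    qed
    from this[symmetric] show "x \<in> pad M n ` carrier (power_module M n)" by (rule image_eqI[OF _ r])
  qed
qed

lemma finite_generators:
  assumes M: "left_module R M" and A: "finite A" "A \<subseteq> carrier M"
  obtains n y where "y \<in> carrier (power_module M n)" "A \<subseteq> lin M n y ` carrier (free R n)"
    "\<forall>L. submodule L R M \<longrightarrow> A \<subseteq> L \<longrightarrow> lin M n y ` carrier (free R n) \<subseteq> L"
proof -
  interpret left_module R M by fact
  obtain h where h: "bij_betw h {0..<card A} A" using ex_bij_betw_nat_finite[OF A(1)] by blast
  define n where "n = card A"
  define y where "y = restrict h {..<n}"
  have hA: "h ` {..<n} = A" using h by (simp add: bij_betw_def n_def lessThan_atLeast0)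
  have y: "y \<in> carrier (power_module M n)" using hA A by (auto simp: y_def)
  show thesis
  proof (rule that[OF y])
    show "A \<subseteq> lin M n y ` carrier (free R n)"
    proof
      fix a assume "a \<in> A"
      then obtain i where i: "i < n" "a = y i" using hA by (auto simp: y_def)
      then show "a \<in> lin M n y ` carrier (free R n)"
        using lin_basis[OF M y i(1)] basis_closed[OF R.ring_axioms] by (metis imageI)
    qed
    show "\<forall>L. submodule L R M \<longrightarrow> A \<subseteq> L \<longrightarrow> lin M n y ` carrier (free R n) \<subseteq> L"
    proof (intro allI impI)
      fix L assume L: "submodule L R M" "A \<subseteq> L"
      have yL: "y \<in> carrier (power_module (M\<lparr>carrier := L\<rparr>) n)" using hA L by (auto simp: y_def)
      \<comment> \<open>Linear combinations formed inside \<open>L\<close> agree with those formed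
        in \<open>M\<close>, so the latter stay in \<open>L\<close>.\<close>
      have "lin (M\<lparr>carrier := L\<rparr>) n y a = lin M n y a" if "a \<in> carrier (free R n)" for a
      proof -
        have "lhom R (M\<lparr>carrier := L\<rparr>) M (\<lambda>x. x)"
          by (rule lhom_restrict_domain[OF lhom_id[OF M] L(1)])
        from lin_comp[OF this yL that] show ?thesis using y by (auto simp: PiE_restrict)
      qed
      moreover have "lin (M\<lparr>carrier := L\<rparr>) n y a \<in> L" if "a \<in> carrier (free R n)" for a
        using lhomD(3)[OF lin_hom[OF left_module_submodule[OF M L(1)] yL] that] by simp
      ultimately show "lin M n y ` carrier (free R n) \<subseteq> L" by (metis image_subsetI)
    qed
  qed
qed

lemma noeth_generators:
  assumes "noeth R M" "submodule N R M"
  obtains n y where "y \<in> carrier (power_module M n)" "lin M n y ` carrier (free R n) = N"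
proof -
  have M: "left_module R M" using assms by (simp add: noeth_def)
  obtain A where A: "finite A" "A \<subseteq> N" "\<forall>L. submodule L R M \<longrightarrow> A \<subseteq> L \<longrightarrow> N \<subseteq> L"
    using noethD[OF assms] by (elim exE conjE)
  have AM: "A \<subseteq> carrier M" using A(2) submoduleD(1)[OF assms(2)] by blast
  obtain n y where y: "y \<in> carrier (power_module M n)" "A \<subseteq> lin M n y ` carrier (free R n)"
    "\<forall>L. submodule L R M \<longrightarrow> A \<subseteq> L \<longrightarrow> lin M n y ` carrier (free R n) \<subseteq> L"
    by (rule finite_generators[OF M A(1) AM]) (rule that)
  have "submodule (lin M n y ` carrier (free R n)) R M"
    using submodule_image[OF lin_hom[OF M y(1)] submodule_carrier[OF lhomD(1)[OF lin_hom[OF M y(1)]]]] .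
  from A(3)[rule_format, OF this y(2)] y(3)[rule_format, OF assms(2) A(2)]
  have "lin M n y ` carrier (free R n) = N" by (rule subset_antisym[rotated])
  then show thesis by (rule that[OF y(1)])
qed

lemma left_noetherian_noeth:
  assumes "left_noetherian R" shows "noeth R (regular_module R)"
  unfolding noeth_def
proof (intro conjI allI impI)
  have "ring R" using assms by (simp add: left_noetherian_def)
  then show RR: "left_module R (regular_module R)" by (rule left_module_regular)
  fix N assume N: "submodule N R (regular_module R)"
  then obtain A where A: "finite A" "A \<subseteq> N"
    "N = \<Inter> {L. submodule L R ((regular_module R)\<lparr>carrier := N\<rparr>) \<and> A \<subseteq> L}"
    using assms unfolding left_noetherian_def finitely_generated_def by auto
  have "N \<subseteq> L" if L: "submodule L R (regular_module R)" "A \<subseteq> L" for L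
  proof -
    have "submodule (L \<inter> N) R ((regular_module R)\<lparr>carrier := N\<rparr>)"
      using submodule_Int[OF RR L(1) N] submodule_restrict_iff[OF RR N] by blast
    then have "N \<subseteq> L \<inter> N" using A(2,3) L(2) by blast
    then show ?thesis by blast
  qed
  then show "\<exists>A. finite A \<and> A \<subseteq> N \<and> (\<forall>L. submodule L R (regular_module R) \<longrightarrow> A \<subseteq> L \<longrightarrow> N \<subseteq> L)"
    using A by blast
qed

lemma finitely_generated_noeth:
  assumes M: "left_module R M" and fg: "finitely_generated R M" and R: "noeth R (regular_module R)"
  shows "noeth R M"
proof -
  obtain A where A: "finite A" "A \<subseteq> carrier M" "carrier M = \<Inter> {N. submodule N R M \<and> A \<subseteq> N}"
    using fg unfolding finitely_generated_def by (elim exE conjE)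
  obtain n y where y: "y \<in> carrier (power_module M n)" "A \<subseteq> lin M n y ` carrier (free R n)"
    by (rule finite_generators[OF M A(1,2)]) (rule that)
  note l = lin_hom[OF M y(1)]
  have sub: "submodule (lin M n y ` carrier (free R n)) R M"
    using submodule_image[OF l submodule_carrier[OF lhomD(1)[OF l]]] .
  have "\<Inter> {N. submodule N R M \<and> A \<subseteq> N} \<subseteq> lin M n y ` carrier (free R n)"
    by (rule Inter_lower) (rule CollectI conjI sub y(2))+
  with submoduleD(1)[OF sub] have "lin M n y ` carrier (free R n) = carrier M"
    unfolding A(3)[symmetric] by (rule subset_antisym)
  then show ?thesis by (rule noeth_image[OF l noeth_power[OF R]])
qed

text \<open>\<open>l j\<close> is the rank in degree \<open>j\<close>. With \<open>s = 0\<close>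
  this is a resolution of the cokernel of \<open>c 0\<close>; a larger \<open>s\<close> admits
  homology in low degrees, as in a resolution that has been shifted upwards.\<close>

definition free_exact ::
    "('r, 'a) ring_scheme \<Rightarrow> nat \<Rightarrow> (nat \<Rightarrow> nat) \<Rightarrow> (nat \<Rightarrow> (nat \<Rightarrow> 'r) \<Rightarrow> nat \<Rightarrow> 'r) \<Rightarrow> bool" where
  "free_exact R s l c \<longleftrightarrow>
    (\<forall>j. lhom R (free R (l (Suc j))) (free R (l j)) (c j)) \<and>
    (\<forall>j. \<forall>x \<in> carrier (free R (l (Suc (Suc j)))). c j (c (Suc j) x) = \<zero>\<^bsub>free R (l j)\<^esub>) \<and>
    (\<forall>j\<ge>s. \<forall>x \<in> carrier (free R (l (Suc j))). c j x = \<zero>\<^bsub>free R (l j)\<^esub> \<longrightarrow>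
      x \<in> c (Suc j) ` carrier (free R (l (Suc (Suc j)))))"

lemma free_exactD:
  assumes "free_exact R s l c"
  shows "lhom R (free R (l (Suc j))) (free R (l j)) (c j)"
    "x \<in> carrier (free R (l (Suc (Suc j)))) \<Longrightarrow> c j (c (Suc j) x) = \<zero>\<^bsub>free R (l j)\<^esub>"
    "s \<le> j \<Longrightarrow> x \<in> carrier (free R (l (Suc j))) \<Longrightarrow> c j x = \<zero>\<^bsub>free R (l j)\<^esub> \<Longrightarrow>
      x \<in> c (Suc j) ` carrier (free R (l (Suc (Suc j))))"
  using assms unfolding free_exact_def by (simp_all del: power_module_simps)

text \<open>Prescribing the image \<open>K\<close> of the first map makes this a resolution of the
  quotient by \<open>K\<close>, although that quotient is never formed.\<close>

lemma free_resolution: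
  assumes R: "noeth R (regular_module R)" and K: "submodule K R (free R n)"
  obtains l c where "l 0 = n" "c 0 ` carrier (free R (l 1)) = K" "free_exact R 0 l c"
proof -
  have RR: "left_module R (regular_module R)" using R by (simp add: noeth_def)
  have gen: "\<exists>b y. y \<in> carrier (power_module (free R a) b) \<and> lin (free R a) b y ` carrier (free R b) = N"
    if "submodule N R (free R a)" for N a
    by (rule noeth_generators[OF noeth_power[OF R] that]) (intro exI conjI)
  have ex: "\<exists>b f. lhom R (free R b) (free R a) f \<and> f ` carrier (free R b) = N"
    if "submodule N R (free R a)" for N a
    using gen[OF that] lin_hom[OF left_module_power[OF RR]] by fast
  \<comment> \<open>The state \<open>(a, b, f)\<close> records a map \<open>f\<close> from the free
    module of rank \<open>b\<close> to that of rank \<open>a\<close>; its successor maps into rank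
    \<open>b\<close> and covers the kernel of \<open>f\<close>.\<close>
  have "\<exists>s. \<forall>j. (case s j of (a, b, f) \<Rightarrow> lhom R (free R b) (free R a) f \<and>
        (j = 0 \<longrightarrow> a = n \<and> f ` carrier (free R b) = K)) \<and>
      (case s j of (a, b, f) \<Rightarrow> case s (Suc j) of (a', b', f') \<Rightarrow> a' = b \<and>
        f' ` carrier (free R b') = {x \<in> carrier (free R b). f x = \<zero>\<^bsub>free R a\<^esub>})"
  proof (rule dependent_nat_choice)
    show "\<exists>x. case x of (a, b, f) \<Rightarrow> lhom R (free R b) (free R a) f \<and>
        (0 = (0::nat) \<longrightarrow> a = n \<and> f ` carrier (free R b) = K)"
      using ex[OF K] by auto
    fix x :: "nat \<times> nat \<times> ((nat \<Rightarrow> 'a) \<Rightarrow> nat \<Rightarrow> 'a)" and j :: nat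
    assume x: "case x of (a, b, f) \<Rightarrow> lhom R (free R b) (free R a) f \<and>
        (j = 0 \<longrightarrow> a = n \<and> f ` carrier (free R b) = K)"
    obtain a b f where abf: "x = (a, b, f)" by (cases x)
    then have f: "lhom R (free R b) (free R a) f" using x by simp
    obtain b' f' where "lhom R (free R b') (free R b) f'"
      "f' ` carrier (free R b') = {x \<in> carrier (free R b). f x = \<zero>\<^bsub>free R a\<^esub>}"
      using ex[OF submodule_kernel[OF f]] by blast
    then show "\<exists>y. (case y of (a, b, f) \<Rightarrow> lhom R (free R b) (free R a) f \<and>
          (Suc j = 0 \<longrightarrow> a = n \<and> f ` carrier (free R b) = K)) \<and>
        (case x of (a, b, f) \<Rightarrow> case y of (a', b', f') \<Rightarrow> a' = b \<and>
          f' ` carrier (free R b') = {x \<in> carrier (free R b). f x = \<zero>\<^bsub>free R a\<^esub>})"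
      using abf by (intro exI[of _ "(b, b', f')"]) simp
  qed
  then obtain s where s: "\<And>j. (case s j of (a, b, f) \<Rightarrow> lhom R (free R b) (free R a) f \<and>
        (j = 0 \<longrightarrow> a = n \<and> f ` carrier (free R b) = K)) \<and>
      (case s j of (a, b, f) \<Rightarrow> case s (Suc j) of (a', b', f') \<Rightarrow> a' = b \<and>
        f' ` carrier (free R b') = {x \<in> carrier (free R b). f x = \<zero>\<^bsub>free R a\<^esub>})" by blast
  define l where "l j = fst (s j)" for j
  define c where "c j = snd (snd (s j))" for j
  have l': "l (Suc j) = fst (snd (s j))" for j using s[of j] by (auto simp: l_def split: prod.splits)
  have c: "lhom R (free R (l (Suc j))) (free R (l j)) (c j)" for j
    using s[of j] l'[of j] by (auto simp: l_def c_def split: prod.splits)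
  have ker: "c (Suc j) ` carrier (free R (l (Suc (Suc j)))) =
      {x \<in> carrier (free R (l (Suc j))). c j x = \<zero>\<^bsub>free R (l j)\<^esub>}" for j
    using s[of j] l'[of j] l'[of "Suc j"] by (auto simp: l_def c_def split: prod.splits)
  show thesis
  proof (rule that[of l c])
    show "l 0 = n" "c 0 ` carrier (free R (l 1)) = K"
      using s[of 0] l'[of 0] by (auto simp: l_def c_def split: prod.splits)
    show "free_exact R 0 l c" unfolding free_exact_def using c ker by blast
  qed
qed

section \<open>Duality with respect to a faithfully balanced bimodule\<close>

definition dual ::
    "('r, 'a) ring_scheme \<Rightarrow> ('r, 'm, 'b) module_scheme \<Rightarrow> nat \<Rightarrow> nat \<Rightarrow>
      ((nat \<Rightarrow> 'r) \<Rightarrow> nat \<Rightarrow> 'r) \<Rightarrow> (nat \<Rightarrow> 'm) \<Rightarrow> nat \<Rightarrow> 'm" where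
  "dual R M n m \<phi> x = (\<lambda>i \<in> {..<m}. lin M n x (\<phi> (basis R m i)))"

lemma dual_closed:
  assumes "lhom R (free R m) (free R n) \<phi>" "left_module R M" "x \<in> carrier (power_module M n)"
  shows "dual R M n m \<phi> x \<in> carrier (power_module M m)"
proof -
  interpret left_module R M by fact
  show ?thesis
    using lhomD(3)[OF lin_hom[OF assms(2,3)] lhomD(3)[OF assms(1) basis_closed[OF R.ring_axioms]]]
    by (auto simp: dual_def)
qed

text \<open>Under the identification of \<open>x \<in> M\<^sup>n\<close> with \<open>lin M n x \<in> Hom(R\<^sup>n, M)\<close>, the map
  \<open>dual R M n m \<phi>\<close> is \<open>Hom(\<phi>, M)\<close>.\<close>

lemma lin_dual:
  assumes \<phi>: "lhom R (free R m) (free R n) \<phi>" and M: "left_module R M"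
    and x: "x \<in> carrier (power_module M n)" and a: "a \<in> carrier (free R m)"
  shows "lin M m (dual R M n m \<phi> x) a = lin M n x (\<phi> a)"
proof (rule lhom_free_ext[OF lin_hom[OF M dual_closed[OF \<phi> M x]] lhom_comp[OF \<phi> lin_hom[OF M x]] _ a])
  fix i assume "i < m"
  then show "lin M m (dual R M n m \<phi> x) (basis R m i) = lin M n x (\<phi> (basis R m i))"
    using lin_basis[OF M dual_closed[OF \<phi> M x]] by (simp add: dual_def)
qed

lemma lin_zero:
  assumes M: "left_module R M" and a: "a \<in> carrier (free R n)"
  shows "lin M n \<zero>\<^bsub>power_module M n\<^esub> a = \<zero>\<^bsub>M\<^esub>"
proof -
  interpret left_module R M by (rule M)
  have "lin M n \<zero>\<^bsub>power_module M n\<^esub> a = (\<Oplus>\<^bsub>M\<^esub>i\<in>{..<n}. \<zero>\<^bsub>M\<^esub>)"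
    unfolding lin_def
    by (rule M.finsum_cong') (use a in \<open>auto intro!: smult_r_null\<close>)
  then show ?thesis by (simp add: M.finsum_zero del: power_module_simps)
qed

lemma lin_eq_imp_eq:
  assumes M: "left_module R M"
    and x: "x \<in> carrier (power_module M n)" and y: "y \<in> carrier (power_module M n)"
    and eq: "\<And>a. a \<in> carrier (free R n) \<Longrightarrow> lin M n x a = lin M n y a"
  shows "x = y"
proof (rule power_eqI[OF x y])
  interpret left_module R M by fact
  fix i assume i: "i < n"
  show "x i = y i"
    using eq[OF basis_closed[OF R.ring_axioms]] lin_basis[OF M x i] lin_basis[OF M y i] by simp
qed

lemma lin_of_hom:
  assumes f: "lhom R (free R n) M f"
  obtains x where "x \<in> carrier (power_module M n)" "\<And>a. a \<in> carrier (free R n) \<Longrightarrow> f a = lin M n x a"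
proof -
  have R: "ring R" using left_module_ring[OF lhomD(1)[OF f]] .
  show thesis
  proof (rule that)
    show "(\<lambda>i \<in> {..<n}. f (basis R n i)) \<in> carrier (power_module M n)"
      using lhomD(3)[OF f basis_closed[OF R]] by auto
  qed (rule lhom_free_eq[OF f])
qed

lemma free_lift:
  assumes f: "lhom R (free R n) N f" and g: "lhom R M N g"
    and im: "\<And>x. x \<in> carrier (free R n) \<Longrightarrow> f x \<in> g ` carrier M"
  shows "\<exists>h. lhom R (free R n) M h \<and> (\<forall>x \<in> carrier (free R n). g (h x) = f x)"
proof -
  have R: "ring R" using left_module_ring[OF lhomD(1)[OF f]] .
  have "\<forall>i. \<exists>y \<in> carrier M. f (basis R n i) = g y"
    using im[OF basis_closed[OF R]] by blast
  then obtain y where y: "\<And>i. y i \<in> carrier M" "\<And>i. f (basis R n i) = g (y i)" by metis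
  define x where "x = restrict y {..<n}"
  have x: "x \<in> carrier (power_module M n)" using y(1) by (simp add: x_def)
  note l = lin_hom[OF lhomD(1)[OF g] x]
  have "g (lin M n x a) = f a" if a: "a \<in> carrier (free R n)" for a
  proof (rule lhom_free_ext[OF lhom_comp[OF l g] f _ a])
    show "g (lin M n x (basis R n i)) = f (basis R n i)" if "i < n" for i
      unfolding lin_basis[OF lhomD(1)[OF g] x that] using that by (simp add: y(2) x_def)
  qed
  then show ?thesis using l by blast
qed

lemma lhom_power_ext:
  assumes f: "lhom R (power_module M n) N f" and g: "lhom R (power_module M n) N g"
    and M: "left_module R M"
    and eq: "\<And>i u. i < n \<Longrightarrow> u \<in> carrier M \<Longrightarrow> f (inc M n i u) = g (inc M n i u)"
    and x: "x \<in> carrier (power_module M n)"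
  shows "f x = g x"
proof -
  interpret N: left_module R N by (rule lhomD(2)[OF f])
  have c: "x i \<in> carrier M" if "i < n" for i using x that by auto
  show ?thesis
    unfolding lhom_power_eq[OF f M x] lhom_power_eq[OF g M x]
    by (rule N.finsum_cong'[OF refl])
      (use c eq lhomD(3)[OF g lhomD(3)[OF lhom_inc[OF M]]] in auto)
qed

text \<open>\<open>G 0\<close> is a copy of \<open>M\<close> inside the type of the injective terms.
  \<open>lifting_M\<close> says that Ext of \<open>M\<close> with itself vanishes in positive
  degrees.\<close>

locale resolved = coresolution R G \<delta>
  for R :: "('r, 'a) ring_scheme" and G :: "nat \<Rightarrow> ('r, 'e) module" and \<delta> +
  fixes M :: "('r, 'm, 'b) module_scheme" and \<iota> :: "'m \<Rightarrow> 'e"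
  assumes \<iota>: "lhom R M (G 0) \<iota>" and bij: "bij_betw \<iota> (carrier M) (carrier (G 0))"
    and lifting_M: "lifting M"
begin

lemma left_module_M: "left_module R M" by (rule lhomD(1)[OF \<iota>])

lemma ring_R: "ring R" by (rule left_module_ring[OF left_module_M])

lemma hom_into_G0:
  assumes h: "lhom R C (G 0) h"
  obtains h' where "lhom R C M h'" "\<And>x. x \<in> carrier C \<Longrightarrow> h x = \<iota> (h' x)"
proof -
  obtain k where k: "lhom R (G 0) M k" "\<And>x. x \<in> carrier M \<Longrightarrow> k (\<iota> x) = x"
      "\<And>y. y \<in> carrier (G 0) \<Longrightarrow> \<iota> (k y) = y"
    by (rule lhom_inverse[OF \<iota> bij]) (rule that)
  show thesis by (rule that[OF lhom_comp[OF h k(1)]]) (simp add: k(3) lhomD(3)[OF h])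
qed

lemma inj_\<iota>: "x \<in> carrier M \<Longrightarrow> y \<in> carrier M \<Longrightarrow> \<iota> x = \<iota> y \<Longrightarrow> x = y"
  using bij by (auto simp: bij_betw_def dest: inj_onD)

text \<open>Since \<open>\<delta> 0\<close> and \<open>\<iota>\<close> are injective, the equality
  up to \<open>\<delta> 0\<close> in \<open>extension_along\<close> becomes a genuine factorization
  for maps into \<open>M\<close>.\<close>

lemma extension_along':
  fixes X :: "nat \<Rightarrow> ('r, 'x) module" and Y :: "nat \<Rightarrow> ('r, 'y) module"
  assumes em: "exact_morphism n X \<tau> Y \<sigma> \<mu>"
    and triv: "carrier (G (Suc (Suc n))) = {\<zero>\<^bsub>G (Suc (Suc n))\<^esub>}"
    and f: "lhom R (X 0) M f"
    and ker: "\<And>x. n > 0 \<Longrightarrow> x \<in> carrier (X 0) \<Longrightarrow> \<tau> 0 x = \<zero>\<^bsub>X 1\<^esub> \<Longrightarrow> f x = \<zero>\<^bsub>M\<^esub>"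
      "\<And>y. n = 0 \<Longrightarrow> y \<in> carrier (Y 0) \<Longrightarrow> \<sigma> 0 y = \<zero>\<^bsub>Y 1\<^esub> \<Longrightarrow> f (\<mu> 0 y) = \<zero>\<^bsub>M\<^esub>"
  shows "\<exists>h. lhom R (Y 1) M h \<and> (\<forall>y \<in> carrier (Y 0). f (\<mu> 0 y) = h (\<sigma> 0 y))"
proof -
  have "\<exists>h. lhom R (Y 1) (G 0) h \<and> (\<forall>y \<in> carrier (Y 0). \<delta> 0 (\<iota> (f (\<mu> 0 y))) = \<delta> 0 (h (\<sigma> 0 y)))"
  proof (rule extension_along[OF em])
    show "lhom R (X 0) (G 0) (\<lambda>x. \<iota> (f x))" by (rule lhom_comp[OF f \<iota>])
    show "n > 0 \<longrightarrow> (\<forall>x \<in> carrier (X 0). \<tau> 0 x = \<zero>\<^bsub>X 1\<^esub> \<longrightarrow> \<delta> 0 (\<iota> (f x)) = \<zero>\<^bsub>G (Suc 0)\<^esub>)"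
      using ker(1) lhom_zero[OF \<iota>] lhom_zero[OF hom[of 0]] by simp
    show "n = 0 \<longrightarrow> (\<forall>y \<in> carrier (Y 0). \<sigma> 0 y = \<zero>\<^bsub>Y 1\<^esub> \<longrightarrow> \<delta> 0 (\<iota> (f (\<mu> 0 y))) = \<zero>\<^bsub>G (Suc 0)\<^esub>)"
      using ker(2) lhom_zero[OF \<iota>] lhom_zero[OF hom[of 0]] by simp
  qed (use triv in simp)
  then obtain h where h: "lhom R (Y 1) (G 0) h"
    "\<And>y. y \<in> carrier (Y 0) \<Longrightarrow> \<delta> 0 (\<iota> (f (\<mu> 0 y))) = \<delta> 0 (h (\<sigma> 0 y))" by blast
  obtain h' where h': "lhom R (Y 1) M h'" "\<And>x. x \<in> carrier (Y 1) \<Longrightarrow> h x = \<iota> (h' x)"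
    by (rule hom_into_G0[OF h(1)]) (rule that)
  note sig = exact_morphismD(2)[OF em] and mu = exact_morphismD(3)[OF em]
  have "f (\<mu> 0 y) = h' (\<sigma> 0 y)" if y: "y \<in> carrier (Y 0)" for y
  proof (rule inj_\<iota>)
    have s: "\<sigma> 0 y \<in> carrier (Y 1)" using lhomD(3)[OF sig y] by simp
    have fy: "f (\<mu> 0 y) \<in> carrier M" by (rule lhomD(3)[OF f lhomD(3)[OF mu y]])
    show "\<iota> (f (\<mu> 0 y)) = \<iota> (h' (\<sigma> 0 y))"
      unfolding h'(2)[OF s, symmetric]
      by (rule inj_\<delta>_0[OF lhomD(3)[OF \<iota> fy] lhomD(3)[OF h(1) s] h(2)[OF y]])
    show "h' (\<sigma> 0 y) \<in> carrier M" by (rule lhomD(3)[OF h'(1) s])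
    show "f (\<mu> 0 y) \<in> carrier M" by (rule fy)
  qed
  then show ?thesis using h'(1) by blast
qed

text \<open>The case of the identity morphism: a map that kills the kernel of
  \<open>\<sigma> 0\<close> factors through \<open>\<sigma> 0\<close> if the complex is exact for as
  many steps as the coresolution is long.\<close>

lemma extension_exact':
  fixes C :: "nat \<Rightarrow> ('r, 'x) module"
  assumes \<sigma>: "\<And>j. lhom R (C j) (C (Suc j)) (\<sigma> j)"
    and \<sigma>2: "\<And>j y. y \<in> carrier (C j) \<Longrightarrow> \<sigma> (Suc j) (\<sigma> j y) = \<zero>\<^bsub>C (Suc (Suc j))\<^esub>"
    and lift: "\<And>j. lifting (C (Suc j))"
    and ex: "\<And>j x. j < n \<Longrightarrow> x \<in> carrier (C (Suc j)) \<Longrightarrow> \<sigma> (Suc j) x = \<zero>\<^bsub>C (Suc (Suc j))\<^esub> \<Longrightarrow>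
      x \<in> \<sigma> j ` carrier (C j)"
    and triv: "carrier (G (Suc (Suc n))) = {\<zero>\<^bsub>G (Suc (Suc n))\<^esub>}"
    and f: "lhom R (C 0) M f"
    and ker: "\<And>x. x \<in> carrier (C 0) \<Longrightarrow> \<sigma> 0 x = \<zero>\<^bsub>C 1\<^esub> \<Longrightarrow> f x = \<zero>\<^bsub>M\<^esub>"
  shows "\<exists>h. lhom R (C 1) M h \<and> (\<forall>x \<in> carrier (C 0). f x = h (\<sigma> 0 x))"
proof (rule extension_along'[where X = C and Y = C and \<tau> = \<sigma> and \<sigma> = \<sigma> and n = n and f = f
      and \<mu> = "\<lambda>_ x. x", OF _ triv f])
  have "lhom R (C j) (C j) (\<lambda>x. x)" for j by (rule lhom_id[OF lhomD(1)[OF \<sigma>]])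
  then show "exact_morphism n C \<sigma> C \<sigma> (\<lambda>_ x. x)"
    unfolding exact_morphism_def using \<sigma> \<sigma>2 lift ex by auto
qed (use ker in auto)

lemma lifting_free: "lifting (free R n)"
  by (rule lifting_power[OF lifting_regular[OF ring_R]])

text \<open>The cohomology of the dual in degree \<open>i + 1\<close> is Ext of degree
  \<open>i + 1 - s\<close> of the cokernel of \<open>c s\<close>, and this degree exceeds the length
  \<open>m\<close> of the coresolution.\<close>

lemma dual_exact:
  assumes fe: "free_exact R s l c"
    and triv: "carrier (G (Suc (Suc m))) = {\<zero>\<^bsub>G (Suc (Suc m))\<^esub>}"
    and i: "m + s \<le> i"
    and u: "u \<in> carrier (power_module M (l (Suc i)))"
    and u0: "dual R M (l (Suc i)) (l (Suc (Suc i))) (c (Suc i)) u = \<zero>\<^bsub>power_module M (l (Suc (Suc i)))\<^esub>"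
  shows "u \<in> dual R M (l i) (l (Suc i)) (c i) ` carrier (power_module M (l i))"
proof -
  note M = left_module_M and c = free_exactD(1)[OF fe] and c2 = free_exactD(2)[OF fe]
    and ex = free_exactD(3)[OF fe]
  \<comment> \<open>The complex is read downwards from degree \<open>Suc i\<close>. Truncated
    subtraction makes it stationary at \<open>l 0\<close>, where zero maps continue it.\<close>
  define C where "C j = free R (l (Suc i - j))" for j
  define \<sigma> where "\<sigma> j = (if j \<le> i then c (i - j) else (\<lambda>x. \<zero>\<^bsub>free R (l 0)\<^esub>))" for j
  have F: "left_module R (free R n)" for n by (rule left_module_free[OF ring_R])
  have \<sigma>: "lhom R (C j) (C (Suc j)) (\<sigma> j)" for j
  proof (cases "j \<le> i")
    case True
    then have "Suc i - j = Suc (i - j)" by simp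
    then show ?thesis using c[of "i - j"] True by (simp add: C_def \<sigma>_def del: power_module_simps)
  next
    case False
    then have "Suc i - Suc j = 0" "Suc i - j = 0" by simp_all
    then show ?thesis using False lhom_const_zero[OF F F] by (simp add: C_def \<sigma>_def del: power_module_simps)
  qed
  have "\<exists>h. lhom R (C 1) M h \<and> (\<forall>x \<in> carrier (C 0). lin M (l (Suc i)) u x = h (\<sigma> 0 x))"
  proof (rule extension_exact'[of C \<sigma> m, OF \<sigma> _ _ _ triv])
    show "lifting (C (Suc j))" for j unfolding C_def by (rule lifting_free)
    show "lhom R (C 0) M (lin M (l (Suc i)) u)" unfolding C_def using lin_hom[OF M u] by simp
    show "\<sigma> (Suc j) (\<sigma> j y) = \<zero>\<^bsub>C (Suc (Suc j))\<^esub>" if y: "y \<in> carrier (C j)" for j y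
    proof (cases "Suc j \<le> i")
      case True
      then have e: "Suc i - j = Suc (Suc (i - Suc j))" "i - j = Suc (i - Suc j)" "Suc i - Suc (Suc j) = i - Suc j"
        by simp_all
      have "y \<in> carrier (free R (l (Suc (Suc (i - Suc j)))))" using y unfolding C_def e(1) .
      from c2[OF this] show ?thesis using True e(2,3) by (simp add: C_def \<sigma>_def del: power_module_simps)
    next
      case False
      then have "Suc i - Suc (Suc j) = 0" by simp
      then show ?thesis using False by (simp add: C_def \<sigma>_def del: power_module_simps)
    qed
    show "x \<in> \<sigma> j ` carrier (C j)"
      if j: "j < m" and x: "x \<in> carrier (C (Suc j))" "\<sigma> (Suc j) x = \<zero>\<^bsub>C (Suc (Suc j))\<^esub>" for j x
    proof -
      define k where "k = i - Suc j"
      have e: "Suc i - Suc j = Suc k" "Suc i - j = Suc (Suc k)" "i - j = Suc k" "Suc i - Suc (Suc j) = k"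
        "j \<le> i" "Suc j \<le> i" "s \<le> k"
        using j i by (simp_all add: k_def)
      have x1: "x \<in> carrier (free R (l (Suc k)))" using x(1) unfolding C_def e(1) .
      have x2: "c k x = \<zero>\<^bsub>free R (l k)\<^esub>"
        using x(2) e(6) unfolding C_def \<sigma>_def e(4) k_def by (simp del: power_module_simps)
      show ?thesis using ex[OF e(7) x1 x2] e(5) unfolding C_def \<sigma>_def e(2,3) by (simp del: power_module_simps)
    qed
    fix x assume x: "x \<in> carrier (C 0)" "\<sigma> 0 x = \<zero>\<^bsub>C 1\<^esub>"
    have x1: "x \<in> carrier (free R (l (Suc i)))" "c i x = \<zero>\<^bsub>free R (l i)\<^esub>"
      using x by (simp_all add: C_def \<sigma>_def del: power_module_simps)
    have "x \<in> c (Suc i) ` carrier (free R (l (Suc (Suc i))))"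
      by (rule ex[OF _ x1]) (use i in simp)
    then obtain y where y: "y \<in> carrier (free R (l (Suc (Suc i))))" "x = c (Suc i) y" by blast
    show "lin M (l (Suc i)) u x = \<zero>\<^bsub>M\<^esub>"
      unfolding y(2) lin_dual[OF c M u y(1), symmetric] u0 by (rule lin_zero[OF M y(1)])
  qed
  then obtain h where h: "lhom R (free R (l i)) M h"
    "\<And>x. x \<in> carrier (free R (l (Suc i))) \<Longrightarrow> lin M (l (Suc i)) u x = h (c i x)"
    by (auto simp: C_def \<sigma>_def simp del: power_module_simps)
  obtain v where v: "v \<in> carrier (power_module M (l i))"
      "\<And>a. a \<in> carrier (free R (l i)) \<Longrightarrow> h a = lin M (l i) v a"
    by (rule lin_of_hom[OF h(1)]) (rule that)
  have "u = dual R M (l i) (l (Suc i)) (c i) v"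
  proof (rule lin_eq_imp_eq[OF M u dual_closed[OF c M v(1)]])
    fix a assume a: "a \<in> carrier (free R (l (Suc i)))"
    show "lin M (l (Suc i)) u a = lin M (l (Suc i)) (dual R M (l i) (l (Suc i)) (c i) v) a"
      unfolding lin_dual[OF c M v(1) a] h(2)[OF a] by (rule v(2)[OF lhomD(3)[OF c a]])
  qed
  then show ?thesis using v(1) by (rule image_eqI)
qed

end

text \<open>A right \<open>S\<close>-module is treated as a left module \<open>W\<close> over \<open>B\<close>, the opposite of \<open>S\<close>, on the same
  underlying group as \<open>U\<close>; this makes all conditions symmetric in the two sides.\<close>

locale balanced_bimodule =
  fixes A :: "('r, 'a) ring_scheme" and B :: "('s, 'b) ring_scheme"
    and U :: "('r, 'm, 'c) module_scheme" and W :: "('s, 'm, 'd) module_scheme"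
  assumes U: "left_module A U" and W: "left_module B W"
    and carrier_W: "carrier W = carrier U" and add_W: "add W = add U" and zero_W: "zero W = zero U"
    and commute: "\<lbrakk>a \<in> carrier A; b \<in> carrier B; u \<in> carrier U\<rbrakk> \<Longrightarrow>
      a \<odot>\<^bsub>U\<^esub> (b \<odot>\<^bsub>W\<^esub> u) = b \<odot>\<^bsub>W\<^esub> (a \<odot>\<^bsub>U\<^esub> u)"
    and end_U: "lhom A U U f \<Longrightarrow> \<exists>b \<in> carrier B. \<forall>u \<in> carrier U. f u = b \<odot>\<^bsub>W\<^esub> u"
    and end_W: "lhom B W W g \<Longrightarrow> \<exists>a \<in> carrier A. \<forall>u \<in> carrier U. g u = a \<odot>\<^bsub>U\<^esub> u"
    and faithful_A: "a \<in> carrier A \<Longrightarrow> (\<And>u. u \<in> carrier U \<Longrightarrow> a \<odot>\<^bsub>U\<^esub> u = \<zero>\<^bsub>U\<^esub>) \<Longrightarrow> a = \<zero>\<^bsub>A\<^esub>"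
    and faithful_B: "b \<in> carrier B \<Longrightarrow> (\<And>u. u \<in> carrier U \<Longrightarrow> b \<odot>\<^bsub>W\<^esub> u = \<zero>\<^bsub>U\<^esub>) \<Longrightarrow> b = \<zero>\<^bsub>B\<^esub>"
    and noeth_A: "noeth A (regular_module A)" and noeth_B: "noeth B (regular_module B)"
    and noeth_U: "noeth A U" and noeth_W: "noeth B W"
begin

lemma swap: "balanced_bimodule B A W U"
  by (rule balanced_bimodule.intro)
    (use U W carrier_W add_W zero_W commute end_U end_W faithful_A faithful_B noeth_A noeth_B noeth_U noeth_W
      in auto)

lemma carrier_power: "carrier (power_module W n) = carrier (power_module U n)"
  by (simp add: carrier_W)

lemma zero_power: "zero (power_module W n) = zero (power_module U n)"
  by (simp add: zero_W)

lemma lhom_scalar: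
  assumes "b \<in> carrier B" shows "lhom A U U (\<lambda>u. b \<odot>\<^bsub>W\<^esub> u)"
proof -
  interpret W: left_module B W by (rule W)
  show ?thesis
    using assms W.smult_closed[OF assms] W.smult_r_distr[OF assms] commute
    by (intro lhomI U) (auto simp: carrier_W add_W)
qed

lemma lhom_eval:
  assumes a: "a \<in> carrier (free A n)"
  shows "lhom B (power_module W n) W (\<lambda>x. lin U n x a)"
proof -
  interpret U: left_module A U by (rule U)
  interpret W: left_module B W by (rule W)
  have c: "a i \<odot>\<^bsub>U\<^esub> x i \<in> carrier U" "x i \<in> carrier U" "a i \<in> carrier A"
    if "x \<in> carrier (power_module U n)" "i < n" for x i
  proof -
    show 1: "x i \<in> carrier U" "a i \<in> carrier A" using a that by auto
    show "a i \<odot>\<^bsub>U\<^esub> x i \<in> carrier U" by (rule U.smult_closed[OF 1(2,1)])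
  qed
  show ?thesis
  proof (rule lhomI[OF left_module_power[OF W] W], unfold carrier_power)
    fix x y assume x: "x \<in> carrier (power_module U n)"
    show "lin U n x a \<in> carrier W"
      unfolding carrier_W by (rule lhomD(3)[OF lin_hom[OF U x] a])
    show "lin U n (x \<oplus>\<^bsub>power_module W n\<^esub> y) a = lin U n x a \<oplus>\<^bsub>W\<^esub> lin U n y a"
      if y: "y \<in> carrier (power_module U n)"
    proof -
      have "lin U n (x \<oplus>\<^bsub>power_module W n\<^esub> y) a = (\<Oplus>\<^bsub>U\<^esub>i\<in>{..<n}. a i \<odot>\<^bsub>U\<^esub> x i \<oplus>\<^bsub>U\<^esub> a i \<odot>\<^bsub>U\<^esub> y i)"
        unfolding lin_def using c[OF x] c[OF y]
        by (intro U.finsum_cong') (simp_all add: add_W U.smult_r_distr)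
      also have "\<dots> = lin U n x a \<oplus>\<^bsub>U\<^esub> lin U n y a"
        unfolding lin_def using c[OF x] c[OF y] by (intro U.finsum_addf) simp_all
      finally show ?thesis by (simp add: add_W)
    qed
    show "lin U n (b \<odot>\<^bsub>power_module W n\<^esub> x) a = b \<odot>\<^bsub>W\<^esub> lin U n x a" if b: "b \<in> carrier B" for b
    proof -
      have "b \<odot>\<^bsub>W\<^esub> lin U n x a = (\<Oplus>\<^bsub>U\<^esub>i\<in>{..<n}. b \<odot>\<^bsub>W\<^esub> (a i \<odot>\<^bsub>U\<^esub> x i))"
        unfolding lin_def by (rule lhom_finsum[OF lhom_scalar[OF b]]) (use c[OF x] in simp_all)
      also have "\<dots> = lin U n (b \<odot>\<^bsub>power_module W n\<^esub> x) a"
        unfolding lin_def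
        by (rule U.finsum_cong'[symmetric])
          (use c[OF x] b lhomD(3)[OF lhom_scalar[OF b]] in \<open>simp_all add: commute\<close>)
      finally show ?thesis ..
    qed
  qed
qed

lemma lin_inc:
  assumes "i < n" "u \<in> carrier U" "a \<in> carrier (free A n)"
  shows "lin U n (inc U n i u) a = a i \<odot>\<^bsub>U\<^esub> u"
proof -
  interpret U: left_module A U by (rule U)
  have c: "a j \<in> carrier A" if "j < n" for j using assms(3) that by auto
  have "lin U n (inc U n i u) a = (\<Oplus>\<^bsub>U\<^esub>j\<in>{..<n}. if i = j then a j \<odot>\<^bsub>U\<^esub> u else \<zero>\<^bsub>U\<^esub>)"
    unfolding lin_def
    by (rule U.finsum_cong') (use assms(1,2) c in \<open>auto simp: inc_def U.smult_closed U.smult_r_null\<close>)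
  also have "\<dots> = a i \<odot>\<^bsub>U\<^esub> u"
    by (rule U.finsum_singleton) (use assms(1,2) c in \<open>auto simp: U.smult_closed\<close>)
  finally show ?thesis .
qed

lemma inc_W: "inc W n i u = inc U n i u"
  unfolding inc_def zero_W ..

text \<open>Biduality for free modules: coordinatewise it says that the endomorphisms of
  \<open>W\<close> are the multiplications by \<open>A\<close>. Together with
  \<open>eval_faithful\<close> it recovers elements of a free module from functionals on its
  dual.\<close>

lemma eval_of_hom:
  assumes f: "lhom B (power_module W n) W f"
  obtains a where "a \<in> carrier (free A n)"
    "\<And>x. x \<in> carrier (power_module U n) \<Longrightarrow> f x = lin U n x a"
proof -
  have "\<exists>a \<in> carrier A. \<forall>u \<in> carrier U. f (inc W n i u) = a \<odot>\<^bsub>U\<^esub> u" for i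
    by (rule end_W[OF lhom_comp[OF lhom_inc[OF W] f]])
  then obtain a0 where a0: "\<And>i. a0 i \<in> carrier A"
      "\<And>i u. u \<in> carrier U \<Longrightarrow> f (inc W n i u) = a0 i \<odot>\<^bsub>U\<^esub> u" by metis
  define a where "a = restrict a0 {..<n}"
  have a: "a \<in> carrier (free A n)" using a0(1) by (simp add: a_def)
  have "f x = lin U n x a" if x: "x \<in> carrier (power_module U n)" for x
  proof (rule lhom_power_ext[OF f lhom_eval[OF a] W])
    show "f (inc W n i u) = lin U n (inc W n i u) a" if "i < n" "u \<in> carrier W" for i u
      using that a0(2) lin_inc[OF _ _ a] by (simp add: carrier_W inc_W a_def)
    show "x \<in> carrier (power_module W n)" using x unfolding carrier_power .
  qed
  then show thesis by (rule that[OF a])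
qed

lemma eval_faithful:
  assumes a: "a \<in> carrier (free A n)" and a': "a' \<in> carrier (free A n)"
    and eq: "\<And>x. x \<in> carrier (power_module U n) \<Longrightarrow> lin U n x a = lin U n x a'"
  shows "a = a'"
proof (rule power_eqI[OF a a'])
  interpret U: left_module A U by (rule U)
  fix i assume i: "i < n"
  have ai: "a i \<in> carrier A" "a' i \<in> carrier A" using a a' i by auto
  have "a i \<ominus>\<^bsub>A\<^esub> a' i = \<zero>\<^bsub>A\<^esub>"
  proof (rule faithful_A)
    fix u assume u: "u \<in> carrier U"
    have "a i \<odot>\<^bsub>U\<^esub> u = a' i \<odot>\<^bsub>U\<^esub> u"
      using eq[OF lhomD(3)[OF lhom_inc[OF U] u], of i] lin_inc[OF i u a] lin_inc[OF i u a'] by simp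
    then show "(a i \<ominus>\<^bsub>A\<^esub> a' i) \<odot>\<^bsub>U\<^esub> u = \<zero>\<^bsub>U\<^esub>"
      using ai u by (simp add: a_minus_def U.smult_l_distr U.smult_l_minus U.M.r_neg U.smult_closed)
  qed (use ai in simp)
  then show "a i = a' i"
    using ai by (metis U.R.add.inv_closed U.R.add.inv_inv U.R.minus_equality U.R.r_neg a_minus_def)
qed

lemma lhom_dual:
  assumes \<phi>: "lhom A (free A m) (free A n) \<phi>"
  shows "lhom B (power_module W n) (power_module W m) (dual A U n m \<phi>)"
proof -
  interpret U: left_module A U by (rule U)
  have b: "\<phi> (basis A m i) \<in> carrier (free A n)" for i
    by (rule lhomD(3)[OF \<phi> basis_closed[OF U.R.ring_axioms]])
  note e = lhomD(3-5)[OF lhom_eval[OF b]]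
  show ?thesis
  proof (rule lhomI[OF left_module_power[OF W] left_module_power[OF W]])
    show "dual A U n m \<phi> x \<in> carrier (power_module W m)" if "x \<in> carrier (power_module W n)" for x
      using dual_closed[OF \<phi> U] that unfolding carrier_power by blast
  qed (use e in \<open>simp_all add: dual_def del: power_module_simps(1) cong: restrict_cong\<close>)
qed

end

lemma dual_dual_zero:
  assumes \<phi>: "lhom R (free R m) (free R n) \<phi>" and \<psi>: "lhom R (free R l) (free R m) \<psi>"
    and zero: "\<And>a. a \<in> carrier (free R l) \<Longrightarrow> \<phi> (\<psi> a) = \<zero>\<^bsub>free R n\<^esub>"
    and M: "left_module R M" and x: "x \<in> carrier (power_module M n)"
  shows "dual R M m l \<psi> (dual R M n m \<phi> x) = \<zero>\<^bsub>power_module M l\<^esub>"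
proof (rule lin_eq_imp_eq[OF M])
  note d = dual_closed[OF \<phi> M x]
  show "dual R M m l \<psi> (dual R M n m \<phi> x) \<in> carrier (power_module M l)"
    by (rule dual_closed[OF \<psi> M d])
  show "\<zero>\<^bsub>power_module M l\<^esub> \<in> carrier (power_module M l)"
    by (rule submoduleD(2)[OF submodule_carrier[OF left_module_power[OF M]]])
  fix a assume a: "a \<in> carrier (free R l)"
  show "lin M l (dual R M m l \<psi> (dual R M n m \<phi> x)) a = lin M l \<zero>\<^bsub>power_module M l\<^esub> a"
    unfolding lin_dual[OF \<psi> M d a] lin_dual[OF \<phi> M x lhomD(3)[OF \<psi> a]] zero[OF a]
      lin_zero[OF M a]
    by (rule lhom_zero[OF lin_hom[OF M x]])
qed

lemma dual_commute:
  assumes "lhom R (free R m) (free R n) \<phi>" "lhom R (free R l) (free R m) \<psi>"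
    and "lhom R (free R m') (free R n) \<phi>'" "lhom R (free R l) (free R m') \<psi>'"
    and eq: "\<And>a. a \<in> carrier (free R l) \<Longrightarrow> \<phi> (\<psi> a) = \<phi>' (\<psi>' a)"
    and M: "left_module R M" and x: "x \<in> carrier (power_module M n)"
  shows "dual R M m l \<psi> (dual R M n m \<phi> x) = dual R M m' l \<psi>' (dual R M n m' \<phi>' x)"
proof (rule lin_eq_imp_eq[OF M])
  note d = dual_closed[OF assms(1) M x] and d' = dual_closed[OF assms(3) M x]
  show "dual R M m l \<psi> (dual R M n m \<phi> x) \<in> carrier (power_module M l)"
    by (rule dual_closed[OF assms(2) M d])
  show "dual R M m' l \<psi>' (dual R M n m' \<phi>' x) \<in> carrier (power_module M l)"
    by (rule dual_closed[OF assms(4) M d'])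
  fix a assume a: "a \<in> carrier (free R l)"
  show "lin M l (dual R M m l \<psi> (dual R M n m \<phi> x)) a = lin M l (dual R M m' l \<psi>' (dual R M n m' \<phi>' x)) a"
    unfolding lin_dual[OF assms(2) M d a] lin_dual[OF assms(4) M d' a]
      lin_dual[OF assms(1) M x lhomD(3)[OF assms(2) a]] lin_dual[OF assms(3) M x lhomD(3)[OF assms(4) a]] eq[OF a] ..
qed

section \<open>Vanishing of the top cohomology\<close>

text \<open>\<open>m\<close> and \<open>q\<close> bound the injective dimensions of \<open>U\<close>
  over \<open>A\<close> and of \<open>W\<close> over \<open>B\<close>; the shift by two occurs
  because index 0 is taken by the module itself. The strict inequality is the assumption that a
  minimal \<open>q\<close> will refute.\<close>

locale resolved_bimodule = balanced_bimodule A B U W + S: resolved A G \<delta> U \<iota> + T: resolved B H \<epsilon> W \<kappa>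
  for A :: "('r, 'a) ring_scheme" and B :: "('s, 'b) ring_scheme"
    and U :: "('r, 'm, 'c) module_scheme" and W :: "('s, 'm, 'd) module_scheme"
    and G :: "nat \<Rightarrow> ('r, 'e) module" and \<delta> \<iota>
    and H :: "nat \<Rightarrow> ('s, 'f) module" and \<epsilon> \<kappa> +
  fixes m q :: nat
  assumes trivial_G: "carrier (G (Suc (Suc m))) = {\<zero>\<^bsub>G (Suc (Suc m))\<^esub>}"
    and trivial_H: "carrier (H (Suc (Suc q))) = {\<zero>\<^bsub>H (Suc (Suc q))\<^esub>}"
    and m_less_q: "m < q"

text \<open>Exactness starts in degree 2, so homology may sit in degree 1: in the application the
  free complex is a resolution of a cyclic module, shifted by one.\<close>

locale dual_complex = resolved_bimodule A B U W G \<delta> \<iota> H \<epsilon> \<kappa> m q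
  for A :: "('r, 'a) ring_scheme" and B :: "('s, 'b) ring_scheme"
    and U :: "('r, 'm, 'c) module_scheme" and W :: "('s, 'm, 'd) module_scheme"
    and G \<delta> \<iota> H \<epsilon> \<kappa> m q +
  fixes k :: "nat \<Rightarrow> nat" and p
  assumes free_exact_p: "free_exact B 1 k p"
begin

lemmas p = free_exactD(1)[OF free_exact_p]
  and p_p = free_exactD(2)[OF free_exact_p]
  and p_exact = free_exactD(3)[OF free_exact_p]

definition X :: "nat \<Rightarrow> ('r, nat \<Rightarrow> 'm) module" where "X n = power_module U (k n)"

definition D :: "nat \<Rightarrow> (nat \<Rightarrow> 'm) \<Rightarrow> nat \<Rightarrow> 'm" where
  "D n = dual B W (k n) (k (Suc n)) (p n)"

lemma D: "lhom A (X n) (X (Suc n)) (D n)"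
  unfolding X_def D_def by (rule balanced_bimodule.lhom_dual[OF swap p])

lemma carrier_X: "carrier (X n) = carrier (power_module W (k n))"
  by (simp add: X_def carrier_W)

lemma zero_X: "zero (X n) = zero (power_module W (k n))"
  by (simp add: X_def zero_W)

lemma left_module_X: "left_module A (X n)" by (rule lhomD(1)[OF D])

lemma D_D: "x \<in> carrier (X n) \<Longrightarrow> D (Suc n) (D n x) = \<zero>\<^bsub>X (Suc (Suc n))\<^esub>"
  unfolding carrier_X zero_X D_def by (rule dual_dual_zero[OF p p p_p W])

text \<open>Because of the shift by one, cohomology in degree \<open>Suc n\<close> is an Ext group
  of degree \<open>n\<close>, which exceeds the injective dimension of \<open>W\<close>.\<close>

lemma X_exact:
  assumes "q < n" "x \<in> carrier (X (Suc n))" "D (Suc n) x = \<zero>\<^bsub>X (Suc (Suc n))\<^esub>"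
  shows "x \<in> D n ` carrier (X n)"
  unfolding carrier_X D_def
  by (rule T.dual_exact[OF free_exact_p trivial_H])
    (use assms in \<open>simp_all add: carrier_X zero_X D_def del: power_module_simps\<close>)

text \<open>The mapping cone of a morphism from a complex of free modules \<open>A\<^bsup>\<tau> n\<^esup>\<close> to the complex \<open>X\<close>;
  the component \<open>\<gamma> n\<close> of the differential collects both the differential of the free complex
  and the morphism.\<close>

definition cone :: "(nat \<Rightarrow> nat) \<Rightarrow> nat \<Rightarrow> ('r, (nat \<Rightarrow> 'r) \<times> (nat \<Rightarrow> 'm)) module" where
  "cone \<tau> n = dsum (free A (\<tau> n)) (X n)"

definition cone_d ::
    "(nat \<Rightarrow> nat) \<Rightarrow> (nat \<Rightarrow> (nat \<Rightarrow> 'r) \<Rightarrow> (nat \<Rightarrow> 'r) \<times> (nat \<Rightarrow> 'm)) \<Rightarrow> nat \<Rightarrow>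
      (nat \<Rightarrow> 'r) \<times> (nat \<Rightarrow> 'm) \<Rightarrow> (nat \<Rightarrow> 'r) \<times> (nat \<Rightarrow> 'm)" where
  "cone_d \<tau> \<gamma> n y = \<gamma> n (fst y) \<oplus>\<^bsub>cone \<tau> (Suc n)\<^esub> (\<zero>\<^bsub>free A (\<tau> (Suc n))\<^esub>, D n (snd y))"

lemma left_module_cone: "left_module A (cone \<tau> n)"
  unfolding cone_def by (intro left_module_dsum S.left_module_G left_module_X left_module_free S.ring_R)

lemma carrier_cone: "carrier (cone \<tau> n) = carrier (free A (\<tau> n)) \<times> carrier (X n)"
  by (simp add: cone_def del: power_module_simps)

lemma lhom_inr: "lhom A (X n) (cone \<tau> n) (\<lambda>x. (\<zero>\<^bsub>free A (\<tau> n)\<^esub>, x))"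
proof -
  interpret F: left_module A "free A (\<tau> n)" by (rule left_module_free[OF S.ring_R])
  show ?thesis
    by (rule lhomI[OF left_module_X left_module_cone])
      (simp_all add: cone_def F.smult_r_null del: power_module_simps)
qed

lemma lhom_fst: "lhom A (cone \<tau> n) (free A (\<tau> n)) fst"
  by (rule lhomI[OF left_module_cone left_module_free[OF S.ring_R]])
    (simp_all add: cone_def mem_Times_iff del: power_module_simps)

lemma lhom_snd: "lhom A (cone \<tau> n) (X n) snd"
  by (rule lhomI[OF left_module_cone left_module_X])
    (simp_all add: cone_def mem_Times_iff del: power_module_simps)

lemma lhom_cone_d:
  assumes "lhom A (free A (\<tau> n)) (cone \<tau> (Suc n)) (\<gamma> n)"
  shows "lhom A (cone \<tau> n) (cone \<tau> (Suc n)) (cone_d \<tau> \<gamma> n)"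
  unfolding cone_d_def
  by (rule lhom_plus[OF lhom_comp[OF lhom_fst[of \<tau> n] assms]
        lhom_comp[OF lhom_comp[OF lhom_snd[of \<tau> n] D[of n]] lhom_inr[of "Suc n" \<tau>]]])

lemma zero_cone: "(\<zero>\<^bsub>free A (\<tau> n)\<^esub>, \<zero>\<^bsub>X n\<^esub>) = \<zero>\<^bsub>cone \<tau> n\<^esub>"
  by (simp add: cone_def del: power_module_simps)

lemma cone_d_inl:
  assumes "lhom A (free A (\<tau> n)) (cone \<tau> (Suc n)) (\<gamma> n)" "a \<in> carrier (free A (\<tau> n))"
  shows "cone_d \<tau> \<gamma> n (a, \<zero>\<^bsub>X n\<^esub>) = \<gamma> n a"
proof -
  interpret C: left_module A "cone \<tau> (Suc n)" by (rule left_module_cone)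
  note zero_cone[of \<tau> "Suc n"]
  then show ?thesis
    unfolding cone_d_def using lhomD(3)[OF assms] lhom_zero[OF D] by simp
qed

lemma cone_d_inr:
  assumes "lhom A (free A (\<tau> n)) (cone \<tau> (Suc n)) (\<gamma> n)" "x \<in> carrier (X n)"
  shows "cone_d \<tau> \<gamma> n (\<zero>\<^bsub>free A (\<tau> n)\<^esub>, x) = (\<zero>\<^bsub>free A (\<tau> (Suc n))\<^esub>, D n x)"
proof -
  interpret C: left_module A "cone \<tau> (Suc n)" by (rule left_module_cone)
  have "(\<zero>\<^bsub>free A (\<tau> (Suc n))\<^esub>, D n x) \<in> carrier (cone \<tau> (Suc n))"
    by (rule lhomD(3)[OF lhom_inr lhomD(3)[OF D assms(2)]])
  then show ?thesis
    unfolding cone_d_def using lhom_zero[OF assms(1)] by simp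
qed

text \<open>The construction descends. In degrees above \<open>Suc q\<close> the complex
  \<open>X\<close> is exact and zero modules suffice. To make the cone exact in degree
  \<open>n0 + 1\<close>, a new free module is mapped onto all cycles there, which are finitely
  generated because \<open>U\<close> and \<open>A\<close> are noetherian.\<close>

lemma cone_exists:
  assumes "n0 \<le> Suc q"
  shows "\<exists>\<tau> \<gamma>. (\<forall>n>q. \<tau> n = 0) \<and> (\<forall>n\<ge>n0. lhom A (free A (\<tau> n)) (cone \<tau> (Suc n)) (\<gamma> n) \<and>
      (\<forall>a \<in> carrier (free A (\<tau> n)). cone_d \<tau> \<gamma> (Suc n) (\<gamma> n a) = \<zero>\<^bsub>cone \<tau> (Suc (Suc n))\<^esub>) \<and>
      (\<forall>y \<in> carrier (cone \<tau> (Suc n)). cone_d \<tau> \<gamma> (Suc n) y = \<zero>\<^bsub>cone \<tau> (Suc (Suc n))\<^esub> \<longrightarrow>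
        y \<in> cone_d \<tau> \<gamma> n ` carrier (cone \<tau> n)))"
  using assms
proof (induction n0 rule: inc_induct)
  case base
  define \<tau> :: "nat \<Rightarrow> nat" where "\<tau> n = 0" for n
  define \<gamma> where "\<gamma> n = (\<lambda>a :: nat \<Rightarrow> 'r. \<zero>\<^bsub>cone \<tau> (Suc n)\<^esub>)" for n
  have g: "lhom A (free A (\<tau> n)) (cone \<tau> (Suc n)) (\<gamma> n)" for n
    unfolding \<gamma>_def by (rule lhom_const_zero[OF left_module_free[OF S.ring_R] left_module_cone])
  have F0: "carrier (free A (\<tau> n)) = {\<zero>\<^bsub>free A (\<tau> n)\<^esub>}" for n
    by (simp add: \<tau>_def restrict_def)
  show ?case
  proof (intro exI[of _ \<tau>] exI[of _ \<gamma>] conjI allI impI ballI g)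
    fix n a assume "a \<in> carrier (free A (\<tau> n))"
    show "cone_d \<tau> \<gamma> (Suc n) (\<gamma> n a) = \<zero>\<^bsub>cone \<tau> (Suc (Suc n))\<^esub>"
      using lhom_zero[OF lhom_cone_d[of \<tau> "Suc n" \<gamma>, OF g]] unfolding \<gamma>_def by simp
  next
    fix n y assume n: "Suc q \<le> n" and y: "y \<in> carrier (cone \<tau> (Suc n))"
      and d: "cone_d \<tau> \<gamma> (Suc n) y = \<zero>\<^bsub>cone \<tau> (Suc (Suc n))\<^esub>"
    obtain x where x: "x \<in> carrier (X (Suc n))" "y = (\<zero>\<^bsub>free A (\<tau> (Suc n))\<^esub>, x)"
      using y unfolding carrier_cone F0 by auto
    have "D (Suc n) x = \<zero>\<^bsub>X (Suc (Suc n))\<^esub>"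
      using d cone_d_inr[of \<tau> "Suc n" \<gamma>, OF g x(1)] unfolding x(2) by (simp add: cone_def del: power_module_simps)
    then obtain x' where x': "x' \<in> carrier (X n)" "x = D n x'"
      using X_exact[OF _ x(1)] n by auto
    have "y = cone_d \<tau> \<gamma> n (\<zero>\<^bsub>free A (\<tau> n)\<^esub>, x')"
      using cone_d_inr[of \<tau> n \<gamma>, OF g x'(1)] x x' by simp
    then show "y \<in> cone_d \<tau> \<gamma> n ` carrier (cone \<tau> n)"
      by (rule image_eqI) (rule lhomD(3)[OF lhom_inr x'(1)])
  qed (simp add: \<tau>_def)
next
  case (step n0)
  from step.IH obtain \<tau> \<gamma> where ih: "\<forall>n>q. \<tau> n = 0"
      "\<forall>n\<ge>Suc n0. lhom A (free A (\<tau> n)) (cone \<tau> (Suc n)) (\<gamma> n) \<and>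
      (\<forall>a \<in> carrier (free A (\<tau> n)). cone_d \<tau> \<gamma> (Suc n) (\<gamma> n a) = \<zero>\<^bsub>cone \<tau> (Suc (Suc n))\<^esub>) \<and>
      (\<forall>y \<in> carrier (cone \<tau> (Suc n)). cone_d \<tau> \<gamma> (Suc n) y = \<zero>\<^bsub>cone \<tau> (Suc (Suc n))\<^esub> \<longrightarrow>
        y \<in> cone_d \<tau> \<gamma> n ` carrier (cone \<tau> n))"
    by (elim exE conjE)
  have IH: "\<forall>n>q. \<tau> n = 0"
      "n \<ge> Suc n0 \<Longrightarrow> lhom A (free A (\<tau> n)) (cone \<tau> (Suc n)) (\<gamma> n)"
      "n \<ge> Suc n0 \<Longrightarrow> a \<in> carrier (free A (\<tau> n)) \<Longrightarrow> cone_d \<tau> \<gamma> (Suc n) (\<gamma> n a) = \<zero>\<^bsub>cone \<tau> (Suc (Suc n))\<^esub>"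
      "n \<ge> Suc n0 \<Longrightarrow> y \<in> carrier (cone \<tau> (Suc n)) \<Longrightarrow> cone_d \<tau> \<gamma> (Suc n) y = \<zero>\<^bsub>cone \<tau> (Suc (Suc n))\<^esub> \<Longrightarrow>
        y \<in> cone_d \<tau> \<gamma> n ` carrier (cone \<tau> n)" for n a y
    using ih by blast+
  have d: "lhom A (cone \<tau> (Suc n0)) (cone \<tau> (Suc (Suc n0))) (cone_d \<tau> \<gamma> (Suc n0))"
    by (rule lhom_cone_d[OF IH(2)]) simp
  have "noeth A (cone \<tau> (Suc n0))"
    unfolding cone_def X_def by (intro noeth_dsum noeth_power noeth_A noeth_U)
  then obtain t y where y: "y \<in> carrier (power_module (cone \<tau> (Suc n0)) t)"
      "lin (cone \<tau> (Suc n0)) t y ` carrier (free A t) =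
        {z \<in> carrier (cone \<tau> (Suc n0)). cone_d \<tau> \<gamma> (Suc n0) z = \<zero>\<^bsub>cone \<tau> (Suc (Suc n0))\<^esub>}"
    by (rule noeth_generators[OF _ submodule_kernel[OF d]]) (rule that)
  \<comment> \<open>Changing the data at \<open>n0\<close> leaves the terms and differentials above
    \<open>n0\<close> intact, and with them the exactness already achieved.\<close>
  define \<tau>' where "\<tau>' = \<tau>(n0 := t)"
  define \<gamma>' where "\<gamma>' = \<gamma>(n0 := lin (cone \<tau> (Suc n0)) t y)"
  have tt: "\<tau>' n = \<tau> n" if "n > n0" for n using that by (simp add: \<tau>'_def)
  have gg: "\<gamma>' n = \<gamma> n" if "n > n0" for n using that by (simp add: \<gamma>'_def)
  have co: "cone \<tau>' n = cone \<tau> n" if "n > n0" for n using that by (simp add: cone_def \<tau>'_def)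
  have cd: "cone_d \<tau>' \<gamma>' n = cone_d \<tau> \<gamma> n" if "n > n0" for n
    using that by (intro ext) (simp add: cone_d_def co tt \<gamma>'_def)
  have l: "lhom A (free A t) (cone \<tau> (Suc n0)) (lin (cone \<tau> (Suc n0)) t y)"
    by (rule lin_hom[OF left_module_cone y(1)])
  have g: "lhom A (free A (\<tau>' n)) (cone \<tau>' (Suc n)) (\<gamma>' n)" if "n \<ge> n0" for n
    using that l IH(2)[of n] co by (cases "n = n0") (simp_all add: \<tau>'_def \<gamma>'_def del: power_module_simps)
  show ?case
  proof (intro exI[of _ \<tau>'] exI[of _ \<gamma>'] conjI allI impI ballI g)
    fix n assume "q < n" then show "\<tau>' n = 0" using IH(1) step.hyps by (simp add: \<tau>'_def)
  next
    fix n a assume n: "n0 \<le> n" and a: "a \<in> carrier (free A (\<tau>' n))"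
    show "cone_d \<tau>' \<gamma>' (Suc n) (\<gamma>' n a) = \<zero>\<^bsub>cone \<tau>' (Suc (Suc n))\<^esub>"
    proof (cases "n = n0")
      case True
      then have "\<gamma>' n a \<in> lin (cone \<tau> (Suc n0)) t y ` carrier (free A t)"
        using a by (simp add: \<gamma>'_def \<tau>'_def del: power_module_simps)
      then show ?thesis unfolding y(2) using True by (simp add: cd co)
    next
      case False
      with n have "n0 < n" by simp
      then show ?thesis using IH(3)[of n a] a by (simp add: cd co gg tt del: power_module_simps)
    qed
  next
    fix n z assume n: "n0 \<le> n" and z: "z \<in> carrier (cone \<tau>' (Suc n))"
      and dz: "cone_d \<tau>' \<gamma>' (Suc n) z = \<zero>\<^bsub>cone \<tau>' (Suc (Suc n))\<^esub>"
    show "z \<in> cone_d \<tau>' \<gamma>' n ` carrier (cone \<tau>' n)"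
    proof (cases "n = n0")
      case True
      then have "z \<in> lin (cone \<tau> (Suc n0)) t y ` carrier (free A t)"
        unfolding y(2) using z dz by (simp add: cd co)
      then obtain a where a: "a \<in> carrier (free A (\<tau>' n))" "z = \<gamma>' n a"
        using True by (auto simp: \<gamma>'_def \<tau>'_def simp del: power_module_simps)
      have "z = cone_d \<tau>' \<gamma>' n (a, \<zero>\<^bsub>X n\<^esub>)" using cone_d_inl[of \<tau>' n \<gamma>', OF g[OF n] a(1)] a(2) by simp
      moreover have "(a, \<zero>\<^bsub>X n\<^esub>) \<in> carrier (cone \<tau>' n)"
        unfolding carrier_cone using a(1) submoduleD(2)[OF submodule_carrier[OF left_module_X]] by blast
      ultimately show ?thesis by (rule image_eqI)
    next
      case False
      then show ?thesis using IH(4)[of n z] n z dz by (simp add: cd co)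
    qed
  qed
qed

text \<open>The comparison theorem with degree 0 prescribed as the identity, so that evaluation at
  an element of the degree 0 term has the same meaning for both complexes.\<close>

lemma free_chain_map:
  assumes a: "\<And>j. lhom A (free A (t (Suc j))) (free A (t j)) (a j)"
    and a2: "\<And>j x. x \<in> carrier (free A (t (Suc (Suc j)))) \<Longrightarrow> a j (a (Suc j) x) = \<zero>\<^bsub>free A (t j)\<^esub>"
    and fe: "free_exact A 0 l c"
    and l0: "l 0 = t 0" and im: "\<And>x. x \<in> carrier (free A (t 1)) \<Longrightarrow> a 0 x \<in> c 0 ` carrier (free A (l 1))"
  shows "\<exists>\<nu>. (\<forall>j. lhom A (free A (t j)) (free A (l j)) (\<nu> j)) \<and> \<nu> 0 = (\<lambda>x. x) \<and>
    (\<forall>j. \<forall>x \<in> carrier (free A (t (Suc j))). c j (\<nu> (Suc j) x) = \<nu> j (a j x))"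
proof -
  note c = free_exactD(1)[OF fe] and ker = free_exactD(3)[OF fe, OF le0]
  \<comment> \<open>The invariant in degree \<open>j\<close> contains the image condition under
    which the next component exists; exactness of the target passes it on.\<close>
  have "\<exists>f. \<forall>j. (lhom A (free A (t j)) (free A (l j)) (f j) \<and> (j = 0 \<longrightarrow> f j = (\<lambda>x. x)) \<and>
      (\<forall>x \<in> carrier (free A (t (Suc j))). f j (a j x) \<in> c j ` carrier (free A (l (Suc j))))) \<and>
    (\<forall>x \<in> carrier (free A (t (Suc j))). c j (f (Suc j) x) = f j (a j x))"
  proof (rule dependent_nat_choice)
    show "\<exists>f. lhom A (free A (t 0)) (free A (l 0)) f \<and> ((0::nat) = 0 \<longrightarrow> f = (\<lambda>x. x)) \<and>
      (\<forall>x \<in> carrier (free A (t (Suc 0))). f (a 0 x) \<in> c 0 ` carrier (free A (l (Suc 0))))"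
      using im lhom_id[OF left_module_free[OF S.ring_R]] l0
      by (intro exI[of _ "\<lambda>x. x"]) (simp del: power_module_simps)
    fix f j assume f: "lhom A (free A (t j)) (free A (l j)) f \<and> (j = 0 \<longrightarrow> f = (\<lambda>x. x)) \<and>
      (\<forall>x \<in> carrier (free A (t (Suc j))). f (a j x) \<in> c j ` carrier (free A (l (Suc j))))"
    then have f1: "lhom A (free A (t j)) (free A (l j)) f" by simp
    obtain g where g: "lhom A (free A (t (Suc j))) (free A (l (Suc j))) g"
      "\<And>x. x \<in> carrier (free A (t (Suc j))) \<Longrightarrow> c j (g x) = f (a j x)"
      using free_lift[OF lhom_comp[OF a f1] c] f by blast
    have "g (a (Suc j) x) \<in> c (Suc j) ` carrier (free A (l (Suc (Suc j))))"
      if x: "x \<in> carrier (free A (t (Suc (Suc j))))" for x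
    proof -
      have "c j (g (a (Suc j) x)) = \<zero>\<^bsub>free A (l j)\<^esub>"
        unfolding g(2)[OF lhomD(3)[OF a x]] a2[OF x] by (rule lhom_zero[OF f1])
      then show ?thesis by (rule ker[OF lhomD(3)[OF g(1) lhomD(3)[OF a x]]])
    qed
    then show "\<exists>g. (lhom A (free A (t (Suc j))) (free A (l (Suc j))) g \<and> (Suc j = 0 \<longrightarrow> g = (\<lambda>x. x)) \<and>
      (\<forall>x \<in> carrier (free A (t (Suc (Suc j)))). g (a (Suc j) x) \<in> c (Suc j) ` carrier (free A (l (Suc (Suc j)))))) \<and>
      (\<forall>x \<in> carrier (free A (t (Suc j))). c j (g x) = f (a j x))"
      using g by blast
  qed
  then obtain f where f: "\<forall>j. (lhom A (free A (t j)) (free A (l j)) (f j) \<and> (j = 0 \<longrightarrow> f j = (\<lambda>x. x)) \<and>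
      (\<forall>x \<in> carrier (free A (t (Suc j))). f j (a j x) \<in> c j ` carrier (free A (l (Suc j))))) \<and>
    (\<forall>x \<in> carrier (free A (t (Suc j))). c j (f (Suc j) x) = f j (a j x))" ..
  show ?thesis by (rule exI[of _ f]) (use f in blast)
qed

end

section \<open>Dual of the free part of an exact cone, and the vanishing argument\<close>

locale resolving_cone = dual_complex A B U W G \<delta> \<iota> H \<epsilon> \<kappa> m q k p
  for A :: "('r, 'a) ring_scheme" and B :: "('s, 'b) ring_scheme"
    and U :: "('r, 'm, 'c) module_scheme" and W :: "('s, 'm, 'd) module_scheme"
    and G \<delta> \<iota> H \<epsilon> \<kappa> m q k p +
  fixes \<tau> :: "nat \<Rightarrow> nat" and \<gamma>
  assumes \<tau>0: "q < n \<Longrightarrow> \<tau> n = 0"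
    and g: "lhom A (free A (\<tau> n)) (cone \<tau> (Suc n)) (\<gamma> n)"
    and dg: "a \<in> carrier (free A (\<tau> n)) \<Longrightarrow> cone_d \<tau> \<gamma> (Suc n) (\<gamma> n a) = \<zero>\<^bsub>cone \<tau> (Suc (Suc n))\<^esub>"
    and ex: "y \<in> carrier (cone \<tau> (Suc n)) \<Longrightarrow> cone_d \<tau> \<gamma> (Suc n) y = \<zero>\<^bsub>cone \<tau> (Suc (Suc n))\<^esub> \<Longrightarrow>
      y \<in> cone_d \<tau> \<gamma> n ` carrier (cone \<tau> n)"
begin

lemmas d = lhom_cone_d[of \<tau> _ \<gamma>, OF g] and inr = cone_d_inr[of \<tau> _ \<gamma>, OF g]
  and F = left_module_free[OF S.ring_R]

lemma cone_d_cone_d: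
  assumes y: "y \<in> carrier (cone \<tau> n)"
  shows "cone_d \<tau> \<gamma> (Suc n) (cone_d \<tau> \<gamma> n y) = \<zero>\<^bsub>cone \<tau> (Suc (Suc n))\<^esub>"
proof -
  interpret C: left_module A "cone \<tau> (Suc (Suc n))" by (rule left_module_cone)
  have f: "fst y \<in> carrier (free A (\<tau> n))" "snd y \<in> carrier (X n)"
    by (rule lhomD(3)[OF lhom_fst y], rule lhomD(3)[OF lhom_snd y])
  have z: "(\<zero>\<^bsub>free A (\<tau> (Suc n))\<^esub>, D n (snd y)) \<in> carrier (cone \<tau> (Suc n))"
    by (rule lhomD(3)[OF lhom_inr lhomD(3)[OF D f(2)]])
  have "cone_d \<tau> \<gamma> (Suc n) (cone_d \<tau> \<gamma> n y) = cone_d \<tau> \<gamma> (Suc n) (\<gamma> n (fst y)) \<oplus>\<^bsub>cone \<tau> (Suc (Suc n))\<^esub>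
      cone_d \<tau> \<gamma> (Suc n) (\<zero>\<^bsub>free A (\<tau> (Suc n))\<^esub>, D n (snd y))"
    unfolding cone_d_def[of \<tau> \<gamma> n y] by (rule lhomD(4)[OF d lhomD(3)[OF g f(1)] z])
  also have "\<dots> = \<zero>\<^bsub>cone \<tau> (Suc (Suc n))\<^esub>"
    unfolding dg[OF f(1)] inr[OF lhomD(3)[OF D f(2)]] D_D[OF f(2)]
      zero_cone by (rule C.M.l_zero[OF C.M.zero_closed])
  finally show ?thesis .
qed

definition t :: "nat \<Rightarrow> (nat \<Rightarrow> 'r) \<Rightarrow> nat \<Rightarrow> 'r" where "t n a = fst (\<gamma> n a)"

lemma t: "lhom A (free A (\<tau> n)) (free A (\<tau> (Suc n))) (t n)"
  unfolding t_def by (rule lhom_comp[OF g lhom_fst])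

lemma fst_cone_d:
  assumes y: "y \<in> carrier (cone \<tau> n)"
  shows "fst (cone_d \<tau> \<gamma> n y) = t n (fst y)"
proof -
  interpret Fn: left_module A "free A (\<tau> (Suc n))" by (rule F)
  have "t n (fst y) \<in> carrier (free A (\<tau> (Suc n)))"
    by (rule lhomD(3)[OF t lhomD(3)[OF lhom_fst y]])
  then show ?thesis
    unfolding cone_d_def cone_def by (simp add: t_def del: power_module_simps)
qed

lemma t_t:
  assumes a: "a \<in> carrier (free A (\<tau> n))"
  shows "t (Suc n) (t n a) = \<zero>\<^bsub>free A (\<tau> (Suc (Suc n)))\<^esub>"
  using fst_cone_d[OF lhomD(3)[OF g a]] dg[OF a] by (simp add: t_def cone_def del: power_module_simps)

lemma lifting_cone: "S.lifting (cone \<tau> n)"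
  unfolding cone_def X_def by (intro S.lifting_dsum S.lifting_free S.lifting_power S.lifting_M)

text \<open>The exact cone stays exact in these degrees under Hom(-, \<open>U\<close>), its terms
  being acyclic and the injective dimension of \<open>U\<close> finite; and the dual of
  \<open>X\<close> is the original free complex over \<open>B\<close>, exact from degree 2 on. Hence
  a cocycle on the free part, extended over the cone, can be corrected until it ignores
  \<open>X\<close>.\<close>

lemma dual_t_exact:
  assumes u: "u \<in> carrier (power_module U (\<tau> (Suc n)))"
      and u0: "dual A U (\<tau> (Suc n)) (\<tau> n) (t n) u = \<zero>\<^bsub>power_module U (\<tau> n)\<^esub>"
  shows "u \<in> dual A U (\<tau> (Suc (Suc n))) (\<tau> (Suc n)) (t (Suc n)) ` carrier (power_module U (\<tau> (Suc (Suc n))))"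
proof -
  let ?n1 = "Suc n" and ?n2 = "Suc (Suc n)" and ?n3 = "Suc (Suc (Suc n))"
  define \<theta> where "\<theta> y = lin U (\<tau> ?n1) u (fst y)" for y :: "(nat \<Rightarrow> 'r) \<times> (nat \<Rightarrow> 'm)"
  note lu = lin_hom[OF U u]
  have \<theta>: "lhom A (cone \<tau> ?n1) U \<theta>" unfolding \<theta>_def by (rule lhom_comp[OF lhom_fst[of \<tau> "Suc n"] lu])
  have "\<exists>h. lhom A (cone \<tau> (Suc n + 1)) U h \<and>
      (\<forall>y \<in> carrier (cone \<tau> (Suc n + 0)). \<theta> y = h (cone_d \<tau> \<gamma> (Suc n + 0) y))"
  proof (rule S.extension_exact'[of "\<lambda>j. cone \<tau> (Suc n + j)" "\<lambda>j. cone_d \<tau> \<gamma> (Suc n + j)" m, OF _ _ lifting_cone _ trivial_G])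
    fix y assume y: "y \<in> carrier (cone \<tau> (Suc n + 0))" "cone_d \<tau> \<gamma> (Suc n + 0) y = \<zero>\<^bsub>cone \<tau> (Suc n + 1)\<^esub>"
    have "y \<in> cone_d \<tau> \<gamma> n ` carrier (cone \<tau> n)" using ex[of y n] y by simp
    then obtain w where w: "w \<in> carrier (cone \<tau> n)" "y = cone_d \<tau> \<gamma> n w" by blast
    have f: "fst w \<in> carrier (free A (\<tau> n))" by (rule lhomD(3)[OF lhom_fst w(1)])
    show "\<theta> y = \<zero>\<^bsub>U\<^esub>"
      unfolding \<theta>_def w(2) fst_cone_d[OF w(1)] lin_dual[OF t U u f, symmetric] u0 by (rule lin_zero[OF U f])
  qed (use d cone_d_cone_d ex \<theta> in simp_all)
  then obtain h where h: "lhom A (cone \<tau> ?n2) U h"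
    "\<And>y. y \<in> carrier (cone \<tau> ?n1) \<Longrightarrow> \<theta> y = h (cone_d \<tau> \<gamma> ?n1 y)" by auto
  interpret U: left_module A U by (rule U)
  have inrX: "(\<zero>\<^bsub>free A (\<tau> i)\<^esub>, x) \<in> carrier (cone \<tau> i)" if "x \<in> carrier (X i)" for i x
    by (rule lhomD(3)[OF lhom_inr that])
  have hx: "lhom A (power_module U (k ?n2)) U (\<lambda>x. h (\<zero>\<^bsub>free A (\<tau> ?n2)\<^esub>, x))"
    using lhom_comp[OF lhom_inr[of "Suc ?n1" \<tau>] h(1)] by (simp add: X_def del: power_module_simps)
  \<comment> \<open>By balancedness the restriction of \<open>h\<close> to \<open>X\<close> is
    evaluation at some \<open>b\<close>, and \<open>b\<close> is a cycle because \<open>h\<close>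
    vanishes on the image of \<open>D\<close>.\<close>
  obtain b where b: "b \<in> carrier (free B (k ?n2))"
      "\<And>x. x \<in> carrier (power_module W (k ?n2)) \<Longrightarrow>
        h (\<zero>\<^bsub>free A (\<tau> ?n2)\<^esub>, x) = lin W (k ?n2) x b"
    by (rule balanced_bimodule.eval_of_hom[OF swap hx]) (rule that)
  have "p ?n1 b = \<zero>\<^bsub>free B (k ?n1)\<^esub>"
  proof (rule balanced_bimodule.eval_faithful[OF swap])
    show "p ?n1 b \<in> carrier (free B (k ?n1))" by (rule lhomD(3)[OF p b(1)])
    show "\<zero>\<^bsub>free B (k ?n1)\<^esub> \<in> carrier (free B (k ?n1))"
      by (rule submoduleD(2)[OF submodule_carrier[OF lhomD(2)[OF p]]])
    fix x assume x: "x \<in> carrier (power_module W (k ?n1))"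
    then have x': "x \<in> carrier (X ?n1)" by (simp add: carrier_X)
    have "lin W (k ?n1) x (p ?n1 b) = lin W (k ?n2) (D ?n1 x) b"
      unfolding D_def by (rule lin_dual[OF p W x b(1), symmetric])
    also have "\<dots> = h (\<zero>\<^bsub>free A (\<tau> ?n2)\<^esub>, D ?n1 x)"
      by (rule b(2)[symmetric]) (use lhomD(3)[OF D x'] in \<open>simp add: carrier_X del: power_module_simps\<close>)
    also have "\<dots> = \<theta> (\<zero>\<^bsub>free A (\<tau> ?n1)\<^esub>, x)"
      using h(2)[OF inrX[OF x']] inr[OF x'] by simp
    also have "\<dots> = \<zero>\<^bsub>W\<^esub>" unfolding \<theta>_def zero_W fst_conv by (rule lhom_zero[OF lu])
    also have "\<dots> = lin W (k ?n1) x \<zero>\<^bsub>free B (k ?n1)\<^esub>"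
      by (rule lhom_zero[OF lin_hom[OF W x], symmetric])
    finally show "lin W (k ?n1) x (p ?n1 b) = lin W (k ?n1) x \<zero>\<^bsub>free B (k ?n1)\<^esub>" .
  qed
  then obtain b' where b': "b' \<in> carrier (free B (k ?n3))" "b = p ?n2 b'"
    using p_exact[of "Suc n" b] b(1) by auto
  have ev: "lhom A (power_module U (k ?n3)) U (\<lambda>x. lin W (k ?n3) x b')"
    by (rule balanced_bimodule.lhom_eval[OF swap b'(1)])
  \<comment> \<open>Evaluation at \<open>b'\<close> after the differential agrees with
    \<open>h\<close> on \<open>X\<close> and vanishes on boundaries; subtracting it removes the
    \<open>X\<close> part and still extends \<open>\<theta>\<close>.\<close>
  define r where "r y = lin W (k ?n3) (snd (cone_d \<tau> \<gamma> ?n2 y)) b'" for y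
  have r: "lhom A (cone \<tau> ?n2) U r"
    unfolding r_def
    by (rule lhom_comp[OF lhom_comp[OF d lhom_snd[of \<tau> "Suc ?n2"]] ev[folded X_def]])
  define h' where "h' y = h y \<ominus>\<^bsub>U\<^esub> r y" for y
  have h': "lhom A (cone \<tau> ?n2) U h'" unfolding h'_def by (rule lhom_diff[OF h(1) r])
  have h'0: "h' (\<zero>\<^bsub>free A (\<tau> ?n2)\<^esub>, x) = \<zero>\<^bsub>U\<^esub>" if x: "x \<in> carrier (X ?n2)" for x
  proof -
    have xW: "x \<in> carrier (power_module W (k ?n2))" using x by (simp add: carrier_X)
    have "r (\<zero>\<^bsub>free A (\<tau> ?n2)\<^esub>, x) = lin W (k ?n3) (D ?n2 x) b'"
      unfolding r_def inr[OF x] snd_conv ..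
    also have "\<dots> = h (\<zero>\<^bsub>free A (\<tau> ?n2)\<^esub>, x)"
      unfolding D_def lin_dual[OF p W xW b'(1)] b'(2)[symmetric] by (rule b(2)[OF xW, symmetric])
    finally show ?thesis
      unfolding h'_def using left_module_diff_eq_zero[OF U] lhomD(3)[OF h(1) inrX[OF x]] by simp
  qed
  have h'd: "h' (cone_d \<tau> \<gamma> ?n1 y) = \<theta> y" if y: "y \<in> carrier (cone \<tau> ?n1)" for y
  proof -
    have "r (cone_d \<tau> \<gamma> ?n1 y) = lin W (k ?n3) \<zero>\<^bsub>power_module U (k ?n3)\<^esub> b'"
      unfolding r_def cone_d_cone_d[OF y] by (simp add: cone_def X_def del: power_module_simps)
    also have "\<dots> = \<zero>\<^bsub>U\<^esub>" by (rule lhom_zero[OF ev])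
    finally show ?thesis
      unfolding h'_def h(2)[OF y, symmetric] using lhomD(3)[OF \<theta> y] by (simp add: a_minus_def)
  qed
  interpret XX: left_module A "X ?n2" by (rule left_module_X)
  have inl_hom: "lhom A (free A (\<tau> ?n2)) (cone \<tau> ?n2) (\<lambda>a. (a, \<zero>\<^bsub>X ?n2\<^esub>))"
    by (rule lhomI[OF F left_module_cone]) (simp_all add: cone_def XX.smult_r_null del: power_module_simps)
  obtain u' where u': "u' \<in> carrier (power_module U (\<tau> ?n2))"
    "\<And>a. a \<in> carrier (free A (\<tau> ?n2)) \<Longrightarrow> h' (a, \<zero>\<^bsub>X ?n2\<^esub>) = lin U (\<tau> ?n2) u' a"
    by (rule lin_of_hom[OF lhom_comp[OF inl_hom h']]) (rule that)
  have h'eq: "h' y = lin U (\<tau> ?n2) u' (fst y)" if y: "y \<in> carrier (cone \<tau> ?n2)" for y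
  proof -
    interpret FF: left_module A "free A (\<tau> ?n2)" by (rule F)
    have f: "fst y \<in> carrier (free A (\<tau> ?n2))" "snd y \<in> carrier (X ?n2)"
      by (rule lhomD(3)[OF lhom_fst y], rule lhomD(3)[OF lhom_snd y])
    have "y = (fst y, \<zero>\<^bsub>X ?n2\<^esub>) \<oplus>\<^bsub>cone \<tau> ?n2\<^esub> (\<zero>\<^bsub>free A (\<tau> ?n2)\<^esub>, snd y)"
      using f by (cases y) (simp add: cone_def del: power_module_simps)
    then have "h' y = h' (fst y, \<zero>\<^bsub>X ?n2\<^esub>) \<oplus>\<^bsub>U\<^esub> h' (\<zero>\<^bsub>free A (\<tau> ?n2)\<^esub>, snd y)"
      using lhomD(4)[OF h' lhomD(3)[OF inl_hom f(1)] inrX[OF f(2)]] by simp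
    then show ?thesis
      unfolding u'(2)[OF f(1)] h'0[OF f(2)] using lhomD(3)[OF lin_hom[OF U u'(1)] f(1)] by simp
  qed
  have "u = dual A U (\<tau> ?n2) (\<tau> ?n1) (t ?n1) u'"
  proof (rule lin_eq_imp_eq[OF U u dual_closed[OF t U u'(1)]])
    fix a assume a: "a \<in> carrier (free A (\<tau> ?n1))"
    have ca: "(a, \<zero>\<^bsub>X ?n1\<^esub>) \<in> carrier (cone \<tau> ?n1)"
      unfolding carrier_cone using a submoduleD(2)[OF submodule_carrier[OF left_module_X]] by blast
    have "lin U (\<tau> ?n1) u a = \<theta> (a, \<zero>\<^bsub>X ?n1\<^esub>)" by (simp add: \<theta>_def)
    also have "\<dots> = lin U (\<tau> ?n2) u' (t ?n1 a)"
      unfolding h'd[OF ca, symmetric] h'eq[OF lhomD(3)[OF d ca]] fst_cone_d[OF ca] fst_conv ..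
    also have "\<dots> = lin U (\<tau> ?n1) (dual A U (\<tau> ?n2) (\<tau> ?n1) (t ?n1) u') a"
      by (rule lin_dual[OF t U u'(1) a, symmetric])
    finally show "lin U (\<tau> ?n1) u a = \<dots>" .
  qed
  then show ?thesis using u'(1) by (rule image_eqI)
qed

theorem top_cohomology_vanishes:
  assumes z: "z \<in> carrier (X (Suc q))" and Dz: "D (Suc q) z = \<zero>\<^bsub>X (Suc (Suc q))\<^esub>"
  shows "z \<in> D q ` carrier (X q)"
proof -
  \<comment> \<open>\<open>K\<close> is the kernel of the map that \<open>\<gamma> q\<close> induces
    from the free module of rank \<open>\<tau> q\<close> to the top cohomology of \<open>X\<close>.
    This map is onto, so the cohomology vanishes once \<open>K\<close> is everything.\<close>
  define K where "K = {a \<in> carrier (free A (\<tau> q)). snd (\<gamma> q a) \<in> D q ` carrier (X q)}"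
  have DX: "submodule (D q ` carrier (X q)) A (X (Suc q))"
    by (rule submodule_image[OF D submodule_carrier[OF left_module_X]])
  have K: "submodule K A (free A (\<tau> q))"
    unfolding K_def by (rule submodule_vimage[OF lhom_comp[OF g lhom_snd[of \<tau> "Suc q"]] DX])
  obtain l c where l0: "l 0 = \<tau> q" and c0: "c 0 ` carrier (free A (l 1)) = K"
    and fe: "free_exact A 0 l c"
    by (rule free_resolution[OF noeth_A K]) (rule that)
  note c = free_exactD(1)[OF fe] and c2 = free_exactD(2)[OF fe]
  \<comment> \<open>Re-index the free complex homologically, starting from degree \<open>q\<close>.\<close>
  define s where "s j = (if j \<le> q then \<tau> (q - j) else 0)" for j
  define a where "a j = (if j < q then t (q - Suc j) else (\<lambda>x. \<zero>\<^bsub>free A (s j)\<^esub>))" for j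
  have a_less: "a j = t (q - Suc j)" "s j = \<tau> (Suc (q - Suc j))" "s (Suc j) = \<tau> (q - Suc j)" if "j < q" for j
    using that by (simp_all add: a_def s_def Suc_diff_Suc)
  have a: "lhom A (free A (s (Suc j))) (free A (s j)) (a j)" for j
  proof (cases "j < q")
    case True
    show ?thesis unfolding a_less[OF True] by (rule t)
  next
    case False
    then show ?thesis unfolding a_def using lhom_const_zero[OF F F] by (simp del: power_module_simps)
  qed
  have a2: "a j (a (Suc j) x) = \<zero>\<^bsub>free A (s j)\<^esub>" if x: "x \<in> carrier (free A (s (Suc (Suc j))))" for j x
  proof (cases "Suc j < q")
    case True
    then have j: "j < q" and e: "q - Suc j = Suc (q - Suc (Suc j))" by simp_all
    have x': "x \<in> carrier (free A (\<tau> (q - Suc (Suc j))))" using x unfolding a_less(3)[OF True] .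
    show ?thesis unfolding a_less(1)[OF True] a_less(1,2)[OF j] e by (rule t_t[OF x'])
  next
    case False
    then show ?thesis using lhom_zero[OF a[of j]] by (simp add: a_def del: power_module_simps)
  qed
  have a0: "a 0 x \<in> c 0 ` carrier (free A (l 1))" if x: "x \<in> carrier (free A (s 1))" for x
  proof -
    define n where "n = q - 1"
    have n: "q = Suc n" using m_less_q by (simp add: n_def)
    have x': "x \<in> carrier (free A (\<tau> n))" using x m_less_q by (simp add: s_def n_def)
    have eq: "a 0 x = t n x" using m_less_q by (simp add: a_def n_def)
    define w where "w = \<gamma> n x"
    have w: "fst w \<in> carrier (free A (\<tau> q))" "snd w \<in> carrier (X q)"
      unfolding w_def n by (rule lhomD(3)[OF lhom_fst lhomD(3)[OF g x']], rule lhomD(3)[OF lhom_snd lhomD(3)[OF g x']])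
    interpret XX: left_module A "X (Suc q)" by (rule left_module_X)
    have gw: "snd (\<gamma> q (fst w)) \<in> carrier (X (Suc q))"
      by (rule lhomD(3)[OF lhom_snd lhomD(3)[OF g w(1)]])
    have Dw: "D q (snd w) \<in> carrier (X (Suc q))" by (rule lhomD(3)[OF D w(2)])
    \<comment> \<open>The \<open>X\<close> component of this equation says that
      \<open>\<gamma> q\<close> sends boundaries of the free complex to coboundaries of
      \<open>X\<close>.\<close>
    have "cone_d \<tau> \<gamma> q w = \<zero>\<^bsub>cone \<tau> (Suc q)\<^esub>" using dg[OF x'] unfolding w_def n .
    then have "snd (cone_d \<tau> \<gamma> q w) = \<zero>\<^bsub>X (Suc q)\<^esub>" by (simp add: cone_def del: power_module_simps)
    then have "snd (\<gamma> q (fst w)) \<oplus>\<^bsub>X (Suc q)\<^esub> D q (snd w) = \<zero>\<^bsub>X (Suc q)\<^esub>"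
      by (simp add: cone_d_def cone_def del: power_module_simps)
    then have "snd (\<gamma> q (fst w)) = \<ominus>\<^bsub>X (Suc q)\<^esub> D q (snd w)"
      using XX.M.minus_equality[OF _ Dw gw] by simp
    moreover have "\<ominus>\<^bsub>X (Suc q)\<^esub> D q (snd w) \<in> D q ` carrier (X q)"
      by (rule submoduleD(5)[OF DX imageI[OF w(2)]])
    ultimately have "fst w \<in> K" using w(1) unfolding K_def by simp
    then show ?thesis unfolding c0 eq t_def w_def .
  qed
  have ls: "l 0 = s 0" by (simp add: l0 s_def)
  have "\<exists>\<nu>. (\<forall>j. lhom A (free A (s j)) (free A (l j)) (\<nu> j)) \<and> \<nu> 0 = (\<lambda>x. x) \<and>
    (\<forall>j. \<forall>x \<in> carrier (free A (s (Suc j))). c j (\<nu> (Suc j) x) = \<nu> j (a j x))"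
    by (rule free_chain_map[OF a a2 fe ls a0])
  then obtain \<nu> where \<nu>': "(\<forall>j. lhom A (free A (s j)) (free A (l j)) (\<nu> j)) \<and> \<nu> 0 = (\<lambda>x. x) \<and>
    (\<forall>j. \<forall>x \<in> carrier (free A (s (Suc j))). c j (\<nu> (Suc j) x) = \<nu> j (a j x))" ..
  have \<nu>: "lhom A (free A (s j)) (free A (l j)) (\<nu> j)" and \<nu>0: "\<nu> 0 = (\<lambda>x. x)" for j
    using \<nu>' by (simp_all del: power_module_simps)
  have \<nu>c: "c j (\<nu> (Suc j) x) = \<nu> j (a j x)" if "x \<in> carrier (free A (s (Suc j)))" for j x
    using \<nu>' that by (simp del: power_module_simps)
  have em: "T.exact_morphism q (\<lambda>j. power_module W (s j)) (\<lambda>j. dual A U (s j) (s (Suc j)) (a j))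
      (\<lambda>j. power_module W (l j)) (\<lambda>j. dual A U (l j) (l (Suc j)) (c j)) (\<lambda>j. dual A U (l j) (s j) (\<nu> j))"
    unfolding T.exact_morphism_def carrier_power zero_power
  proof (intro conjI allI ballI impI)
    show "dual A U (l (Suc j)) (s (Suc j)) (\<nu> (Suc j)) (dual A U (l j) (l (Suc j)) (c j) y) =
        dual A U (s j) (s (Suc j)) (a j) (dual A U (l j) (s j) (\<nu> j) y)"
      if "y \<in> carrier (power_module U (l j))" for j y
      by (rule dual_commute[OF c \<nu> \<nu> a \<nu>c U that])
    show "dual A U (s (Suc j)) (s (Suc (Suc j))) (a (Suc j)) (dual A U (s j) (s (Suc j)) (a j) x) =
        \<zero>\<^bsub>power_module U (s (Suc (Suc j)))\<^esub>" if "x \<in> carrier (power_module U (s j))" for j x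
      by (rule dual_dual_zero[OF a a a2 U that])
    show "dual A U (l (Suc j)) (l (Suc (Suc j))) (c (Suc j)) (dual A U (l j) (l (Suc j)) (c j) x) =
        \<zero>\<^bsub>power_module U (l (Suc (Suc j)))\<^esub>" if "x \<in> carrier (power_module U (l j))" for j x
      by (rule dual_dual_zero[OF c c c2 U that])
    show "T.lifting (power_module W (l (Suc j)))" for j by (rule T.lifting_power[OF T.lifting_M])
    fix j x assume j: "Suc j < q" and x: "x \<in> carrier (power_module U (s (Suc j)))"
      and x0: "dual A U (s (Suc j)) (s (Suc (Suc j))) (a (Suc j)) x = \<zero>\<^bsub>power_module U (s (Suc (Suc j)))\<^esub>"
    define n where "n = q - Suc (Suc j)"
    have e: "a (Suc j) = t n" "s (Suc j) = \<tau> (Suc n)" "s (Suc (Suc j)) = \<tau> n"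
      using a_less[OF j] by (simp_all add: n_def)
    have "q - Suc j = Suc n" "j < q" using j by (simp_all add: n_def)
    then have e': "a j = t (Suc n)" "s j = \<tau> (Suc (Suc n))" using a_less[of j] by simp_all
    show "x \<in> dual A U (s j) (s (Suc j)) (a j) ` carrier (power_module U (s j))"
      unfolding e e' by (rule dual_t_exact) (use x x0 in \<open>simp_all only: e\<close>)
  next
    fix i y assume i: "q = Suc i" and y: "y \<in> carrier (power_module U (l q))"
      and y0: "dual A U (l q) (l (Suc q)) (c q) y = \<zero>\<^bsub>power_module U (l (Suc q))\<^esub>"
    \<comment> \<open>Exactness in degree \<open>q\<close> of the dual of the resolution: the one
      point where \<open>q\<close> has to exceed \<open>m\<close> and not just 0.\<close>
    show "y \<in> dual A U (l i) (l (Suc i)) (c i) ` carrier (power_module U (l i))"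
      by (rule S.dual_exact[OF fe trivial_G]) (use i y y0 m_less_q in simp_all)
  qed (rule lhom_dual[OF a] lhom_dual[OF c] lhom_dual[OF \<nu>])+
  have K_all: "b \<in> K" if b: "b \<in> carrier (free A (s 0))" for b
  proof -
    \<comment> \<open>As \<open>\<nu> 0\<close> is the identity, this extends evaluation at
      \<open>b\<close> from the dual of the degree 0 term to that of the degree 1 term.\<close>
    have "\<exists>h. lhom B (power_module W (l 1)) W h \<and> (\<forall>y \<in> carrier (power_module W (l 0)).
        lin U (s 0) (dual A U (l 0) (s 0) (\<nu> 0) y) b = h (dual A U (l 0) (l (Suc 0)) (c 0) y))"
    proof (rule T.extension_along'[OF em])
      show "lin U (s 0) (dual A U (l 0) (s 0) (\<nu> 0) y) b = \<zero>\<^bsub>W\<^esub>" if "q = 0" for y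
        using that m_less_q by simp
      show "carrier (H (Suc (Suc q))) = {\<zero>\<^bsub>H (Suc (Suc q))\<^esub>}" by (rule trivial_H)
      show "lhom B (power_module W (s 0)) W (\<lambda>x. lin U (s 0) x b)" by (rule lhom_eval[OF b])
      fix x assume x: "x \<in> carrier (power_module W (s 0))"
        and x0: "dual A U (s 0) (s (Suc 0)) (a 0) x = \<zero>\<^bsub>power_module W (s 1)\<^esub>"
      define n where "n = q - 1"
      have n: "q = Suc n" using m_less_q by (simp add: n_def)
      have e: "a 0 = t n" "s 0 = \<tau> (Suc n)" "s (Suc 0) = \<tau> n" "\<tau> (Suc (Suc n)) = 0"
        using a_less[of 0] m_less_q \<tau>0 by (simp_all add: n)
      \<comment> \<open>There is no free module beyond \<open>\<tau> q\<close>, so exactness here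
        means that the first dual differential is injective.\<close>
      have "x \<in> dual A U (\<tau> (Suc (Suc n))) (\<tau> (Suc n)) (t (Suc n)) ` carrier (power_module U (\<tau> (Suc (Suc n))))"
        by (rule dual_t_exact) (use x x0 in \<open>simp_all only: e carrier_power zero_power One_nat_def\<close>)
      moreover have "carrier (power_module U 0) = {\<zero>\<^bsub>power_module U 0\<^esub>}" by (simp add: restrict_def)
      ultimately have "x = dual A U (\<tau> (Suc (Suc n))) (\<tau> (Suc n)) (t (Suc n)) \<zero>\<^bsub>power_module W (\<tau> (Suc (Suc n)))\<^esub>"
        unfolding zero_power by (simp add: e(4) del: power_module_simps)
      then have "x = \<zero>\<^bsub>power_module W (s 0)\<^esub>" unfolding e(2) lhom_zero[OF lhom_dual[OF t]] .
      then show "lin U (s 0) x b = \<zero>\<^bsub>W\<^esub>" using lin_zero[OF U b] by (simp only: zero_power zero_W)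
    qed
    then obtain h where h: "lhom B (power_module W (l 1)) W h"
      "\<forall>y \<in> carrier (power_module W (l 0)).
        lin U (s 0) (dual A U (l 0) (s 0) (\<nu> 0) y) b = h (dual A U (l 0) (l (Suc 0)) (c 0) y)"
      by (elim exE conjE)
    \<comment> \<open>Balancedness turns the extension into evaluation at some \<open>b'\<close>,
      whose boundary cannot be told apart from \<open>b\<close> by evaluations.\<close>
    obtain b' where b': "b' \<in> carrier (free A (l 1))"
        "\<And>x. x \<in> carrier (power_module U (l 1)) \<Longrightarrow> h x = lin U (l 1) x b'"
      by (rule eval_of_hom[OF h(1)]) (rule that)
    have b'1: "b' \<in> carrier (free A (l (Suc 0)))" using b'(1) by simp
    have bl: "b \<in> carrier (free A (l 0))" using b unfolding ls .
    have "b = c 0 b'"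
    proof (rule eval_faithful[OF bl lhomD(3)[OF c b'1]])
      fix y assume y: "y \<in> carrier (power_module U (l 0))"
      have "lin U (l 0) y b = lin U (s 0) (dual A U (l 0) (s 0) (\<nu> 0) y) b"
        using lin_dual[OF \<nu> U y b] unfolding \<nu>0 by (rule sym)
      also have "\<dots> = h (dual A U (l 0) (l (Suc 0)) (c 0) y)"
        using h(2) y unfolding carrier_power by blast
      also have "\<dots> = lin U (l 1) (dual A U (l 0) (l (Suc 0)) (c 0) y) b'"
        by (rule b'(2)) (use dual_closed[OF c U y] in simp)
      also have "\<dots> = lin U (l 0) y (c 0 b')"
        using lin_dual[OF c U y b'1] by simp
      finally show "lin U (l 0) y b = lin U (l 0) y (c 0 b')" .
    qed
    then show ?thesis unfolding c0[symmetric] using b'(1) by (rule image_eqI)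
  qed
  have s0: "s 0 = \<tau> q" by (simp add: s_def)
  have w: "(\<zero>\<^bsub>free A (\<tau> (Suc q))\<^esub>, z) \<in> carrier (cone \<tau> (Suc q))" by (rule lhomD(3)[OF lhom_inr z])
  \<comment> \<open>By exactness of the cone, every top cocycle comes, modulo coboundaries, from the
    free module of rank \<open>\<tau> q\<close>, all of which lies in \<open>K\<close>.\<close>
  have "(\<zero>\<^bsub>free A (\<tau> (Suc q))\<^esub>, z) \<in> cone_d \<tau> \<gamma> q ` carrier (cone \<tau> q)"
    by (rule ex[OF w]) (simp only: inr[OF z] Dz zero_cone)
  then obtain v where v: "v \<in> carrier (cone \<tau> q)" "(\<zero>\<^bsub>free A (\<tau> (Suc q))\<^esub>, z) = cone_d \<tau> \<gamma> q v" by blast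
  have "z = snd (cone_d \<tau> \<gamma> q v)" using v(2) by (metis snd_conv)
  also have "\<dots> = snd (\<gamma> q (fst v)) \<oplus>\<^bsub>X (Suc q)\<^esub> D q (snd v)"
    by (simp add: cone_d_def cone_def del: power_module_simps)
  finally have zeq: "z = snd (\<gamma> q (fst v)) \<oplus>\<^bsub>X (Suc q)\<^esub> D q (snd v)" .
  have "fst v \<in> K" by (rule K_all) (use lhomD(3)[OF lhom_fst v(1)] in \<open>simp only: s0\<close>)
  then have "snd (\<gamma> q (fst v)) \<in> D q ` carrier (X q)" unfolding K_def by blast
  moreover have "D q (snd v) \<in> D q ` carrier (X q)" by (rule imageI[OF lhomD(3)[OF lhom_snd v(1)]])
  ultimately show ?thesis unfolding zeq by (rule submoduleD(3)[OF DX])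
qed

end

context dual_complex
begin

theorem top_cocycle_is_coboundary:
  assumes z: "z \<in> carrier (X (Suc q))" and Dz: "D (Suc q) z = \<zero>\<^bsub>X (Suc (Suc q))\<^esub>"
  shows "z \<in> D q ` carrier (X q)"
proof -
  obtain \<tau> \<gamma> where \<tau>0: "\<forall>n>q. \<tau> n = 0"
    and all0: "\<forall>n\<ge>0. lhom A (free A (\<tau> n)) (cone \<tau> (Suc n)) (\<gamma> n) \<and>
      (\<forall>a \<in> carrier (free A (\<tau> n)). cone_d \<tau> \<gamma> (Suc n) (\<gamma> n a) = \<zero>\<^bsub>cone \<tau> (Suc (Suc n))\<^esub>) \<and>
      (\<forall>y \<in> carrier (cone \<tau> (Suc n)). cone_d \<tau> \<gamma> (Suc n) y = \<zero>\<^bsub>cone \<tau> (Suc (Suc n))\<^esub> \<longrightarrow>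
        y \<in> cone_d \<tau> \<gamma> n ` carrier (cone \<tau> n))"
    using cone_exists[OF le0] by (elim exE conjE)
  note all = all0[THEN spec, THEN mp, OF le0]
  have "resolving_cone A B U W G \<delta> \<iota> H \<epsilon> \<kappa> m q k p \<tau> \<gamma>"
    by (intro resolving_cone.intro resolving_cone_axioms.intro dual_complex_axioms)
      (fact \<tau>0[rule_format], fact all[THEN conjunct1],
        fact all[THEN conjunct2, THEN conjunct1, THEN bspec],
        fact all[THEN conjunct2, THEN conjunct2, THEN bspec, THEN mp])
  then show ?thesis using z Dz by (rule resolving_cone.top_cohomology_vanishes)
qed

end

section \<open>Shortening the coresolution\<close>

text \<open>This kernel is the cosyzygy of \<open>W\<close> with index \<open>q - 1\<close>.
  Dimension shifting identifies the obstruction to extending a map from a left ideal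
  \<open>J\<close> into it with a class in Ext of degree \<open>q\<close> of \<open>B\<close> modulo
  \<open>J\<close>, which is zero by \<open>top_cocycle_is_coboundary\<close>.\<close>

lemma (in resolved_bimodule) baer_top_kernel:
  "baer B ((H q)\<lparr>carrier := {x \<in> carrier (H q). \<epsilon> q x = \<zero>\<^bsub>H (Suc q)\<^esub>}\<rparr>)"
  unfolding baer_def
proof (intro conjI allI impI)
  let ?C = "{x \<in> carrier (H q). \<epsilon> q x = \<zero>\<^bsub>H (Suc q)\<^esub>}"
  have C: "submodule ?C B (H q)" by (rule submodule_kernel[OF T.hom])
  show "left_module B ((H q)\<lparr>carrier := ?C\<rparr>)" by (rule left_module_submodule[OF T.left_module_G C])
  fix J f assume J: "submodule J B (regular_module B)"
    and f: "lhom B ((regular_module B)\<lparr>carrier := J\<rparr>) ((H q)\<lparr>carrier := ?C\<rparr>) f"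
  interpret B: ring B by (rule T.ring_R)
  note RB = left_module_regular[OF T.ring_R]
  have fH: "lhom B ((regular_module B)\<lparr>carrier := J\<rparr>) (H q) f"
    by (rule lhom_extend_range[OF f T.left_module_G]) blast
  define q' where "q' = q - 1"
  have q: "q = Suc q'" using m_less_q by (simp add: q'_def)
  have FB: "left_module B (free B n)" for n by (rule left_module_free[OF T.ring_R])
  have p0: "lhom B (free B 1) (regular_module B) (\<lambda>x. x 0)" by (rule lhom_proj[OF RB]) simp
  \<comment> \<open>\<open>J\<close> is copied into the free module of rank 1, since
    \<open>free_resolution\<close> takes submodules of such modules.\<close>
  define K where "K = {x \<in> carrier (free B 1). x 0 \<in> J}"
  have K: "submodule K B (free B 1)" unfolding K_def by (rule submodule_vimage[OF p0 J])
  obtain l c where l0: "l 0 = 1" and c0: "c 0 ` carrier (free B (l 1)) = K"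
    and fe: "free_exact B 0 l c"
    by (rule free_resolution[OF noeth_B K]) (rule that)
  note c = free_exactD(1)[OF fe] and c2 = free_exactD(2)[OF fe] and cker = free_exactD(3)[OF fe]
  \<comment> \<open>Shifting by one leaves room below the complex for the last free module of the cone.\<close>
  define k where "k n = (case n of 0 \<Rightarrow> 0 | Suc i \<Rightarrow> l i)" for n
  define p where "p n = (case n of 0 \<Rightarrow> (\<lambda>x. \<zero>\<^bsub>free B 0\<^esub>) | Suc i \<Rightarrow> c i)" for n
  have "free_exact B 1 k p"
    unfolding free_exact_def
  proof (intro conjI allI ballI impI)
    show "lhom B (free B (k (Suc n))) (free B (k n)) (p n)" for n
      using c lhom_const_zero[OF FB FB] by (cases n) (simp_all add: k_def p_def del: power_module_simps)
    show "p n (p (Suc n) x) = \<zero>\<^bsub>free B (k n)\<^esub>" if "x \<in> carrier (free B (k (Suc (Suc n))))" for n x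
      using c2 that by (cases n) (simp_all add: k_def p_def del: power_module_simps)
    show "x \<in> p (Suc n) ` carrier (free B (k (Suc (Suc n))))"
      if n: "1 \<le> n" and x: "x \<in> carrier (free B (k (Suc n)))" "p n x = \<zero>\<^bsub>free B (k n)\<^esub>" for n x
    proof -
      obtain i where i: "n = Suc i" using n by (cases n) auto
      show ?thesis using cker[of i x] x by (simp add: i k_def p_def del: power_module_simps)
    qed
  qed
  then interpret DC: dual_complex A B U W G \<delta> \<iota> H \<epsilon> \<kappa> m q k p
    by (intro dual_complex.intro dual_complex_axioms.intro resolved_bimodule_axioms)
  have cJ: "c 0 x 0 \<in> J" if "x \<in> carrier (free B (l (Suc 0)))" for x
    using that c0 unfolding K_def by auto
  \<comment> \<open>\<open>f\<close> composed with a presentation of \<open>J\<close>: the cocycle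
    whose class is the obstruction.\<close>
  define g where "g x = f (c 0 x 0)" for x
  have g: "lhom B (free B (l (Suc 0))) (H (Suc q')) g"
  proof -
    have c0': "lhom B (free B (l (Suc 0))) (free B 1) (c 0)" using c[of 0] unfolding l0 .
    show ?thesis unfolding g_def q[symmetric]
      by (rule lhom_comp[OF lhom_restrict_range[OF lhom_comp[OF c0' p0] J cJ] fH])
  qed
  have gz: "\<epsilon> (Suc q') (g x) = \<zero>\<^bsub>H (Suc (Suc q'))\<^esub>" if "x \<in> carrier (free B (l (Suc 0)))" for x
    using lhomD(3)[OF f, of "c 0 x 0"] cJ[OF that] unfolding g_def q by simp
  obtain y where y: "lhom B (free B (l (Suc 0))) (H q') y"
      "\<And>x. x \<in> carrier (free B (l (Suc 0))) \<Longrightarrow> g x = \<epsilon> q' (y x)"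
    by (rule T.liftingD[OF T.lifting_free g], erule gz) (rule that)
  have "\<exists>h. lhom B (free B (l 0)) (H q') h \<and>
      (\<forall>x \<in> carrier (free B (l 1)). \<epsilon> q' (y x) = \<epsilon> q' (h (c 0 x)))"
  proof (rule T.cocycle_shift[where F = "\<lambda>j. free B (l j)" and \<phi> = c and i = q' and y = y])
    show "lhom B (free B (l (Suc j))) (free B (l j)) (c j)" for j by (rule c)
    show "x \<in> c (Suc j) ` carrier (free B (l (Suc (Suc j))))"
      if "x \<in> carrier (free B (l (Suc j)))" "c j x = \<zero>\<^bsub>free B (l j)\<^esub>" for j x
      by (rule cker[OF le0 that])
    show "c j (c (Suc j) x) = \<zero>\<^bsub>free B (l j)\<^esub>" if "x \<in> carrier (free B (l (Suc (Suc j))))" for j x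
      by (rule c2[OF that])
    show "T.lifting (free B (l (Suc (Suc j))))" for j by (rule T.lifting_free)
    show "lhom B (free B (l 1)) (H q') y" using y(1) by simp
    show "\<epsilon> q' (y (c 1 x)) = \<zero>\<^bsub>H (Suc q')\<^esub>" if "x \<in> carrier (free B (l 2))" for x
    proof -
      have x: "x \<in> carrier (free B (l (Suc (Suc 0))))" using that by (simp add: numeral_2_eq_2)
      have "c 0 (c (Suc 0) x) = \<zero>\<^bsub>free B 1\<^esub>" using c2[OF x] unfolding l0 .
      then have "g (c (Suc 0) x) = f \<zero>\<^bsub>B\<^esub>" by (simp add: g_def)
      also have "\<dots> = \<zero>\<^bsub>H (Suc q')\<^esub>" using lhom_zero[OF fH] q by simp
      finally show ?thesis using y(2)[OF lhomD(3)[OF c x]] by simp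
    qed
    \<comment> \<open>A cocycle in degree \<open>q\<close> with values in \<open>W\<close> is an
      element of \<open>DC.X (Suc q)\<close> killed by the differential, so the vanishing theorem
      makes it a coboundary.\<close>
    fix w assume w: "lhom B (free B (l (Suc q'))) (H 0) w"
      and w0: "\<And>x. x \<in> carrier (free B (l (Suc (Suc q')))) \<Longrightarrow> w (c (Suc q') x) = \<zero>\<^bsub>H 0\<^esub>"
    obtain w1 where w1: "lhom B (free B (l (Suc q'))) W w1"
        "\<And>x. x \<in> carrier (free B (l (Suc q'))) \<Longrightarrow> w x = \<kappa> (w1 x)"
      by (rule T.hom_into_G0[OF w]) (rule that)
    obtain z where z: "z \<in> carrier (power_module W (l (Suc q')))"
        "\<And>x. x \<in> carrier (free B (l (Suc q'))) \<Longrightarrow> w1 x = lin W (l (Suc q')) z x"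
      by (rule lin_of_hom[OF w1(1)]) (rule that)
    have kq: "k (Suc q) = l (Suc q')" "k (Suc (Suc q)) = l (Suc (Suc q'))" "k q = l q'"
      "p (Suc q) = c (Suc q')" "p q = c q'"
      by (simp_all add: k_def p_def q)
    have zX: "z \<in> carrier (DC.X (Suc q))" using z(1) unfolding DC.carrier_X kq .
    have "DC.D (Suc q) z = \<zero>\<^bsub>DC.X (Suc (Suc q))\<^esub>"
      unfolding DC.D_def DC.zero_X kq
    proof (rule lin_eq_imp_eq[OF W dual_closed[OF c W z(1)]])
      show "\<zero>\<^bsub>power_module W (l (Suc (Suc q')))\<^esub> \<in> carrier (power_module W (l (Suc (Suc q'))))"
        by (rule submoduleD(2)[OF submodule_carrier[OF left_module_power[OF W]]])
      fix b assume b: "b \<in> carrier (free B (l (Suc (Suc q'))))"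
      note cb = lhomD(3)[OF c b]
      have "w1 (c (Suc q') b) = \<zero>\<^bsub>W\<^esub>"
      proof (rule T.inj_\<iota>[OF lhomD(3)[OF w1(1) cb]])
        interpret WW: left_module B W by (rule W)
        show "\<zero>\<^bsub>W\<^esub> \<in> carrier W" by simp
        show "\<kappa> (w1 (c (Suc q') b)) = \<kappa> \<zero>\<^bsub>W\<^esub>"
          unfolding w1(2)[OF cb, symmetric] w0[OF b] by (rule lhom_zero[OF T.\<iota>, symmetric])
      qed
      then show "lin W (l (Suc (Suc q'))) (dual B W (l (Suc q')) (l (Suc (Suc q'))) (c (Suc q')) z) b =
          lin W (l (Suc (Suc q'))) \<zero>\<^bsub>power_module W (l (Suc (Suc q')))\<^esub> b"
        unfolding lin_dual[OF c W z(1) b] lin_zero[OF W b] z(2)[OF cb] .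
    qed
    then have "z \<in> DC.D q ` carrier (DC.X q)" by (rule DC.top_cocycle_is_coboundary[OF zX])
    then obtain z' where z': "z' \<in> carrier (power_module W (l q'))"
        "z = dual B W (l q') (l (Suc q')) (c q') z'"
      unfolding DC.D_def DC.carrier_X kq by blast
    have "w x = \<kappa> (lin W (l q') z' (c q' x))" if x: "x \<in> carrier (free B (l (Suc q')))" for x
      unfolding w1(2)[OF x] z(2)[OF x] z'(2) lin_dual[OF c W z'(1) x] ..
    moreover have "lhom B (free B (l q')) (H 0) (\<lambda>x. \<kappa> (lin W (l q') z' x))"
      by (rule lhom_comp[OF lin_hom[OF W z'(1)] T.\<iota>])
    ultimately show "\<exists>w'. lhom B (free B (l q')) (H 0) w' \<and>
        (\<forall>x \<in> carrier (free B (l (Suc q'))). w x = w' (c q' x))" by blast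
  qed
  then obtain h where h: "lhom B (free B 1) (H q') h"
      "\<And>x. x \<in> carrier (free B (l (Suc 0))) \<Longrightarrow> \<epsilon> q' (y x) = \<epsilon> q' (h (c 0 x))"
    unfolding l0 One_nat_def by blast
  \<comment> \<open>The extended map is determined by its value at the basis vector, and applying
    \<open>\<epsilon> q'\<close> puts that value into the kernel.\<close>
  define e where "e = \<epsilon> q' (h (basis B 1 0))"
  have hb: "h (basis B 1 0) \<in> carrier (H q')" by (rule lhomD(3)[OF h(1) basis_closed[OF T.ring_R]])
  have "e \<in> ?C" unfolding e_def q using T.cplx[OF hb] lhomD(3)[OF T.hom hb] by simp
  moreover have "f a = a \<odot>\<^bsub>H q\<^esub> e" if a: "a \<in> J" for a
  proof -
    have aB: "a \<in> carrier B" using a submoduleD(1)[OF J] by auto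
    define v where "v = a \<odot>\<^bsub>free B 1\<^esub> basis B 1 0"
    have v: "v \<in> carrier (free B 1)"
      unfolding v_def by (rule left_module.smult_closed[OF FB aB basis_closed[OF T.ring_R]])
    have v0: "v 0 = a" using aB by (simp add: v_def basis_def inc_def)
    then have "v \<in> K" using v a by (simp add: K_def)
    then obtain x where x: "x \<in> carrier (free B (l (Suc 0)))" "v = c 0 x"
      unfolding c0[symmetric] by auto
    have "f a = g x" unfolding g_def x(2)[symmetric] v0 ..
    also have "\<dots> = \<epsilon> q' (h v)" unfolding y(2)[OF x(1)] h(2)[OF x(1)] x(2) ..
    also have "\<dots> = a \<odot>\<^bsub>H (Suc q')\<^esub> e"
      unfolding v_def lhomD(5)[OF h(1) aB basis_closed[OF T.ring_R]] e_def
      by (rule lhomD(5)[OF T.hom aB hb])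
    finally show ?thesis unfolding q .
  qed
  ultimately show "\<exists>x \<in> carrier ((H q)\<lparr>carrier := ?C\<rparr>). \<forall>a \<in> J. f a = a \<odot>\<^bsub>(H q)\<lparr>carrier := ?C\<rparr>\<^esub> x"
    by (intro bexI[of _ e]) simp_all
qed

lemma baer_trivial:
  assumes E: "left_module R E" and triv: "carrier E = {\<zero>\<^bsub>E\<^esub>}"
  shows "baer R E"
  unfolding baer_def
proof (intro conjI allI impI E)
  interpret left_module R E by (rule E)
  fix J f assume J: "submodule J R (regular_module R)" and f: "lhom R ((regular_module R)\<lparr>carrier := J\<rparr>) E f"
  have "f a = a \<odot>\<^bsub>E\<^esub> \<zero>\<^bsub>E\<^esub>" if "a \<in> J" for a
  proof -
    have "a \<in> carrier R" using that submoduleD(1)[OF J] by auto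
    then show ?thesis using lhomD(3)[OF f, of a] that triv by (simp add: smult_r_null)
  qed
  then show "\<exists>x \<in> carrier E. \<forall>a \<in> J. f a = a \<odot>\<^bsub>E\<^esub> x" using triv by blast
qed

text \<open>By exactness the differential into degree \<open>q\<close> is onto the kernel, so an
  injective kernel can serve as the last term. \<open>0 < q\<close> keeps the coresolved module
  \<open>G 0\<close> out of the replacement.\<close>

lemma (in coresolution) truncate:
  assumes q: "0 < q" and C: "baer R ((G q)\<lparr>carrier := {x \<in> carrier (G q). \<delta> q x = \<zero>\<^bsub>G (Suc q)\<^esub>}\<rparr>)"
  shows "\<exists>G' \<delta>'. coresolution R G' \<delta>' \<and> G' 0 = G 0 \<and> (\<forall>i>q. carrier (G' i) = {\<zero>\<^bsub>G' i\<^esub>})"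
proof -
  define C where "C = {x \<in> carrier (G q). \<delta> q x = \<zero>\<^bsub>G (Suc q)\<^esub>}"
  have Cs: "submodule C R (G q)" unfolding C_def by (rule submodule_kernel[OF hom])
  define G' where "G' i = (if i < q then G i else if i = q then (G q)\<lparr>carrier := C\<rparr>
    else (G i)\<lparr>carrier := {\<zero>\<^bsub>G i\<^esub>}\<rparr>)" for i
  define \<delta>' where "\<delta>' i = (if i < q then \<delta> i else (\<lambda>x. \<zero>\<^bsub>G' (Suc i)\<^esub>))" for i
  have Z: "left_module R ((G i)\<lparr>carrier := {\<zero>\<^bsub>G i\<^esub>}\<rparr>)" for i
    by (rule left_module_submodule[OF left_module_G submodule_zero[OF left_module_G]])
  have L: "left_module R (G' i)" for i
    using Z left_module_submodule[OF left_module_G Cs] by (simp add: G'_def)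
  have \<delta>C: "\<delta> i x \<in> C" if "Suc i = q" "x \<in> carrier (G i)" for i x
    using that cplx[of x i] lhomD(3)[OF hom that(2)] by (auto simp: C_def)
  have "coresolution R G' \<delta>'"
  proof
    show "lhom R (G' i) (G' (Suc i)) (\<delta>' i)" for i
    proof (cases "i < q")
      case True
      show ?thesis
      proof (cases "Suc i = q")
        case s: True
        have "lhom R (G i) ((G (Suc i))\<lparr>carrier := C\<rparr>) (\<delta> i)"
          by (rule lhom_restrict_range[OF hom]) (use Cs s \<delta>C in auto)
        then show ?thesis using True s by (simp add: G'_def \<delta>'_def)
      next
        case False
        then show ?thesis using True hom by (simp add: G'_def \<delta>'_def)
      qed
    next
      case False
      then show ?thesis using lhom_const_zero[OF L L] by (simp add: \<delta>'_def)
    qed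
    have zero': "zero (G' i) = zero (G i)" for i by (simp add: G'_def)
    show "x = \<zero>\<^bsub>G' 0\<^esub>" if "x \<in> carrier (G' 0)" "\<delta>' 0 x = \<zero>\<^bsub>G' 1\<^esub>" for x
      using that inj[of x] q unfolding zero' by (simp add: G'_def \<delta>'_def)
    show "x \<in> \<delta>' i ` carrier (G' i)"
      if x: "x \<in> carrier (G' (Suc i))" "\<delta>' (Suc i) x = \<zero>\<^bsub>G' (Suc (Suc i))\<^esub>" for i x
    proof (cases "Suc i < q")
      case True
      then show ?thesis using x exact[of x i] unfolding zero' by (simp add: G'_def \<delta>'_def)
    next
      case False
      show ?thesis
      proof (cases "Suc i = q")
        case True
        then have "x \<in> C" using x(1) by (simp add: G'_def)
        then have "x \<in> \<delta> i ` carrier (G i)" using exact[of x i] True by (auto simp: C_def)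
        then show ?thesis using True by (simp add: G'_def \<delta>'_def)
      next
        case F: False
        have "\<zero>\<^bsub>G' i\<^esub> \<in> carrier (G' i)" by (rule submoduleD(2)[OF submodule_carrier[OF L]])
        moreover have "x = \<delta>' i \<zero>\<^bsub>G' i\<^esub>" using False F x(1) by (simp add: G'_def \<delta>'_def)
        ultimately show ?thesis by (rule rev_image_eqI)
      qed
    qed
    show "\<delta>' (Suc i) (\<delta>' i x) = \<zero>\<^bsub>G' (Suc (Suc i))\<^esub>" if "x \<in> carrier (G' i)" for i x
      using that cplx[of x i] unfolding zero' by (auto simp: G'_def \<delta>'_def)
    show "baer R (G' (Suc i))" for i
      using baer_G[of i] C baer_trivial[OF Z] by (auto simp: G'_def C_def[symmetric])
  qed
  moreover have "G' 0 = G 0" using q by (simp add: G'_def)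
  moreover have "\<forall>i>q. carrier (G' i) = {\<zero>\<^bsub>G' i\<^esub>}" by (simp add: G'_def)
  ultimately show ?thesis by blast
qed

section \<open>Injective dimension\<close>

text \<open>With the augmentation at index 0, a coresolution of length \<open>n\<close> vanishes
  from index \<open>n + 2\<close> on. The type of its terms is the one in
  \<open>injective_dimension\<close>, so both speak about the same resolutions.\<close>

definition id_le :: "('r, 'a) ring_scheme \<Rightarrow> ('r, 'm, 'b) module_scheme \<Rightarrow> nat \<Rightarrow> bool" where
  "id_le R M n \<longleftrightarrow> (\<exists>(G :: nat \<Rightarrow> ('r, ('r, 'm) univ) module) \<delta> \<iota>. coresolution R G \<delta> \<and>
    lhom R M (G 0) \<iota> \<and> bij_betw \<iota> (carrier M) (carrier (G 0)) \<and>
    (\<forall>i>n. carrier (G (Suc i)) = {\<zero>\<^bsub>G (Suc i)\<^esub>}))"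

lemma injective_resolution_imp_id_le:
  fixes I :: "nat \<Rightarrow> ('r, ('r, 'm) univ) module" and M :: "('r, 'm, 'b) module_scheme"
  assumes M: "left_module R M" and res: "injective_resolution R M e I d"
    and triv: "\<forall>i>n. carrier (I i) = {\<zero>\<^bsub>I i\<^esub>}"
  shows "id_le R M n"
proof -
  note r = res[unfolded injective_resolution_def]
  have b: "baer R (I i)" for i using r injective_module_imp_baer by blast
  then have L: "left_module R (I i)" for i by (simp add: baer_def)
  have d: "lhom R (I i) (I (Suc i)) (d i)" for i using r mod_hom_lhom[OF _ L L] by blast
  have e: "lhom R M (I 0) e" using r mod_hom_lhom[OF _ M L] by blast
  have ex0: "e ` carrier M = {y \<in> carrier (I 0). d 0 y = \<zero>\<^bsub>I 1\<^esub>}"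
    using r unfolding exact_at_def by blast
  have ex: "d i ` carrier (I i) = {y \<in> carrier (I (Suc i)). d (Suc i) y = \<zero>\<^bsub>I (Suc (Suc i))\<^esub>}" for i
    using r unfolding exact_at_def by blast
  have eM: "submodule (e ` carrier M) R (I 0)" by (rule submodule_image[OF e submodule_carrier[OF M]])
  \<comment> \<open>\<open>M\<close> is replaced by its image in \<open>I 0\<close>, so that all
    terms share one type; \<open>\<delta> 0\<close> becomes an inclusion.\<close>
  define G where "G i = (case i of 0 \<Rightarrow> (I 0)\<lparr>carrier := e ` carrier M\<rparr> | Suc j \<Rightarrow> I j)" for i
  define \<delta> where "\<delta> i = (case i of 0 \<Rightarrow> (\<lambda>x. x) | Suc j \<Rightarrow> d j)" for i
  have G [simp]: "G 0 = (I 0)\<lparr>carrier := e ` carrier M\<rparr>" "G (Suc j) = I j" for j by (simp_all add: G_def)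
  have \<delta> [simp]: "\<delta> 0 = (\<lambda>x. x)" "\<delta> (Suc j) = d j" for j by (simp_all add: \<delta>_def)
  have "coresolution R G \<delta>"
  proof
    show "lhom R (G i) (G (Suc i)) (\<delta> i)" for i
      using d lhom_restrict_domain[OF lhom_id[OF L] eM] by (cases i) simp_all
    show "x \<in> \<delta> i ` carrier (G i)"
      if "x \<in> carrier (G (Suc i))" "\<delta> (Suc i) x = \<zero>\<^bsub>G (Suc (Suc i))\<^esub>" for i x
    proof (cases i)
      case 0
      then show ?thesis using that ex0 by simp
    next
      case (Suc j)
      then show ?thesis using that ex[of j] by simp
    qed
    show "\<delta> (Suc i) (\<delta> i x) = \<zero>\<^bsub>G (Suc (Suc i))\<^esub>" if "x \<in> carrier (G i)" for i x
    proof (cases i)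
      case 0
      then show ?thesis using that ex0 by auto
    next
      case (Suc j)
      then have "d j x \<in> d j ` carrier (I j)" using that by simp
      then show ?thesis using ex[of j] Suc by simp
    qed
    show "baer R (G (Suc i))" for i using b by simp
  qed simp
  moreover have "lhom R M (G 0) e" using lhom_restrict_range[OF e eM] by simp
  moreover have "bij_betw e (carrier M) (carrier (G 0))" using r by (simp add: bij_betw_def)
  moreover have "\<forall>i>n. carrier (G (Suc i)) = {\<zero>\<^bsub>G (Suc i)\<^esub>}" using triv by simp
  ultimately show ?thesis unfolding id_le_def by blast
qed

lemma id_le_imp_injective_resolution:
  fixes M :: "('r, 'm, 'b) module_scheme"
  assumes "id_le R M n"
  shows "\<exists>e (I :: nat \<Rightarrow> ('r, ('r, 'm) univ) module) d.
    left_module R M \<and> injective_resolution R M e I d \<and> (\<forall>i > n. carrier (I i) = {\<zero>\<^bsub>I i\<^esub>})"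
proof -
  obtain G :: "nat \<Rightarrow> ('r, ('r, 'm) univ) module" and \<delta> \<iota>
    where co: "coresolution R G \<delta>" and \<iota>: "lhom R M (G 0) \<iota>"
    and bij: "bij_betw \<iota> (carrier M) (carrier (G 0))"
    and triv: "\<forall>i>n. carrier (G (Suc i)) = {\<zero>\<^bsub>G (Suc i)\<^esub>}"
    using assms unfolding id_le_def by blast
  interpret coresolution R G \<delta> by (rule co)
  define I where "I i = G (Suc i)" for i
  define d where "d i = restrict (\<delta> (Suc i)) (carrier (G (Suc i)))" for i
  define e where "e = restrict (\<lambda>x. \<delta> 0 (\<iota> x)) (carrier M)"
  have M: "left_module R M" by (rule lhomD(1)[OF \<iota>])
  have eM: "x \<in> carrier M \<Longrightarrow> e x = \<delta> 0 (\<iota> x)" for x by (simp add: e_def)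
  have "injective_resolution R M e I d"
    unfolding injective_resolution_def
  proof (intro conjI allI)
    show "injective_module R (I i)" for i unfolding I_def by (rule baer_imp_injective_module[OF baer_G])
    show "d i \<in> mod_hom R (I i) (I (Suc i))" for i unfolding d_def I_def by (rule lhom_restrict[OF hom])
    show "e \<in> mod_hom R M (I 0)" unfolding e_def I_def by (rule lhom_restrict[OF lhom_comp[OF \<iota> hom]])
    show "inj_on e (carrier M)"
    proof (rule inj_onI)
      fix x y assume xy: "x \<in> carrier M" "y \<in> carrier M" "e x = e y"
      then have "\<iota> x = \<iota> y" using inj_\<delta>_0 lhomD(3)[OF \<iota>] by (simp add: eM)
      then show "x = y" using bij xy by (auto simp: bij_betw_def dest: inj_onD)
    qed
    have "e ` carrier M = \<delta> 0 ` \<iota> ` carrier M" by (simp add: e_def image_image)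
    also have "\<dots> = \<delta> 0 ` carrier (G 0)" using bij by (simp add: bij_betw_def)
    also have "\<dots> = {y \<in> carrier (G (Suc 0)). \<delta> (Suc 0) y = \<zero>\<^bsub>G (Suc (Suc 0))\<^esub>}"
      using exact[of _ 0] cplx[of _ 0] lhomD(3)[OF hom[of 0]] by blast
    finally show "exact_at M e (I 0) (d 0) (I 1)"
      unfolding exact_at_def by (auto simp: I_def d_def)
    show "exact_at (I i) (d i) (I (Suc i)) (d (Suc i)) (I (Suc (Suc i)))" for i
    proof -
      have "d i ` carrier (I i) = \<delta> (Suc i) ` carrier (G (Suc i))" by (simp add: d_def I_def)
      also have "\<dots> = {y \<in> carrier (G (Suc (Suc i))). \<delta> (Suc (Suc i)) y = \<zero>\<^bsub>G (Suc (Suc (Suc i)))\<^esub>}"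
        using exact[of _ "Suc i"] cplx[of _ "Suc i"] lhomD(3)[OF hom[of "Suc i"]] by blast
      finally show ?thesis unfolding exact_at_def by (auto simp: I_def d_def)
    qed
  qed
  then show ?thesis using M triv unfolding I_def by blast
qed

lemma injective_dimension_id_le: "injective_dimension R M = Inf {enat n | n. id_le R M n}"
proof -
  have "id_le R M n \<longleftrightarrow> (\<exists>e (I :: nat \<Rightarrow> ('a, ('a, 'c) univ) module) d.
    left_module R M \<and> injective_resolution R M e I d \<and> (\<forall>i > n. carrier (I i) = {\<zero>\<^bsub>I i\<^esub>}))" for n
    using injective_resolution_imp_id_le id_le_imp_injective_resolution by blast
  then show ?thesis unfolding injective_dimension_def by presburger
qed

lemma injective_dimension_finite:
  assumes "injective_dimension R M < \<infinity>"
  obtains n where "id_le R M n" "injective_dimension R M = enat n" "\<And>k. id_le R M k \<Longrightarrow> n \<le> k"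
proof -
  have "{enat n | n. id_le R M n} \<noteq> {}"
    using assms unfolding injective_dimension_id_le by (metis Inf_empty less_irrefl top_enat_def)
  then have ne: "\<exists>x. x \<in> {enat n | n. id_le R M n}" by blast
  have "injective_dimension R M \<in> {enat n | n. id_le R M n}"
    unfolding injective_dimension_id_le by (rule exE[OF ne]) (rule wellorder_InfI)
  then obtain n where n: "id_le R M n" "injective_dimension R M = enat n" by blast
  have "n \<le> k" if "id_le R M k" for k
  proof -
    have "injective_dimension R M \<le> enat k" unfolding injective_dimension_id_le by (rule Inf_lower) (use that in blast)
    then show ?thesis using n by simp
  qed
  then show thesis using n that by blast
qed

text \<open>\<open>in_gen_star\<close> supplies one projective resolution in the bounded type, on
  which the Ext condition of \<open>selforthogonal\<close> can be evaluated;
  \<open>lifting_of_resolution\<close> then carries the vanishing over to the coresolution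
  \<open>G\<close>.\<close>

lemma selforthogonal_lifting:
  fixes U :: "('r, 'm, 'b) module_scheme" and G :: "nat \<Rightarrow> ('r, ('r, 'm) univ) module"
  assumes self: "selforthogonal R U" and gen: "in_gen_star R U" and co: "coresolution R G \<delta>"
    and \<iota>: "lhom R U (G 0) \<iota>" and bij: "bij_betw \<iota> (carrier U) (carrier (G 0))"
  shows "coresolution.lifting R G \<delta> U"
proof -
  interpret coresolution R G \<delta> by (rule co)
  have U: "left_module R U" by (rule lhomD(1)[OF \<iota>])
  obtain P :: "nat \<Rightarrow> ('r, ('r, 'm) univ) module" and d e where res: "projective_resolution R P d e U"
    using gen unfolding in_gen_star_def by blast
  note r = res[unfolded projective_resolution_def]
  have P: "projective_module R (P i)" for i using r by blast
  then have L: "left_module R (P i)" for i by (simp add: projective_module_def)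
  have d: "lhom R (P (Suc i)) (P i) (d i)" for i using r mod_hom_lhom[OF _ L L] by blast
  have e: "lhom R (P 0) U e" using r mod_hom_lhom[OF _ L U] by blast
  have ex0: "d 0 ` carrier (P 1) = {y \<in> carrier (P 0). e y = \<zero>\<^bsub>U\<^esub>}"
    using r unfolding exact_at_def by blast
  have ex: "d (Suc i) ` carrier (P (Suc (Suc i))) = {y \<in> carrier (P (Suc i)). d i y = \<zero>\<^bsub>P i\<^esub>}" for i
    using r unfolding exact_at_def by blast
  have lift: "lifting (P j)" for j
    unfolding lifting_def
  proof (intro conjI allI impI L)
    fix i g assume g: "lhom R (P j) (G (Suc i)) g"
      and 0: "\<forall>x\<in>carrier (P j). \<delta> (Suc i) (g x) = \<zero>\<^bsub>G (Suc (Suc i))\<^esub>"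
    \<comment> \<open>Exactness makes \<open>\<delta> i\<close> onto this kernel, so the required
      lift is an instance of projectivity.\<close>
    let ?K = "{x \<in> carrier (G (Suc i)). \<delta> (Suc i) x = \<zero>\<^bsub>G (Suc (Suc i))\<^esub>}"
    have K: "submodule ?K R (G (Suc i))" by (rule submodule_kernel[OF hom])
    have p: "lhom R (G i) ((G (Suc i))\<lparr>carrier := ?K\<rparr>) (\<delta> i)"
      by (rule lhom_restrict_range[OF hom K]) (use cplx lhomD(3)[OF hom] in blast)
    have s: "\<delta> i ` carrier (G i) = carrier ((G (Suc i))\<lparr>carrier := ?K\<rparr>)"
      using exact cplx lhomD(3)[OF hom] by auto
    have g': "lhom R (P j) ((G (Suc i))\<lparr>carrier := ?K\<rparr>) g"
      by (rule lhom_restrict_range[OF g K]) (use 0 lhomD(3)[OF g] in blast)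
    \<comment> \<open>Projectivity of \<open>P j\<close> quantifies over a type built from the
      elements of \<open>P j\<close>, one level above that of \<open>G\<close>; constant functions
      embed the terms of \<open>G\<close> there.\<close>
    define a :: "('r, 'm) univ \<Rightarrow> ('r, ('r, 'm) univ) univ" where "a x = (\<lambda>_. Inl x)" for x
    have a: "inj_on a X" for X by (rule inj_onI) (simp add: a_def fun_eq_iff)
    obtain h where "lhom R (P j) (G i) h" "\<And>x. x \<in> carrier (P j) \<Longrightarrow> \<delta> i (h x) = g x"
      by (rule projective_module_lift[OF P p s g' a a]) (rule that)
    then show "\<exists>h. lhom R (P j) (G i) h \<and> (\<forall>x\<in>carrier (P j). g x = \<delta> i (h x))" by force
  qed
  obtain k where k1: "lhom R (G 0) U k" and "\<And>x. x \<in> carrier U \<Longrightarrow> k (\<iota> x) = x"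
      and k2: "\<And>y. y \<in> carrier (G 0) \<Longrightarrow> \<iota> (k y) = y"
    by (rule lhom_inverse[OF \<iota> bij]) (rule that)
  show ?thesis
  proof (rule lifting_of_resolution[where F = P and \<epsilon> = e and \<phi> = d, OF e _ d _ _ _ _ lift])
    show "e ` carrier (P 0) = carrier U" using r by blast
    show "x \<in> d 0 ` carrier (P 1)" if "x \<in> carrier (P 0)" "e x = \<zero>\<^bsub>U\<^esub>" for x
      unfolding ex0 using that by blast
    show "e (d 0 x) = \<zero>\<^bsub>U\<^esub>" if "x \<in> carrier (P 1)" for x
      using imageI[OF that, of "d 0"] unfolding ex0 by blast
    show "x \<in> d (Suc j) ` carrier (P (Suc (Suc j)))" if "x \<in> carrier (P (Suc j))" "d j x = \<zero>\<^bsub>P j\<^esub>" for j x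
      unfolding ex using that by blast
    show "d j (d (Suc j) x) = \<zero>\<^bsub>P j\<^esub>" if "x \<in> carrier (P (Suc (Suc j)))" for j x
      using imageI[OF that, of "d (Suc j)"] unfolding ex by blast
    fix i w assume w: "lhom R (P (Suc i)) (G 0) w"
      and w0: "\<And>x. x \<in> carrier (P (Suc (Suc i))) \<Longrightarrow> w (d (Suc i) x) = \<zero>\<^bsub>G 0\<^esub>"
    define h where "h = restrict (\<lambda>x. k (w x)) (carrier (P (Suc i)))"
    have h: "h \<in> mod_hom R (P (Suc i)) U" unfolding h_def by (rule lhom_restrict[OF lhom_comp[OF w k1]])
    have "h (d (Suc i) x) = \<zero>\<^bsub>U\<^esub>" if "x \<in> carrier (P (Suc (Suc i)))" for x
      using lhomD(3)[OF d that] w0[OF that] lhom_zero[OF k1] by (simp add: h_def)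
    then have "pullback (P (Suc (Suc i))) (d (Suc i)) h = \<zero>\<^bsub>hom_group R (P (Suc (Suc i))) U\<^esub>"
      by (simp add: pullback_def compose_def hom_group_def cong: restrict_cong)
    moreover have "Ext_zero R (Suc i) U U" using self unfolding selforthogonal_def by simp
    ultimately have "h \<in> pullback (P (Suc i)) (d i) ` mod_hom R (P i) U"
      using h res unfolding Ext_zero_def by fastforce
    then obtain h' where h': "h' \<in> mod_hom R (P i) U" "h = pullback (P (Suc i)) (d i) h'" by blast
    have "lhom R (P i) (G 0) (\<lambda>x. \<iota> (h' x))" by (rule lhom_comp[OF mod_hom_lhom[OF h'(1) L U] \<iota>])
    moreover have "w x = \<iota> (h' (d i x))" if "x \<in> carrier (P (Suc i))" for x
    proof -
      have "k (w x) = h' (d i x)" using that h'(2) by (simp add: h_def pullback_def compose_def fun_eq_iff) metis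
      then show ?thesis using k2[OF lhomD(3)[OF w that]] by simp
    qed
    ultimately show "\<exists>w'. lhom R (P i) (G 0) w' \<and> (\<forall>x \<in> carrier (P (Suc i)). w x = w' (d i x))" by blast
  qed
qed

lemma resolved_bimodule_shorten:
  fixes W :: "('s, 'm, 'd) module_scheme" and H :: "nat \<Rightarrow> ('s, ('s, 'm) univ) module"
  assumes "resolved_bimodule A B U W G \<delta> \<iota> H \<epsilon> \<kappa> m q"
  shows "id_le B W (q - 1)"
proof -
  interpret resolved_bimodule A B U W G \<delta> \<iota> H \<epsilon> \<kappa> m q by fact
  have q: "0 < q" using m_less_q by simp
  obtain H' \<epsilon>' where H': "coresolution B H' \<epsilon>'" "H' 0 = H 0" "\<forall>i>q. carrier (H' i) = {\<zero>\<^bsub>H' i\<^esub>}"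
    using T.truncate[OF q baer_top_kernel] by blast
  have "lhom B W (H' 0) \<kappa>" "bij_betw \<kappa> (carrier W) (carrier (H' 0))"
    using T.\<iota> T.bij by (simp_all add: H'(2))
  moreover have "\<forall>i>q - 1. carrier (H' (Suc i)) = {\<zero>\<^bsub>H' (Suc i)\<^esub>}" using H'(3) q by simp
  ultimately show ?thesis unfolding id_le_def using H'(1) by blast
qed

section \<open>Generalized tilting modules\<close>

text \<open>\<open>U\<close> and \<open>endo_module U\<close> are different records over different
  scalars with one underlying group; this identifies their finite sums.\<close>

lemma finsum_transfer:
  assumes "abelian_monoid G" "abelian_monoid H"
    and "carrier G = carrier H" "add G = add H" "zero G = zero H"
    and "finite I" "g \<in> I \<rightarrow> carrier G"
  shows "finsum G g I = finsum H g I"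
  using assms(6,7)
proof induct
  case empty
  show ?case using assms by (simp add: abelian_monoid.finsum_empty)
next
  case (insert x F)
  have "finsum G g (insert x F) = g x \<oplus>\<^bsub>G\<^esub> finsum G g F"
    using insert by (intro abelian_monoid.finsum_insert[OF assms(1)]) auto
  also have "\<dots> = g x \<oplus>\<^bsub>H\<^esub> finsum H g F" using insert assms(4) by simp
  also have "\<dots> = finsum H g (insert x F)"
    using insert assms(3) by (intro abelian_monoid.finsum_insert[OF assms(2), symmetric]) auto
  finally show ?case .
qed

text \<open>A summand of a power of \<open>U\<close> is a retract of that power; the components of
  the inclusion and of the retraction form a dual basis.\<close>

lemma in_add_dual_basis:
  assumes X: "in_add R U X" and U: "left_module R U"
  shows "\<exists>(n :: nat) \<pi> \<iota>. (\<forall>i<n. lhom R X U (\<pi> i)) \<and> (\<forall>i<n. lhom R U X (\<iota> i)) \<and>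
    (\<forall>x \<in> carrier X. x = (\<Oplus>\<^bsub>X\<^esub>i\<in>{..<n}. \<iota> i (\<pi> i x)))"
proof -
  have XM: "left_module R X" using X by (simp add: in_add_def)
  obtain n D D' f where D: "submodule D R (power_module U n)" and D': "submodule D' R (power_module U n)"
    and int: "D \<inter> D' = {\<zero>\<^bsub>power_module U n\<^esub>}"
    and sum: "D <+>\<^bsub>power_module U n\<^esub> D' = carrier (power_module U n)"
    and f: "f \<in> mod_hom R X ((power_module U n)\<lparr>carrier := D\<rparr>)" and bij: "bij_betw f (carrier X) D"
    using X unfolding in_add_def by (elim exE conjE)
  define P where "P = power_module U n"
  have P: "left_module R P" unfolding P_def by (rule left_module_power[OF U])
  interpret P: left_module R P by (rule P)
  interpret X: left_module R X by (rule XM)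
  note D = D[folded P_def] and D' = D'[folded P_def]
  note LD = left_module_submodule[OF P D] and LD' = left_module_submodule[OF P D']
  have fD: "lhom R X (P\<lparr>carrier := D\<rparr>) f" using mod_hom_lhom[OF f XM] LD unfolding P_def by blast
  have fP: "lhom R X P f" by (rule lhom_extend_range[OF fD P submoduleD(1)[OF D]])
  let ?s = "\<lambda>p. fst p \<oplus>\<^bsub>P\<^esub> snd p"
  let ?DD = "dsum (P\<lparr>carrier := D\<rparr>) (P\<lparr>carrier := D'\<rparr>)"
  have cD: "x \<in> carrier P" if "x \<in> D" for x using that submoduleD(1)[OF D] by blast
  have cD': "x \<in> carrier P" if "x \<in> D'" for x using that submoduleD(1)[OF D'] by blast
  have s: "lhom R ?DD P ?s"
    by (rule lhomI[OF left_module_dsum[OF LD LD'] P])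
      (auto simp: cD cD' P.M.a_ac P.smult_r_distr mem_Times_iff)
  have fst: "lhom R ?DD P fst"
    by (rule lhomI[OF left_module_dsum[OF LD LD'] P]) (auto simp: cD mem_Times_iff)
  have ker: "fst p = \<zero>\<^bsub>P\<^esub>" if p: "p \<in> carrier ?DD" "?s p = \<zero>\<^bsub>P\<^esub>" for p
  proof -
    have c: "fst p \<in> D" "snd p \<in> D'" using p by auto
    then have "fst p = \<ominus>\<^bsub>P\<^esub> snd p" using p(2) P.M.minus_equality[of "fst p" "snd p"] cD cD' by simp
    then have "fst p \<in> D'" using submoduleD(5)[OF D' c(2)] by simp
    then show ?thesis using c int unfolding P_def by blast
  qed
  \<comment> \<open>The projection onto \<open>D\<close> along \<open>D'\<close>: the first
    coordinate descends along the sum map, whose kernel it kills because \<open>D\<close> and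
    \<open>D'\<close> meet in zero.\<close>
  obtain \<rho> where \<rho>: "lhom R (P\<lparr>carrier := ?s ` carrier ?DD\<rparr>) P \<rho>"
      "\<And>p. p \<in> carrier ?DD \<Longrightarrow> \<rho> (?s p) = fst p"
    by (rule lhom_factor_image[OF s fst], erule (1) ker) (rule that)
  have all: "?s ` carrier ?DD = carrier P"
  proof -
    have "?s ` carrier ?DD = D <+>\<^bsub>P\<^esub> D'"
      by (auto simp: set_add_def set_mult_def image_iff; blast)
    then show ?thesis using sum unfolding P_def by simp
  qed
  have \<rho>P: "lhom R P P \<rho>" using \<rho>(1) unfolding all by simp
  have zD': "\<zero>\<^bsub>P\<^esub> \<in> D'" by (rule submoduleD(2)[OF D'])
  have \<rho>_D: "\<rho> x = x" if "x \<in> D" for x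
    using \<rho>(2)[of "(x, \<zero>\<^bsub>P\<^esub>)"] that zD' cD by simp
  have \<rho>_in: "\<rho> x \<in> D" if x: "x \<in> carrier P" for x
  proof -
    obtain p where "p \<in> carrier ?DD" "x = ?s p" using x unfolding all[symmetric] by (rule imageE)
    then show ?thesis using \<rho>(2)[of p] by auto
  qed
  have "bij_betw f (carrier X) (carrier (P\<lparr>carrier := D\<rparr>))" using bij by simp
  then obtain k where kD: "lhom R (P\<lparr>carrier := D\<rparr>) X k" and k: "\<And>x. x \<in> carrier X \<Longrightarrow> k (f x) = x"
      and "\<And>x. x \<in> carrier (P\<lparr>carrier := D\<rparr>) \<Longrightarrow> f (k x) = x"
    by (rule lhom_inverse[OF fD]) (rule that)
  have k\<rho>: "lhom R P X (\<lambda>x. k (\<rho> x))"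
    by (rule lhom_comp[OF lhom_restrict_range[OF \<rho>P D \<rho>_in] kD])
  show ?thesis
  proof (intro exI[of _ n] exI[of _ "\<lambda>i x. f x i"] exI[of _ "\<lambda>i u. k (\<rho> (inc U n i u))"] conjI allI impI ballI)
    show "lhom R X U (\<lambda>x. f x i)" if "i < n" for i
      by (rule lhom_comp[OF fP[unfolded P_def] lhom_proj[OF U that]])
    show "lhom R U X (\<lambda>u. k (\<rho> (inc U n i u)))" if "i < n" for i
      by (rule lhom_comp[OF lhom_inc[OF U] k\<rho>[unfolded P_def]])
    fix x assume x: "x \<in> carrier X"
    have fx: "f x \<in> carrier (power_module U n)" using lhomD(3)[OF fP x] unfolding P_def .
    have "x = k (\<rho> (f x))" using k[OF x] \<rho>_D[OF lhomD(3)[OF fD x, simplified]] by simp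
    also have "\<dots> = (\<Oplus>\<^bsub>X\<^esub>i\<in>{..<n}. k (\<rho> (inc U n i (f x i))))"
      by (rule lhom_power_eq[OF k\<rho>[unfolded P_def] U fx])
    finally show "x = (\<Oplus>\<^bsub>X\<^esub>i\<in>{..<n}. k (\<rho> (inc U n i (f x i))))" .
  qed
qed

section \<open>Hom(V, U) over the endomorphism ring of U\<close>

definition hom_module ::
    "('r, 'a) ring_scheme \<Rightarrow> ('r, 'v, 'b) module_scheme \<Rightarrow> ('r, 'm, 'c) module_scheme \<Rightarrow>
      ('m \<Rightarrow> 'm, 'v \<Rightarrow> 'm) module" where
  "hom_module R V U = \<lparr>carrier = mod_hom R V U, mult = undefined, one = undefined,
     zero = (\<lambda>x \<in> carrier V. \<zero>\<^bsub>U\<^esub>), add = (\<lambda>f g. \<lambda>x \<in> carrier V. f x \<oplus>\<^bsub>U\<^esub> g x),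
     smult = (\<lambda>b f. \<lambda>x \<in> carrier V. b (f x))\<rparr>"

lemma hom_module_simps [simp]:
  "carrier (hom_module R V U) = mod_hom R V U" "zero (hom_module R V U) = (\<lambda>x \<in> carrier V. \<zero>\<^bsub>U\<^esub>)"
  "f \<oplus>\<^bsub>hom_module R V U\<^esub> g = (\<lambda>x \<in> carrier V. f x \<oplus>\<^bsub>U\<^esub> g x)"
  "b \<odot>\<^bsub>hom_module R V U\<^esub> f = (\<lambda>x \<in> carrier V. b (f x))"
  by (simp_all add: hom_module_def)

text \<open>Endomorphisms act on the right in \<open>endo_ring\<close>, so the product in the
  opposite ring is ordinary composition; this makes \<open>U\<close> and, by postcomposition, every
  \<open>hom_module\<close> a left module over it.\<close>

lemma opposite_endo_ring_simps [simp]: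
  "carrier (opposite (endo_ring R U)) = mod_hom R U U"
  "zero (opposite (endo_ring R U)) = (\<lambda>x \<in> carrier U. \<zero>\<^bsub>U\<^esub>)"
  "one (opposite (endo_ring R U)) = (\<lambda>x \<in> carrier U. x)"
  "f \<oplus>\<^bsub>opposite (endo_ring R U)\<^esub> g = (\<lambda>x \<in> carrier U. f x \<oplus>\<^bsub>U\<^esub> g x)"
  "f \<otimes>\<^bsub>opposite (endo_ring R U)\<^esub> g = compose (carrier U) f g"
  by (simp_all add: opposite_def endo_ring_def hom_group_def)

lemma endo_module_simps [simp]:
  "carrier (endo_module U) = carrier U" "zero (endo_module U) = zero U" "add (endo_module U) = add U"
  "b \<odot>\<^bsub>endo_module U\<^esub> x = b x"
  by (simp_all add: endo_module_def)

lemma mod_hom_ext: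
  assumes "f \<in> mod_hom R V U" "g \<in> mod_hom R V U" "\<And>x. x \<in> carrier V \<Longrightarrow> f x = g x"
  shows "f = g"
  using assms by (auto simp: mod_hom_def intro: PiE_ext)

locale endo_context =
  fixes R :: "('r, 'a) ring_scheme" and U :: "('r, 'm, 'b) module_scheme"
  assumes U: "left_module R U" and ring_B: "ring (opposite (endo_ring R U))"
begin

abbreviation "B \<equiv> opposite (endo_ring R U)"
abbreviation "W \<equiv> endo_module U"

lemma mod_homD:
  assumes "f \<in> mod_hom R V U" "left_module R V"
  shows "lhom R V U f" "x \<in> carrier V \<Longrightarrow> f x \<in> carrier U"
proof -
  show "lhom R V U f" by (rule mod_hom_lhom[OF assms U])
  then show "x \<in> carrier V \<Longrightarrow> f x \<in> carrier U" by (rule lhomD(3))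
qed

lemma left_module_W: "left_module B W"
proof -
  interpret U: left_module R U by (rule U)
  have b: "lhom R U U f" if "f \<in> mod_hom R U U" for f by (rule mod_hom_lhom[OF that U U])
  show ?thesis
  proof (rule left_moduleI[OF ring_B])
    show "abelian_group W"
    proof (rule abelian_groupI, goal_cases)
      case (6 x)
      then show ?case by (intro bexI[of _ "\<ominus>\<^bsub>U\<^esub> x"]) (simp_all add: U.M.l_neg)
    qed (simp_all add: U.M.a_ac)
  qed (use lhomD(3,4)[OF b] in \<open>simp_all add: compose_def\<close>)
qed

lemma lhom_hom_module_comp:
  assumes "b \<in> mod_hom R U U" "f \<in> mod_hom R V U" "left_module R V"
  shows "(\<lambda>x \<in> carrier V. b (f x)) \<in> mod_hom R V U"
  by (rule lhom_restrict[OF lhom_comp[OF mod_hom_lhom[OF assms(2,3) U] mod_hom_lhom[OF assms(1) U U]]])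

lemma left_module_hom_module:
  assumes V: "left_module R V" shows "left_module B (hom_module R V U)"
proof -
  interpret U: left_module R U by (rule U)
  interpret V: left_module R V by (rule V)
  have c: "f x \<in> carrier U" if "f \<in> mod_hom R V U" "x \<in> carrier V" for f x using mod_homD(2)[OF that(1) V that(2)] .
  have b: "lhom R U U f" if "f \<in> mod_hom R U U" for f by (rule mod_hom_lhom[OF that U U])
  have add: "(\<lambda>x \<in> carrier V. f x \<oplus>\<^bsub>U\<^esub> g x) \<in> mod_hom R V U"
    if "f \<in> mod_hom R V U" "g \<in> mod_hom R V U" for f g
    by (rule lhom_restrict[OF lhom_plus[OF mod_homD(1)[OF that(1) V] mod_homD(1)[OF that(2) V]]])
  have zero: "(\<lambda>x \<in> carrier V. \<zero>\<^bsub>U\<^esub>) \<in> mod_hom R V U"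
    by (rule lhom_restrict[OF lhom_const_zero[OF V U]])
  have id: "restrict f (carrier V) = f" if "f \<in> mod_hom R V U" for f
    using that by (auto simp: mod_hom_def PiE_def extensional_restrict)
  show ?thesis
  proof (rule left_moduleI[OF ring_B])
    show "abelian_group (hom_module R V U)"
    proof (rule abelian_groupI, goal_cases)
      case (4 f g)
      then show ?case by (simp add: c U.M.a_comm cong: restrict_cong)
    next
      case (6 f)
      have "(\<lambda>x \<in> carrier V. \<zero>\<^bsub>U\<^esub> \<ominus>\<^bsub>U\<^esub> f x) \<in> mod_hom R V U"
        using 6 by (intro lhom_restrict lhom_diff lhom_const_zero V U mod_homD(1)) simp_all
      then show ?case
        using 6 by (intro bexI[of _ "\<lambda>x \<in> carrier V. \<zero>\<^bsub>U\<^esub> \<ominus>\<^bsub>U\<^esub> f x"])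
          (simp_all add: c a_minus_def U.M.l_neg cong: restrict_cong)
    qed (simp_all add: add zero c id U.M.a_assoc cong: restrict_cong)
  qed (use lhomD(3,4)[OF b] in \<open>simp_all add: lhom_hom_module_comp[OF _ _ V] c id compose_def cong: restrict_cong\<close>)
qed

lemma lhom_eval_at:
  assumes V: "left_module R V" and v: "v \<in> carrier V"
  shows "lhom B (hom_module R V U) W (\<lambda>f. f v)"
  by (rule lhomI[OF left_module_hom_module[OF V] left_module_W])
    (use v mod_homD(2)[OF _ V v] in simp_all)

lemma lhom_pullback:
  assumes \<phi>: "lhom R V V' \<phi>"
  shows "lhom B (hom_module R V' U) (hom_module R V U) (pullback V \<phi>)"
proof (rule lhomI[OF left_module_hom_module[OF lhomD(2)[OF \<phi>]] left_module_hom_module[OF lhomD(1)[OF \<phi>]]])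
  show "pullback V \<phi> f \<in> carrier (hom_module R V U)" if "f \<in> carrier (hom_module R V' U)" for f
    unfolding pullback_def compose_def hom_module_simps
    by (rule lhom_restrict[OF lhom_comp[OF \<phi> mod_homD(1)[OF _ lhomD(2)[OF \<phi>]]]]) (use that in simp)
qed (use lhomD(3)[OF \<phi>] in \<open>simp_all add: pullback_def compose_def cong: restrict_cong\<close>)

lemma finsum_W: "finite I \<Longrightarrow> g \<in> I \<rightarrow> carrier U \<Longrightarrow> finsum W g I = finsum U g I"
  using left_module_abelian_group[OF left_module_W] left_module_abelian_group[OF U]
  by (intro finsum_transfer) (simp_all add: abelian_group_def)

text \<open>With a dual basis, \<open>f\<close> is the sum of the composites of
  \<open>\<pi> i\<close>, \<open>\<iota> i\<close> and \<open>f\<close>. So the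
  \<open>\<pi> i\<close> generate with coordinates in \<open>B\<close>, a functional is determined
  by its values on them, and a point that they kill is zero.\<close>

lemma hom_module_add:
  fixes V :: "('r, 'v, 'w) module_scheme"
  assumes X: "in_add R U V"
  shows "(\<exists>n r s. lhom B (free B n) (hom_module R V U) r \<and> lhom B (hom_module R V U) (free B n) s \<and>
      (\<forall>f \<in> mod_hom R V U. r (s f) = f)) \<and>
    (\<forall>\<theta>. lhom B (hom_module R V U) W \<theta> \<longrightarrow> (\<exists>v \<in> carrier V. \<forall>f \<in> mod_hom R V U. \<theta> f = f v)) \<and>
    (\<forall>v \<in> carrier V. (\<forall>f \<in> mod_hom R V U. f v = \<zero>\<^bsub>U\<^esub>) \<longrightarrow> v = \<zero>\<^bsub>V\<^esub>)"
proof -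
  have V: "left_module R V" using X by (simp add: in_add_def)
  interpret U: left_module R U by (rule U)
  interpret V: left_module R V by (rule V)
  interpret W: left_module B W by (rule left_module_W)
  obtain n :: nat and \<pi> \<iota> where db: "\<forall>i<n. lhom R V U (\<pi> i)" "\<forall>i<n. lhom R U V (\<iota> i)"
    "\<forall>x \<in> carrier V. x = (\<Oplus>\<^bsub>V\<^esub>i\<in>{..<n}. \<iota> i (\<pi> i x))"
    using in_add_dual_basis[OF X U] by (elim exE conjE)
  have \<pi>: "lhom R V U (\<pi> i)" and \<iota>: "lhom R U V (\<iota> i)" if "i < n" for i using db(1,2) that by simp_all
  note dec = db(3)[rule_format]
  let ?H = "hom_module R V U"
  note H = left_module_hom_module[OF V]
  define y where "y = (\<lambda>i \<in> {..<n}. restrict (\<pi> i) (carrier V))"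
  have y: "y \<in> carrier (power_module ?H n)"
    using lhom_restrict[OF \<pi>] by (auto simp: y_def)
  define s where "s f = (\<lambda>i \<in> {..<n}. \<lambda>u \<in> carrier U. f (\<iota> i u))" for f :: "'v \<Rightarrow> 'm"
  have sB: "(\<lambda>u \<in> carrier U. f (\<iota> i u)) \<in> mod_hom R U U" if "i < n" "f \<in> mod_hom R V U" for i f
    by (rule lhom_restrict[OF lhom_comp[OF \<iota>[OF that(1)] mod_homD(1)[OF that(2) V]]])
  have ring: "ring B" by (rule ring_B)
  note FB = left_module_free[OF ring_B]
  have s: "lhom B ?H (free B n) s"
    by (rule lhomI[OF H FB])
      (use sB lhomD(3)[OF \<iota>] in \<open>auto simp: s_def compose_def intro!: restrict_ext\<close>)
  \<comment> \<open>Pairs a family in \<open>U\<close> with the coordinates of \<open>f\<close>; it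
    is applied to the values of the \<open>\<pi> i\<close> at a point and to the values of a
    functional on them.\<close>
  have lin_val: "lin W n x (s f) = f (\<Oplus>\<^bsub>V\<^esub>i\<in>{..<n}. \<iota> i (x i))"
    if f: "f \<in> mod_hom R V U" and x: "x \<in> {..<n} \<rightarrow> carrier U" for f x
  proof -
    have ix: "(\<lambda>i. \<iota> i (x i)) \<in> {..<n} \<rightarrow> carrier V" using lhomD(3)[OF \<iota>] x by auto
    have fx: "(\<lambda>i. f (\<iota> i (x i))) \<in> {..<n} \<rightarrow> carrier U"
      using ix mod_homD(2)[OF f V] by auto
    have "lin W n x (s f) = (\<Oplus>\<^bsub>W\<^esub>i\<in>{..<n}. f (\<iota> i (x i)))"
      unfolding lin_def by (rule W.M.finsum_cong'[OF refl]) (use x fx in \<open>auto simp: s_def Pi_iff\<close>)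
    also have "\<dots> = (\<Oplus>\<^bsub>U\<^esub>i\<in>{..<n}. f (\<iota> i (x i)))" by (rule finsum_W[OF _ fx]) simp
    also have "\<dots> = f (\<Oplus>\<^bsub>V\<^esub>i\<in>{..<n}. \<iota> i (x i))"
      by (rule lhom_finsum[OF mod_homD(1)[OF f V] _ ix, symmetric]) simp
    finally show ?thesis .
  qed
  have sf: "s f \<in> carrier (free B n)" if "f \<in> mod_hom R V U" for f
    using lhomD(3)[OF s] that by (simp del: power_module_simps)
  have rs: "lin ?H n y (s f) = f" if f: "f \<in> mod_hom R V U" for f
    proof (rule mod_hom_ext[OF _ f])
      show "lin ?H n y (s f) \<in> mod_hom R V U"
        using lhomD(3)[OF lin_hom[OF H y] sf[OF f]] by simp
      fix v assume v: "v \<in> carrier V"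
      have "lin ?H n y (s f) v = lin W n (\<lambda>i \<in> {..<n}. y i v) (s f)"
        by (rule lin_comp[OF lhom_eval_at[OF V v] y sf[OF f]])
      also have "(\<lambda>i \<in> {..<n}. y i v) = (\<lambda>i \<in> {..<n}. \<pi> i v)"
        using v by (auto simp: y_def intro!: restrict_ext)
      also have "lin W n (\<lambda>i \<in> {..<n}. \<pi> i v) (s f) = f (\<Oplus>\<^bsub>V\<^esub>i\<in>{..<n}. \<iota> i ((\<lambda>i \<in> {..<n}. \<pi> i v) i))"
        by (rule lin_val[OF f]) (use lhomD(3)[OF \<pi> v] in auto)
      also have "(\<Oplus>\<^bsub>V\<^esub>i\<in>{..<n}. \<iota> i ((\<lambda>i \<in> {..<n}. \<pi> i v) i)) = (\<Oplus>\<^bsub>V\<^esub>i\<in>{..<n}. \<iota> i (\<pi> i v))"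
        by (rule V.M.finsum_cong'[OF refl]) (use lhomD(3)[OF \<iota> lhomD(3)[OF \<pi> v]] in auto)
      also have "\<dots> = v" by (rule dec[OF v, symmetric])
      finally show "lin ?H n y (s f) v = f v" .
    qed
  show ?thesis
  proof (intro conjI exI[of _ n] exI[of _ "lin ?H n y"] exI[of _ s] allI impI ballI)
    show "lhom B (free B n) ?H (lin ?H n y)" "lhom B ?H (free B n) s"
      by (rule lin_hom[OF H y], rule s)
    show "lin ?H n y (s f) = f" if "f \<in> mod_hom R V U" for f by (rule rs[OF that])
    show "\<exists>v \<in> carrier V. \<forall>f \<in> mod_hom R V U. \<theta> f = f v" if \<theta>: "lhom B ?H W \<theta>" for \<theta>
    proof -
      \<comment> \<open>The point that represents \<open>\<theta>\<close> is assembled from the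
        values of \<open>\<theta>\<close> on the generators.\<close>
      define x where "x = (\<lambda>i \<in> {..<n}. \<theta> (y i))"
      have yi: "y i \<in> carrier ?H" if "i < n" for i using y that by auto
      have x: "x \<in> {..<n} \<rightarrow> carrier U" using lhomD(3)[OF \<theta> yi] by (auto simp: x_def)
      have "\<theta> f = f (\<Oplus>\<^bsub>V\<^esub>i\<in>{..<n}. \<iota> i (x i))" if f: "f \<in> mod_hom R V U" for f
      proof -
        have "\<theta> f = \<theta> (lin ?H n y (s f))" by (simp only: rs[OF f])
        also have "\<dots> = lin W n x (s f)" unfolding x_def by (rule lin_comp[OF \<theta> y sf[OF f]])
        finally show ?thesis unfolding lin_val[OF f x] .
      qed
      moreover have "(\<Oplus>\<^bsub>V\<^esub>i\<in>{..<n}. \<iota> i (x i)) \<in> carrier V"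
        by (rule V.M.finsum_closed) (use lhomD(3)[OF \<iota>] x in auto)
      ultimately show ?thesis by blast
    qed
    show "v = \<zero>\<^bsub>V\<^esub>" if v: "v \<in> carrier V" "\<forall>f \<in> mod_hom R V U. f v = \<zero>\<^bsub>U\<^esub>" for v
    proof -
      have "\<iota> i (\<pi> i v) = \<zero>\<^bsub>V\<^esub>" if i: "i < n" for i
      proof -
        have "restrict (\<pi> i) (carrier V) v = \<zero>\<^bsub>U\<^esub>" using v(2) lhom_restrict[OF \<pi>[OF i]] by blast
        then show ?thesis using v(1) lhom_zero[OF \<iota>[OF i]] by simp
      qed
      then have "(\<Oplus>\<^bsub>V\<^esub>i\<in>{..<n}. \<iota> i (\<pi> i v)) = (\<Oplus>\<^bsub>V\<^esub>i\<in>{..<n}. \<zero>\<^bsub>V\<^esub>)"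
        by (intro V.M.finsum_cong') auto
      then show ?thesis using dec[OF v(1)] by (simp add: V.M.finsum_zero)
    qed
  qed
qed

end

lemma (in coresolution) lifting_retract:
  assumes r: "lhom R F C r" and s: "lhom R C F s" and rs: "\<And>x. x \<in> carrier C \<Longrightarrow> r (s x) = x"
    and F: "lifting F"
  shows "lifting C"
  unfolding lifting_def
proof (intro conjI allI impI)
  show "left_module R C" by (rule lhomD(1)[OF s])
  fix i g assume g: "lhom R C (G (Suc i)) g"
    and 0: "\<forall>x\<in>carrier C. \<delta> (Suc i) (g x) = \<zero>\<^bsub>G (Suc (Suc i))\<^esub>"
  have z: "\<delta> (Suc i) (g (r x)) = \<zero>\<^bsub>G (Suc (Suc i))\<^esub>" if "x \<in> carrier F" for x
    using 0 lhomD(3)[OF r that] by blast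
  obtain h where h: "lhom R F (G i) h" "\<And>x. x \<in> carrier F \<Longrightarrow> g (r x) = \<delta> i (h x)"
    by (rule liftingD[OF F lhom_comp[OF r g]], erule z) (rule that)
  have "g x = \<delta> i (h (s x))" if x: "x \<in> carrier C" for x
    using h(2)[OF lhomD(3)[OF s x]] rs[OF x] by simp
  then show "\<exists>h. lhom R C (G i) h \<and> (\<forall>x\<in>carrier C. g x = \<delta> i (h x))"
    using lhom_comp[OF s h(1)] by blast
qed

section \<open>The resolution of U over its endomorphism ring\<close>

locale tilting_coresolution = endo_context R U
  for R :: "('r, 'a) ring_scheme" and U :: "('r, 'm, 'b) module_scheme" +
  fixes V :: "nat \<Rightarrow> ('r, 'v) module" and e :: "'r \<Rightarrow> 'v" and d :: "nat \<Rightarrow> 'v \<Rightarrow> 'v"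
  assumes V: "in_add R U (V i)" and e: "lhom R (regular_module R) (V 0) e"
    and d: "lhom R (V i) (V (Suc i)) (d i)" and inj_e: "inj_on e (carrier R)"
    and ex0: "e ` carrier R = {x \<in> carrier (V 0). d 0 x = \<zero>\<^bsub>V 1\<^esub>}"
    and ex: "d i ` carrier (V i) = {x \<in> carrier (V (Suc i)). d (Suc i) x = \<zero>\<^bsub>V (Suc (Suc i))\<^esub>}"
    and surj: "pullback (regular_module R) e ` mod_hom R (V 0) U = mod_hom R (regular_module R) U"
    and ex_hom0: "pullback (V 0) (d 0) ` mod_hom R (V 1) U =
      {f \<in> mod_hom R (V 0) U. pullback (regular_module R) e f = (\<lambda>x \<in> carrier R. \<zero>\<^bsub>U\<^esub>)}"
    and ex_hom: "pullback (V (Suc i)) (d (Suc i)) ` mod_hom R (V (Suc (Suc i))) U =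
      {f \<in> mod_hom R (V (Suc i)) U. pullback (V i) (d i) f = (\<lambda>x \<in> carrier (V i). \<zero>\<^bsub>U\<^esub>)}"
begin

lemma left_module_V: "left_module R (V i)"
  using V by (simp add: in_add_def)

lemma ring_R: "ring R" by (rule left_module_ring[OF U])

lemma one_closed: "\<one>\<^bsub>R\<^esub> \<in> carrier R" by (rule ring.ring_simprules(6)[OF ring_R])

lemma e_one: "a \<in> carrier R \<Longrightarrow> e a = a \<odot>\<^bsub>V 0\<^esub> e \<one>\<^bsub>R\<^esub>"
proof -
  interpret ring R by (rule ring_R)
  assume "a \<in> carrier R"
  then show ?thesis using lhomD(5)[OF e, of a "\<one>\<^bsub>R\<^esub>"] by simp
qed

lemma e_closed: "e \<one>\<^bsub>R\<^esub> \<in> carrier (V 0)"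
  using lhomD(3)[OF e] one_closed by simp

lemma hom_e:
  assumes "f \<in> mod_hom R (V 0) U" "a \<in> carrier R"
  shows "f (e a) = a \<odot>\<^bsub>U\<^esub> f (e \<one>\<^bsub>R\<^esub>)"
  unfolding e_one[OF assms(2)] by (rule lhomD(5)[OF mod_homD(1)[OF assms(1) left_module_V] assms(2) e_closed])

abbreviation "F i \<equiv> hom_module R (V i) U"

lemma F: "left_module B (F i)" by (rule left_module_hom_module[OF left_module_V])

lemma F_retract:
  obtains n r s where "lhom B (free B n) (F i) r" "lhom B (F i) (free B n) s"
    "\<And>f. f \<in> carrier (F i) \<Longrightarrow> r (s f) = f"
proof -
  from hom_module_add[OF V[of i], THEN conjunct1]
  obtain n where "\<exists>r s. lhom B (free B n) (F i) r \<and> lhom B (F i) (free B n) s \<and>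
      (\<forall>f \<in> mod_hom R (V i) U. r (s f) = f)" ..
  then obtain r where "\<exists>s. lhom B (free B n) (F i) r \<and> lhom B (F i) (free B n) s \<and>
      (\<forall>f \<in> mod_hom R (V i) U. r (s f) = f)" ..
  then obtain s where rs: "lhom B (free B n) (F i) r \<and> lhom B (F i) (free B n) s \<and>
      (\<forall>f \<in> mod_hom R (V i) U. r (s f) = f)" ..
  show thesis by (rule that[of n r s]) (use rs in \<open>simp_all del: power_module_simps\<close>)
qed

text \<open>Identifying homomorphisms from the ring to \<open>U\<close> with elements of
  \<open>U\<close>, the pullback along \<open>e\<close> becomes evaluation at the image of one: the
  augmentation of the resolution \<open>F\<close>.\<close>

lemma eval_e: "lhom B (F 0) W (\<lambda>f. f (e \<one>\<^bsub>R\<^esub>))"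
  by (rule lhom_eval_at[OF left_module_V e_closed])

lemma eval_e_surj: "(\<lambda>f. f (e \<one>\<^bsub>R\<^esub>)) ` carrier (F 0) = carrier W"
proof
  show "(\<lambda>f. f (e \<one>\<^bsub>R\<^esub>)) ` carrier (F 0) \<subseteq> carrier W" using lhomD(3)[OF eval_e] by blast
  show "carrier W \<subseteq> (\<lambda>f. f (e \<one>\<^bsub>R\<^esub>)) ` carrier (F 0)"
  proof
    fix u assume "u \<in> carrier W"
    then have u: "u \<in> carrier U" by simp
    interpret U: left_module R U by (rule U)
    have "lhom R (regular_module R) U (\<lambda>a. a \<odot>\<^bsub>U\<^esub> u)"
      using u by (intro lhomI left_module_regular ring_R U)
        (simp_all add: U.smult_closed U.smult_l_distr U.smult_assoc)
    then have "restrict (\<lambda>a. a \<odot>\<^bsub>U\<^esub> u) (carrier (regular_module R)) \<in> mod_hom R (regular_module R) U"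
      by (rule lhom_restrict)
    then obtain f where f: "f \<in> mod_hom R (V 0) U"
        "restrict (\<lambda>a. a \<odot>\<^bsub>U\<^esub> u) (carrier (regular_module R)) = pullback (regular_module R) e f"
      unfolding surj[symmetric] by blast
    from fun_cong[OF f(2), of "\<one>\<^bsub>R\<^esub>"] have "u = f (e \<one>\<^bsub>R\<^esub>)"
      using one_closed u by (simp add: pullback_def compose_def U.smult_one)
    then show "u \<in> (\<lambda>f. f (e \<one>\<^bsub>R\<^esub>)) ` carrier (F 0)" using f(1) by simp
  qed
qed

lemma separated:
  assumes "v \<in> carrier (V i)" "\<And>f. f \<in> mod_hom R (V i) U \<Longrightarrow> f v = \<zero>\<^bsub>U\<^esub>"
  shows "v = \<zero>\<^bsub>V i\<^esub>"
  using hom_module_add[OF V[of i], THEN conjunct2, THEN conjunct2] assms by blast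

lemma hom_is_eval:
  assumes "lhom B (F i) W \<theta>"
  shows "\<exists>v \<in> carrier (V i). \<forall>f \<in> mod_hom R (V i) U. \<theta> f = f v"
  using hom_module_add[OF V[of i], THEN conjunct2, THEN conjunct1] assms by blast

text \<open>The ring embeds by \<open>e\<close> into \<open>V 0\<close>, whose points are separated
  by maps to \<open>U\<close>; on the image of \<open>e\<close> these maps are given by scalar
  multiplication on \<open>U\<close>.\<close>

lemma faithful:
  assumes a: "a \<in> carrier R" and 0: "\<And>u. u \<in> carrier U \<Longrightarrow> a \<odot>\<^bsub>U\<^esub> u = \<zero>\<^bsub>U\<^esub>"
  shows "a = \<zero>\<^bsub>R\<^esub>"
proof -
  interpret R: ring R by (rule ring_R)
  have "e a = \<zero>\<^bsub>V 0\<^esub>"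
  proof (rule separated)
    show "e a \<in> carrier (V 0)" using lhomD(3)[OF e] a by simp
    show "f (e a) = \<zero>\<^bsub>U\<^esub>" if "f \<in> mod_hom R (V 0) U" for f
      unfolding hom_e[OF that a] by (rule 0[OF mod_homD(2)[OF that left_module_V e_closed]])
  qed
  then have "e a = e \<zero>\<^bsub>R\<^esub>" using lhom_zero[OF e] by simp
  then show ?thesis using inj_onD[OF inj_e] a by simp
qed

text \<open>Composed with the augmentation, \<open>g\<close> becomes evaluation at some
  \<open>v\<close> in \<open>V 0\<close>. It kills the pullbacks from \<open>V 1\<close>, so
  \<open>d 0 v\<close> is zero because maps to \<open>U\<close> separate points, and exactness puts
  \<open>v\<close> into the image of the ring.\<close>

lemma end_W:
  assumes g: "lhom B W W g"
  shows "\<exists>a \<in> carrier R. \<forall>u \<in> carrier U. g u = a \<odot>\<^bsub>U\<^esub> u"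
proof -
  obtain v where v: "v \<in> carrier (V 0)" "\<forall>f \<in> mod_hom R (V 0) U. g (f (e \<one>\<^bsub>R\<^esub>)) = f v"
    using hom_is_eval[OF lhom_comp[OF eval_e g]] by blast
  have "d 0 v = \<zero>\<^bsub>V (Suc 0)\<^esub>"
  proof (rule separated)
    show "d 0 v \<in> carrier (V (Suc 0))" by (rule lhomD(3)[OF d v(1)])
    fix f assume f: "f \<in> mod_hom R (V (Suc 0)) U"
    have "pullback (V 0) (d 0) f \<in> pullback (V 0) (d 0) ` mod_hom R (V 1) U" using f by simp
    then have h: "pullback (V 0) (d 0) f \<in> mod_hom R (V 0) U"
      "pullback (regular_module R) e (pullback (V 0) (d 0) f) = (\<lambda>x \<in> carrier R. \<zero>\<^bsub>U\<^esub>)"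
      unfolding ex_hom0 by simp_all
    have "pullback (V 0) (d 0) f (e \<one>\<^bsub>R\<^esub>) = \<zero>\<^bsub>U\<^esub>"
      using fun_cong[OF h(2), of "\<one>\<^bsub>R\<^esub>"] one_closed by (simp add: pullback_def compose_def)
    then have "pullback (V 0) (d 0) f v = g \<zero>\<^bsub>U\<^esub>" using v(2) h(1) by metis
    then show "f (d 0 v) = \<zero>\<^bsub>U\<^esub>" using lhom_zero[OF g] v(1) by (simp add: pullback_def compose_def)
  qed
  then have "v \<in> e ` carrier R" unfolding ex0 using v(1) by simp
  then obtain a where a: "a \<in> carrier R" "v = e a" by blast
  have "g u = a \<odot>\<^bsub>U\<^esub> u" if "u \<in> carrier U" for u
  proof -
    have "u \<in> (\<lambda>f. f (e \<one>\<^bsub>R\<^esub>)) ` carrier (F 0)" using that eval_e_surj by simp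
    then obtain f where f: "f \<in> mod_hom R (V 0) U" "u = f (e \<one>\<^bsub>R\<^esub>)" by auto
    then show ?thesis using v(2) hom_e[OF f(1) a(1)] a(2) by simp
  qed
  then show ?thesis using a(1) by blast
qed

text \<open>\<open>W\<close> is an image of \<open>F 0\<close>, which is a retract of a finite free
  module.\<close>

lemma noeth_W:
  assumes "noeth B (regular_module B)"
  shows "noeth B W"
proof -
  have "noeth B (F 0)"
  proof (rule F_retract[of 0])
    fix n r s
    assume r: "lhom B (free B n) (F 0) r" and s: "lhom B (F 0) (free B n) s"
      and rs: "\<And>f. f \<in> carrier (F 0) \<Longrightarrow> r (s f) = f"
    have "r ` carrier (free B n) = carrier (F 0)"
    proof
      show "r ` carrier (free B n) \<subseteq> carrier (F 0)" using lhomD(3)[OF r] by blast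
      show "carrier (F 0) \<subseteq> r ` carrier (free B n)"
      proof
        fix f assume f: "f \<in> carrier (F 0)"
        have "r (s f) \<in> r ` carrier (free B n)" by (rule imageI[OF lhomD(3)[OF s f]])
        then show "f \<in> r ` carrier (free B n)" unfolding rs[OF f] .
      qed
    qed
    then show ?thesis by (rule noeth_image[OF r noeth_power[OF assms]])
  qed
  then show ?thesis by (rule noeth_image[OF eval_e _ eval_e_surj])
qed

text \<open>The modules \<open>F i\<close> are retracts of free ones and resolve \<open>W\<close>.
  Homomorphisms from them to \<open>W\<close> are evaluations, so dualizing the resolution returns
  \<open>V\<close>, and exactness of \<open>V\<close> kills the higher Ext of \<open>W\<close> with
  itself.\<close>

lemma lifting_W:
  fixes H :: "nat \<Rightarrow> ('m \<Rightarrow> 'm, 'h) module"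
  assumes co: "coresolution B H \<epsilon>" and \<kappa>: "lhom B W (H 0) \<kappa>"
    and bij: "bij_betw \<kappa> (carrier W) (carrier (H 0))"
  shows "coresolution.lifting B H \<epsilon> W"
proof -
  interpret coresolution B H \<epsilon> by (rule co)
  have lift: "lifting (F j)" for j
  proof (rule F_retract[of j])
    fix n r s
    assume r: "lhom B (free B n) (F j) r" and s: "lhom B (F j) (free B n) s"
      and rs: "\<And>f. f \<in> carrier (F j) \<Longrightarrow> r (s f) = f"
    show ?thesis by (rule lifting_retract[where F = "free B n" and C = "F j" and r = r and s = s, OF r s rs lifting_power[OF lifting_regular[OF ring_B]]])
  qed
  obtain k where k1: "lhom B (H 0) W k" and "\<And>x. x \<in> carrier W \<Longrightarrow> k (\<kappa> x) = x"
      and k2: "\<And>y. y \<in> carrier (H 0) \<Longrightarrow> \<kappa> (k y) = y"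
    by (rule lhom_inverse[OF \<kappa> bij]) (rule that)
  show ?thesis
  proof (rule lifting_of_resolution[where F = "\<lambda>j. F j" and \<epsilon> = "\<lambda>f. f (e \<one>\<^bsub>R\<^esub>)" and \<phi> = "\<lambda>j. pullback (V j) (d j)",
        OF eval_e eval_e_surj lhom_pullback[OF d] _ _ _ _ lift])
    show "f \<in> pullback (V 0) (d 0) ` carrier (F 1)"
      if f: "f \<in> carrier (F 0)" "f (e \<one>\<^bsub>R\<^esub>) = \<zero>\<^bsub>W\<^esub>" for f
    proof -
      interpret U: left_module R U by (rule U)
      have f': "f \<in> mod_hom R (V 0) U" using f(1) by simp
      have "f (e a) = \<zero>\<^bsub>U\<^esub>" if "a \<in> carrier R" for a
        using hom_e[OF f' that] f(2) U.smult_r_null[OF that] by simp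
      then have "pullback (regular_module R) e f = (\<lambda>x \<in> carrier R. \<zero>\<^bsub>U\<^esub>)"
        by (simp add: pullback_def compose_def cong: restrict_cong)
      then have "f \<in> pullback (V 0) (d 0) ` mod_hom R (V 1) U" unfolding ex_hom0 using f' by simp
      then show ?thesis by simp
    qed
    show "pullback (V 0) (d 0) f (e \<one>\<^bsub>R\<^esub>) = \<zero>\<^bsub>W\<^esub>" if f: "f \<in> carrier (F 1)" for f
    proof -
      have "pullback (V 0) (d 0) f \<in> pullback (V 0) (d 0) ` mod_hom R (V 1) U" using f by simp
      then have "pullback (regular_module R) e (pullback (V 0) (d 0) f) = (\<lambda>x \<in> carrier R. \<zero>\<^bsub>U\<^esub>)"
        unfolding ex_hom0 by simp
      from fun_cong[OF this, of "\<one>\<^bsub>R\<^esub>"] show ?thesis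
        using one_closed by (simp add: pullback_def compose_def)
    qed
    show "f \<in> pullback (V (Suc j)) (d (Suc j)) ` carrier (F (Suc (Suc j)))"
      if "f \<in> carrier (F (Suc j))" "pullback (V j) (d j) f = \<zero>\<^bsub>F j\<^esub>" for j f
      using that ex_hom[of j] by simp
    show "pullback (V j) (d j) (pullback (V (Suc j)) (d (Suc j)) f) = \<zero>\<^bsub>F j\<^esub>"
      if "f \<in> carrier (F (Suc (Suc j)))" for j f
    proof -
      have "pullback (V (Suc j)) (d (Suc j)) f \<in> pullback (V (Suc j)) (d (Suc j)) ` mod_hom R (V (Suc (Suc j))) U"
        using that by simp
      then show ?thesis unfolding ex_hom by simp
    qed
    fix i w assume w: "lhom B (F (Suc i)) (H 0) w"
      and w0: "\<And>f. f \<in> carrier (F (Suc (Suc i))) \<Longrightarrow> w (pullback (V (Suc i)) (d (Suc i)) f) = \<zero>\<^bsub>H 0\<^esub>"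
    \<comment> \<open>The cocycle is evaluation at \<open>v\<close>; being a cocycle, it forces
      \<open>d (Suc i) v\<close> to vanish, and a preimage of \<open>v\<close> gives the
      coboundary.\<close>
    obtain v where v: "v \<in> carrier (V (Suc i))" "\<forall>f \<in> mod_hom R (V (Suc i)) U. k (w f) = f v"
      using hom_is_eval[OF lhom_comp[OF w k1]] by blast
    have "d (Suc i) v = \<zero>\<^bsub>V (Suc (Suc i))\<^esub>"
    proof (rule separated)
      show "d (Suc i) v \<in> carrier (V (Suc (Suc i)))" by (rule lhomD(3)[OF d v(1)])
      fix f assume f: "f \<in> mod_hom R (V (Suc (Suc i))) U"
      have p: "pullback (V (Suc i)) (d (Suc i)) f \<in> mod_hom R (V (Suc i)) U"
        using lhomD(3)[OF lhom_pullback[OF d]] f by simp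
      have "k (w (pullback (V (Suc i)) (d (Suc i)) f)) = \<zero>\<^bsub>U\<^esub>"
        using w0 f lhom_zero[OF k1] by simp
      then show "f (d (Suc i) v) = \<zero>\<^bsub>U\<^esub>"
        using v(2) p v(1) by (simp add: pullback_def compose_def)
    qed
    then have "v \<in> d i ` carrier (V i)" unfolding ex using v(1) by simp
    then obtain v' where v': "v' \<in> carrier (V i)" "v = d i v'" by blast
    have "w f = \<kappa> (pullback (V i) (d i) f v')" if f: "f \<in> carrier (F (Suc i))" for f
    proof -
      have "k (w f) = pullback (V i) (d i) f v'" using v v' f by (simp add: pullback_def compose_def)
      then show ?thesis using k2[OF lhomD(3)[OF w f]] by simp
    qed
    moreover have "lhom B (F i) (H 0) (\<lambda>f. \<kappa> (f v'))"
      by (rule lhom_comp[OF lhom_eval_at[OF left_module_V v'(1)] \<kappa>])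
    ultimately show "\<exists>w'. lhom B (F i) (H 0) w' \<and>
        (\<forall>f \<in> carrier (F (Suc i)). w f = w' (pullback (V i) (d i) f))" by blast
  qed
qed

lemma balanced:
  assumes A: "noeth R (regular_module R)" and B: "noeth B (regular_module B)"
    and fg: "finitely_generated R U"
  shows "balanced_bimodule R B U W"
proof (rule balanced_bimodule.intro)
  show "a \<odot>\<^bsub>U\<^esub> (b \<odot>\<^bsub>W\<^esub> u) = b \<odot>\<^bsub>W\<^esub> (a \<odot>\<^bsub>U\<^esub> u)"
    if "a \<in> carrier R" "b \<in> carrier B" "u \<in> carrier U" for a b u
    using lhomD(5)[OF mod_hom_lhom[OF _ U U]] that by simp
  show "\<exists>b \<in> carrier B. \<forall>u \<in> carrier U. f u = b \<odot>\<^bsub>W\<^esub> u" if "lhom R U U f" for f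
    using lhom_restrict[OF that] by (intro bexI[of _ "restrict f (carrier U)"]) simp_all
  show "b = \<zero>\<^bsub>B\<^esub>" if "b \<in> carrier B" "\<And>u. u \<in> carrier U \<Longrightarrow> b \<odot>\<^bsub>W\<^esub> u = \<zero>\<^bsub>U\<^esub>" for b
  proof (rule mod_hom_ext)
    show "b \<in> mod_hom R U U" using that(1) by simp
    show "\<zero>\<^bsub>B\<^esub> \<in> mod_hom R U U" using lhom_restrict[OF lhom_const_zero[OF U U]] by simp
  qed (use that(2) in simp)
  show "noeth R U" by (rule finitely_generated_noeth[OF U fg A])
  show "noeth B W" by (rule noeth_W[OF B])
qed (use U left_module_W end_W faithful A B in simp_all)

end

section \<open>Equality of the two injective dimensions\<close>

theorem theorem2p7:
  fixes R :: "('r, 'a) ring_scheme" and U :: "('r, 'm, 'b) module_scheme"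
    and S :: "('m \<Rightarrow> 'm) ring"
  assumes "generalized_tilting R U"
    and "S = endo_ring R U"
    and "left_noetherian R"
    and "right_noetherian S"
    and "injective_dimension R U < \<infinity>"
    and "right_injective_dimension S (endo_module U) < \<infinity>"
  shows "injective_dimension R U = right_injective_dimension S (endo_module U)"
proof -
  let ?B = "opposite (endo_ring R U)" and ?W = "endo_module U"
  have self: "selforthogonal R U" and gen: "in_gen_star R U"
    using assms(1) unfolding generalized_tilting_def by blast+
  have U: "left_module R U" and fg: "finitely_generated R U"
    using self by (simp_all add: selforthogonal_def)
  have nB: "left_noetherian ?B" using assms(2,4) by (simp add: right_noetherian_def)
  then have ring_B: "ring ?B" by (simp add: left_noetherian_def)
  obtain V :: "nat \<Rightarrow> ('r, ('r, 'm) univ) module" and e d where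
    "(\<forall>i. in_add R U (V i)) \<and>
      e \<in> mod_hom R (regular_module R) (V 0) \<and>
      (\<forall>i. d i \<in> mod_hom R (V i) (V (Suc i))) \<and>
      inj_on e (carrier R) \<and>
      exact_at (regular_module R) e (V 0) (d 0) (V 1) \<and>
      (\<forall>i. exact_at (V i) (d i) (V (Suc i)) (d (Suc i)) (V (Suc (Suc i)))) \<and>
      pullback (regular_module R) e ` mod_hom R (V 0) U = mod_hom R (regular_module R) U \<and>
      exact_at (hom_group R (V 1) U) (pullback (V 0) (d 0)) (hom_group R (V 0) U)
        (pullback (regular_module R) e) (hom_group R (regular_module R) U) \<and>
      (\<forall>i. exact_at (hom_group R (V (Suc (Suc i))) U) (pullback (V (Suc i)) (d (Suc i)))
        (hom_group R (V (Suc i)) U) (pullback (V i) (d i)) (hom_group R (V i) U))"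
    using assms(1) unfolding generalized_tilting_def by (elim exE conjE) blast
  note t = this
  have V: "left_module R (V i)" for i using t by (simp add: in_add_def)
  interpret tilting_coresolution R U V e d
  proof (rule tilting_coresolution.intro, rule endo_context.intro[OF U ring_B],
      rule tilting_coresolution_axioms.intro)
    show "lhom R (regular_module R) (V 0) e"
      using t mod_hom_lhom[OF _ left_module_regular[OF left_module_ring[OF U]] V] by blast
    show "lhom R (V i) (V (Suc i)) (d i)" for i using t mod_hom_lhom[OF _ V V] by blast
  qed (use t in \<open>simp_all add: exact_at_def hom_group_def\<close>)
  have bal: "balanced_bimodule R ?B U ?W"
    by (rule balanced[OF left_noetherian_noeth[OF assms(3)] left_noetherian_noeth[OF nB] fg])
  obtain m where m: "id_le R U m" "injective_dimension R U = enat m" "\<And>k. id_le R U k \<Longrightarrow> m \<le> k"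
    by (rule injective_dimension_finite[OF assms(5)]) (rule that)
  have "injective_dimension ?B ?W < \<infinity>" using assms(2,6) by (simp add: right_injective_dimension_def)
  then obtain q where q: "id_le ?B ?W q" "injective_dimension ?B ?W = enat q" "\<And>k. id_le ?B ?W k \<Longrightarrow> q \<le> k"
    by (rule injective_dimension_finite) (rule that)
  obtain G :: "nat \<Rightarrow> ('r, ('r, 'm) univ) module" and \<delta> \<iota>
    where G: "coresolution R G \<delta>" "lhom R U (G 0) \<iota>" "bij_betw \<iota> (carrier U) (carrier (G 0))"
      "\<forall>i>m. carrier (G (Suc i)) = {\<zero>\<^bsub>G (Suc i)\<^esub>}"
    using m(1) unfolding id_le_def by blast
  obtain H :: "nat \<Rightarrow> ('m \<Rightarrow> 'm, ('m \<Rightarrow> 'm, 'm) univ) module" and \<epsilon> \<kappa>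
    where H: "coresolution ?B H \<epsilon>" "lhom ?B ?W (H 0) \<kappa>" "bij_betw \<kappa> (carrier ?W) (carrier (H 0))"
      "\<forall>i>q. carrier (H (Suc i)) = {\<zero>\<^bsub>H (Suc i)\<^esub>}"
    using q(1) unfolding id_le_def by blast
  \<comment> \<open>Over \<open>R\<close> self-orthogonality is part of the hypothesis; over the
    opposite of the endomorphism ring it is derived from the tilting coresolution.\<close>
  have rG: "resolved R G \<delta> U \<iota>"
    by (intro resolved.intro resolved_axioms.intro G(1-3) selforthogonal_lifting[OF self gen G(1-3)])
  have rH: "resolved ?B H \<epsilon> ?W \<kappa>"
    by (intro resolved.intro resolved_axioms.intro H(1-3) lifting_W[OF H(1-3)])
  \<comment> \<open>\<open>m < q\<close> makes \<open>q\<close> positive, so a coresolution of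
    length \<open>q - 1\<close> contradicts the minimality of \<open>q\<close>.\<close>
  have "\<not> m < q"
  proof
    assume "m < q"
    then have "resolved_bimodule R ?B U ?W G \<delta> \<iota> H \<epsilon> \<kappa> m q"
      using G(4) H(4) by (intro resolved_bimodule.intro resolved_bimodule_axioms.intro bal rG rH) simp_all
    then show False using q(3)[OF resolved_bimodule_shorten] \<open>m < q\<close> by fastforce
  qed
  \<comment> \<open>The same with the two rings exchanged, by the symmetry of
    \<open>balanced_bimodule\<close>.\<close>
  moreover have "\<not> q < m"
  proof
    assume "q < m"
    then have "resolved_bimodule ?B R ?W U H \<epsilon> \<kappa> G \<delta> \<iota> q m"
      using G(4) H(4)
      by (intro resolved_bimodule.intro resolved_bimodule_axioms.intro balanced_bimodule.swap[OF bal] rG rH) simp_all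
    then show False using m(3)[OF resolved_bimodule_shorten] \<open>q < m\<close> by fastforce
  qed
  ultimately show ?thesis using m(2) q(2) assms(2) by (simp add: right_injective_dimension_def)
qed

end
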